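(* Let $(M,F)$ be a closed $C^\infty$ Finsler manifold without conjugate points. Assume that the geodesic flow of $(M,F)$ is transitive in $T_1M$, that the Green bundles $G^s$ and $G^u$ of $(M,F)$ are continuous, and that $(M,F)$ has a hyperbolic closed geodesic. If $(M,F)$ has constant $S$-curvature, then $(M,F)$ is Riemannian.
   Context: **Finsler structures.** Let $M$ be an $n$-dimensional smooth manifold and $TM_0=\{(x,y)\in TM: y\neq 0\}$. A $C^k$ Finsler structure on $M$ is a continuous function $F:TM\to[0,\infty)$ such that: $F$ is $C^k$ on $TM_0$; $F(x,\lambda y)=\lambda F(x,y)$ for all $\lambda>0$ (only positive homogeneity; $F(x,-y)$ may differ from $F(x,y)$); and the matrix $g_{ij}(x,y)=\frac12\frac{\partial^2 F^2}{\partial y^i\partial y^j}(x,y)$ is positive definite on $TM_0$. Write $g_{(x,y)}$ for the inner product on $T_xM$ with matrix $g_{ij}(x,y)$. $(M,F)$ is Riemannian if $g_{(x,y)}$ does not depend on $y$, i.e. $F(x,y)=\sqrt{h_x(y,y)}$ for some Riemannian metric $h$ on $M$. Closed means compact without boundary. **Geodesics, conjugate points.** Geodesics are the constant-speed geodesics of $F$ (solutions of the Euler–Lagrange equation of $\frac12F^2$). $T_1M=\{(x,v)\in TM: F(x,v)=1\}$, $\pi:T_1M\to M$ is the projection, and $\phi_t:T_1M\to T_1M$ is the geodesic flow, with generating vector field $X$. The geodesic flow is transitive in $T_1M$ if it has an orbit that is dense in $T_1M$. A Jacobi field along a geodesic $\sigma$ is the variation field of a variation of $\sigma$ through geodesics.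 $(M,F)$ has no conjugate points if no nonzero Jacobi field along any geodesic vanishes at two distinct parameter values. **$S$-curvature.** Fix $x\in M$ and a basis $\{b_i\}$ of $T_xM$. Put $\sigma_{F}(x)=\mathrm{vol}(B^n)/\mathrm{vol}\{(y^i)\in\mathbb{R}^n: F(x,\sum_i y^ib_i)<1\}$, where $B^n$ is the Euclidean unit ball and $\mathrm{vol}$ is Lebesgue measure. The distortion is $\tau(x,y)=\ln\frac{\sqrt{\det(g_{ij}(x,y))}}{\sigma_F(x)}$, with $g_{ij}$ computed in the basis $\{b_i\}$; it does not depend on the basis. The $S$-curvature is $S(x,y)=\frac{d}{dt}\big|_{t=0}\tau(\sigma(t),\sigma'(t))$, where $\sigma$ is the geodesic with $\sigma(0)=x$, $\sigma'(0)=y$. $(M,F)$ has constant $S$-curvature if there is a constant $c\in\mathbb{R}$ with $S=(n+1)cF$ on $TM_0$. **Green bundles.** For $\theta=(x,v)\in T_1M$ let $N(\theta)=\{\xi\in T_\theta T_1M: g_{(x,v)}(v,d\pi_\theta\xi)=0\}$ and $\mathcal V_\theta=\ker d\pi_\theta\subset T_\theta T_1M$ (an $(n-1)$-dimensional subspace of $N(\theta)$). When $(M,F)$ is closed without conjugate points, the limits $$G^s(\theta)=\lim_{t\to+\infty}d\phi_{-t}(\mathcal V_{\phi_t(\theta)}),\qquad G^u(\theta)=\lim_{t\to-\infty}d\phi_{-t}(\mathcal V_{\phi_t(\theta)})$$ exist for every $\theta\in T_1M$ as $(n-1)$-dimensional subspaces of $N(\theta)$ (limits in the Grassmannian), and they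 are $d\phi_t$-invariant; $G^s,G^u$ are called the stable and unstable Green bundles. They are continuous if $\theta\mapsto G^s(\theta)$ and $\theta\mapsto G^u(\theta)$ are continuous sections of the Grassmannian bundle of $(n-1)$-planes in $T(T_1M)$. **Hyperbolicity.** A $\phi_t$-invariant set $\Lambda\subset T_1M$ is hyperbolic if there are constants $C,\lambda>0$ and, for every $\theta\in\Lambda$, subspaces $E^s(\theta),E^u(\theta)\subset T_\theta T_1M$, invariant under $d\phi_t$, with $E^s(\theta)\oplus E^u(\theta)\oplus\mathbb{R}X(\theta)=T_\theta T_1M$, $\|d_\theta\phi_t|_{E^s(\theta)}\|\le Ce^{-\lambda t}$ for $t\ge0$, and $\|d_\theta\phi_t|_{E^u(\theta)}\|\le Ce^{\lambda t}$ for $t\le0$ (norms from a fixed Riemannian metric on the compact manifold $T_1M$). A closed geodesic is hyperbolic if the corresponding periodic orbit of $\phi_t$ in $T_1M$ is a hyperbolic set. *)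

theory Defs
  imports "HOL-Analysis.Analysis" "HOL-Library.Function_Algebras"
begin

section \<open>Functions into a vector space form a vector space\<close>

instantiation "fun" :: (type, real_vector) real_vector
begin

definition scaleR_fun :: "real \<Rightarrow> ('a \<Rightarrow> 'b) \<Rightarrow> 'a \<Rightarrow> 'b"
  where "scaleR_fun r f = (\<lambda>x. r *\<^sub>R f x)"

instance
  by standard
    (auto simp: scaleR_fun_def plus_fun_def fun_eq_iff scaleR_add_right scaleR_add_left)

end


section \<open>Smooth functions between Euclidean spaces\<close>

text \<open>Both notions are meant for open \<open>S\<close>. A function is \<open>C^(k+1)\<close> iff it is differentiable
  and all its directional derivatives are \<open>C^k\<close>.\<close>

primrec Ck_on :: "nat \<Rightarrow> 'e::euclidean_space set \<Rightarrow> ('e \<Rightarrow> 'f::real_normed_vector) \<Rightarrow> bool"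
where
  "Ck_on 0 S f \<longleftrightarrow> continuous_on S f"
| "Ck_on (Suc k) S f \<longleftrightarrow>
     (\<forall>x\<in>S. f differentiable (at x)) \<and> (\<forall>v. Ck_on k S (\<lambda>x. frechet_derivative f (at x) v))"

definition smooth_on :: "'e::euclidean_space set \<Rightarrow> ('e \<Rightarrow> 'f::real_normed_vector) \<Rightarrow> bool"
  where "smooth_on S f \<longleftrightarrow> (\<forall>k. Ck_on k S f)"


section \<open>Smooth manifolds\<close>

text \<open>A chart is a domain together with a coordinate map, of which only the values on the domain
  matter. A manifold modelled on \<open>'e\<close> is given by an atlas; its set of points is the union of the
  chart domains and its topology is the one induced by the charts.\<close>

type_synonym ('a, 'e) chart = "'a set \<times> ('a \<Rightarrow> 'e)"

definition carrier_of :: "('a, 'e) chart set \<Rightarrow> 'a set"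
  where "carrier_of A = (\<Union>c\<in>A. fst c)"

definition chart_inv :: "('a, 'e) chart \<Rightarrow> 'e \<Rightarrow> 'a"
  where "chart_inv c = inv_into (fst c) (snd c)"

definition manifold_topology :: "('a, 'e::topological_space) chart set \<Rightarrow> 'a topology"
  where "manifold_topology A =
    topology_generated_by {fst c \<inter> snd c -` W | c W. c \<in> A \<and> open W}"

definition smooth_manifold :: "('a, 'e::euclidean_space) chart set \<Rightarrow> bool"
  where "smooth_manifold A \<longleftrightarrow>
    (\<forall>c\<in>A. inj_on (snd c) (fst c) \<and> open (snd c ` fst c)) \<and>
    (\<forall>c\<in>A. \<forall>d\<in>A. open (snd c ` (fst c \<inter> fst d)) \<and>
       smooth_on (snd c ` (fst c \<inter> fst d)) (snd d \<circ> chart_inv c)) \<and>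
    Hausdorff_space (manifold_topology A) \<and> second_countable (manifold_topology A)"

definition closed_manifold :: "('a, 'e::euclidean_space) chart set \<Rightarrow> bool"
  where "closed_manifold A \<longleftrightarrow> smooth_manifold A \<and> compact_space (manifold_topology A)"

text \<open>Smoothness of a real-valued function on an open subset \<open>S\<close> of a manifold, and of a map from
  an open subset \<open>S\<close> of a Euclidean space into a manifold. In the latter case the openness of the
  preimages of the chart domains provides continuity.\<close>

definition smooth_fun_on :: "('a, 'e::euclidean_space) chart set \<Rightarrow> 'a set \<Rightarrow> ('a \<Rightarrow> real) \<Rightarrow> bool"
  where "smooth_fun_on A S f \<longleftrightarrow> (\<forall>c\<in>A. smooth_on (snd c ` (fst c \<inter> S)) (f \<circ> chart_inv c))"

definition smooth_into ::
    "('a, 'e::euclidean_space) chart set \<Rightarrow> 'd::euclidean_space set \<Rightarrow> ('d \<Rightarrow> 'a) \<Rightarrow> bool"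
  where "smooth_into A S f \<longleftrightarrow> f ` S \<subseteq> carrier_of A \<and>
    (\<forall>c\<in>A. open (S \<inter> f -` fst c) \<and> smooth_on (S \<inter> f -` fst c) (snd c \<circ> f))"


section \<open>Tangent vectors and the tangent bundle\<close>

text \<open>A tangent vector at \<open>p\<close> is the family of its coordinates in all charts around \<open>p\<close>, related by
  the usual transformation law (and set to \<open>0\<close> at all other arguments). The vector
  space operations are those of the function space.\<close>

type_synonym ('a, 'e) tangent_vector = "('a, 'e) chart \<Rightarrow> 'e"

type_synonym ('a, 'e) tangent_point = "'a \<times> ('a, 'e) tangent_vector"

definition tangent_space ::
    "('a, 'e::euclidean_space) chart set \<Rightarrow> 'a \<Rightarrow> ('a, 'e) tangent_vector set"
  where "tangent_space A p = {v.
    (\<forall>c. c \<notin> A \<or> p \<notin> fst c \<longrightarrow> v c = 0) \<and>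
    (\<forall>c\<in>A. \<forall>d\<in>A. p \<in> fst c \<longrightarrow> p \<in> fst d \<longrightarrow>
       v d = frechet_derivative (snd d \<circ> chart_inv c) (at (snd c p)) (v c))}"

definition coord_vector ::
    "('a, 'e::euclidean_space) chart set \<Rightarrow> ('a, 'e) chart \<Rightarrow> 'a \<Rightarrow> 'e \<Rightarrow> ('a, 'e) tangent_vector"
  where "coord_vector A c p u = (\<lambda>d. if d \<in> A \<and> p \<in> fst d
    then frechet_derivative (snd d \<circ> chart_inv c) (at (snd c p)) u else 0)"

definition tangent_bundle ::
    "('a, 'e::euclidean_space) chart set \<Rightarrow> ('a, 'e) tangent_point set"
  where "tangent_bundle A = {(p, v). p \<in> carrier_of A \<and> v \<in> tangent_space A p}"

definition slit_tangent_bundle ::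
    "('a, 'e::euclidean_space) chart set \<Rightarrow> ('a, 'e) tangent_point set"
  where "slit_tangent_bundle A = {(p, v) \<in> tangent_bundle A. v \<noteq> 0}"

text \<open>The tangent bundle is itself a manifold, with charts \<open>(x, y)\<close> induced by the charts \<open>x\<close>.\<close>

definition tangent_chart ::
    "('a, 'e::euclidean_space) chart set \<Rightarrow> ('a, 'e) chart \<Rightarrow> (('a, 'e) tangent_point, 'e \<times> 'e) chart"
  where "tangent_chart A c =
    ({(p, v). p \<in> fst c \<and> v \<in> tangent_space A p}, \<lambda>(p, v). (snd c p, v c))"

definition tangent_atlas ::
    "('a, 'e::euclidean_space) chart set \<Rightarrow> (('a, 'e) tangent_point, 'e \<times> 'e) chart set"
  where "tangent_atlas A = tangent_chart A ` A"

text \<open>Differentials are computed in an arbitrary chart around the base point.\<close>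

definition directional_deriv ::
    "('a, 'e::euclidean_space) chart set \<Rightarrow> ('a \<Rightarrow> 'f::real_normed_vector) \<Rightarrow> 'a \<Rightarrow>
      ('a, 'e) tangent_vector \<Rightarrow> 'f"
  where "directional_deriv A f p \<xi> =
    (let c = (SOME c. c \<in> A \<and> p \<in> fst c)
     in frechet_derivative (f \<circ> chart_inv c) (at (snd c p)) (\<xi> c))"

definition differential ::
    "('a, 'e::euclidean_space) chart set \<Rightarrow> ('b, 'f::euclidean_space) chart set \<Rightarrow> ('a \<Rightarrow> 'b) \<Rightarrow> 'a \<Rightarrow>
      ('a, 'e) tangent_vector \<Rightarrow> ('b, 'f) tangent_vector"
  where "differential A B f p \<xi> =
    (\<lambda>d. if d \<in> B \<and> f p \<in> fst d then directional_deriv A (snd d \<circ> f) p \<xi> else 0)"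

definition velocity ::
    "('a, 'e::euclidean_space) chart set \<Rightarrow> (real \<Rightarrow> 'a) \<Rightarrow> real \<Rightarrow> ('a, 'e) tangent_vector"
  where "velocity A \<gamma> t =
    (\<lambda>c. if c \<in> A \<and> \<gamma> t \<in> fst c then vector_derivative (snd c \<circ> \<gamma>) (at t) else 0)"

definition canonical_lift ::
    "('a, 'e::euclidean_space) chart set \<Rightarrow> (real \<Rightarrow> 'a) \<Rightarrow> real \<Rightarrow> ('a, 'e) tangent_point"
  where "canonical_lift A \<gamma> t = (\<gamma> t, velocity A \<gamma> t)"

definition riemannian_metric ::
    "('a, 'e::euclidean_space) chart set \<Rightarrow>
      ('a \<Rightarrow> ('a, 'e) tangent_vector \<Rightarrow> ('a, 'e) tangent_vector \<Rightarrow> real) \<Rightarrow> bool"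
  where "riemannian_metric A h \<longleftrightarrow>
    (\<forall>p\<in>carrier_of A.
       (\<forall>u\<in>tangent_space A p. \<forall>v\<in>tangent_space A p. h p u v = h p v u) \<and>
       (\<forall>u\<in>tangent_space A p. \<forall>v\<in>tangent_space A p. \<forall>w\<in>tangent_space A p. \<forall>a b.
          h p (a *\<^sub>R u + b *\<^sub>R v) w = a * h p u w + b * h p v w) \<and>
       (\<forall>u\<in>tangent_space A p. u \<noteq> 0 \<longrightarrow> h p u u > 0)) \<and>
    (\<forall>c\<in>A. \<forall>u w. smooth_on (snd c ` fst c)
       (\<lambda>x. let p = chart_inv c x in h p (coord_vector A c p u) (coord_vector A c p w)))"


section \<open>The Grassmannian bundle of tangent planes\<close>

text \<open>A subspace of a Euclidean space is identified with its orthogonal projection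
  (\<^const>\<open>closest_point\<close>); the topology of the Grassmannian is that of the projections
  (with the operator norm), and the bundle topology is obtained from the local
  trivialisations given by the charts.\<close>

definition grassmann_bundle ::
    "('a, 'e::euclidean_space) chart set \<Rightarrow> nat \<Rightarrow> ('a \<times> ('a, 'e) tangent_vector set) set"
  where "grassmann_bundle A k = {(p, E).
    p \<in> carrier_of A \<and> subspace E \<and> E \<subseteq> tangent_space A p \<and> dim E = k}"

definition grassmann_topology ::
    "('a, 'e::euclidean_space) chart set \<Rightarrow> nat \<Rightarrow> ('a \<times> ('a, 'e) tangent_vector set) topology"
  where "grassmann_topology A k = topology_generated_by
    {{(p, E) \<in> grassmann_bundle A k. p \<in> fst c \<and>
        (snd c p, Blinfun (closest_point ((\<lambda>\<xi>. \<xi> c) ` E))) \<in> W} | c W. c \<in> A \<and> open W}"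


section \<open>Finsler structures\<close>

type_synonym ('a, 'n) finsler = "('a, real^'n) tangent_point \<Rightarrow> real"

text \<open>The second derivative of \<open>F^2/2\<close> along the fibre in the directions \<open>u\<close>, \<open>w\<close>. For vectors of a
  basis of the tangent space these are the second partial derivatives in the coordinates \<open>y\<^sup>i\<close>
  belonging to this basis.\<close>

definition fundamental_tensor ::
    "('a, 'n::finite) finsler \<Rightarrow> ('a, real^'n) tangent_point \<Rightarrow>
      ('a, real^'n) tangent_vector \<Rightarrow> ('a, real^'n) tangent_vector \<Rightarrow> real"
  where "fundamental_tensor F \<theta> u w = (1/2) *
    deriv (\<lambda>s. deriv (\<lambda>t. (F (fst \<theta>, snd \<theta> + s *\<^sub>R u + t *\<^sub>R w))\<^sup>2) 0) 0"

definition tangent_basis ::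
    "('a, real^'n::finite) chart set \<Rightarrow> 'a \<Rightarrow> ('n \<Rightarrow> ('a, real^'n) tangent_vector) \<Rightarrow> bool"
  where "tangent_basis A p b \<longleftrightarrow>
    inj b \<and> independent (range b) \<and> span (range b) = tangent_space A p"

definition fundamental_matrix ::
    "('a, 'n::finite) finsler \<Rightarrow> ('n \<Rightarrow> ('a, real^'n) tangent_vector) \<Rightarrow>
      ('a, real^'n) tangent_point \<Rightarrow> real^'n^'n"
  where "fundamental_matrix F b \<theta> = (\<chi> i j. fundamental_tensor F \<theta> (b i) (b j))"

definition finsler_structure ::
    "('a, real^'n::finite) chart set \<Rightarrow> ('a, 'n) finsler \<Rightarrow> bool"
  where "finsler_structure A F \<longleftrightarrow>
    (\<forall>\<theta>\<in>tangent_bundle A. F \<theta> \<ge> 0) \<and>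
    continuous_map (manifold_topology (tangent_atlas A)) euclideanreal F \<and>
    smooth_fun_on (tangent_atlas A) (slit_tangent_bundle A) F \<and>
    (\<forall>(p, v)\<in>tangent_bundle A. \<forall>\<mu>>0. F (p, \<mu> *\<^sub>R v) = \<mu> * F (p, v)) \<and>
    (\<forall>\<theta>\<in>slit_tangent_bundle A. \<forall>b. tangent_basis A (fst \<theta>) b \<longrightarrow>
       (\<forall>\<eta>. \<eta> \<noteq> 0 \<longrightarrow> \<eta> \<bullet> (fundamental_matrix F b \<theta> *v \<eta>) > 0))"

definition riemannian_finsler ::
    "('a, real^'n::finite) chart set \<Rightarrow> ('a, 'n) finsler \<Rightarrow> bool"
  where "riemannian_finsler A F \<longleftrightarrow>
    (\<exists>h. riemannian_metric A h \<and> (\<forall>(p, v)\<in>tangent_bundle A. F (p, v) = sqrt (h p v v)))"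

definition unit_tangent_bundle ::
    "('a, real^'n::finite) chart set \<Rightarrow> ('a, 'n) finsler \<Rightarrow> ('a, real^'n) tangent_point set"
  where "unit_tangent_bundle A F = {\<theta> \<in> tangent_bundle A. F \<theta> = 1}"


section \<open>Geodesics, Jacobi fields and the geodesic flow\<close>

definition energy_in_chart ::
    "('a, real^'n::finite) chart set \<Rightarrow> ('a, 'n) finsler \<Rightarrow> ('a, real^'n) chart \<Rightarrow>
      (real^'n) \<times> (real^'n) \<Rightarrow> real"
  where "energy_in_chart A F c z = (1/2) * (F (chart_inv (tangent_chart A c) z))\<^sup>2"

text \<open>Regular solutions, defined on the whole real line, of the Euler-Lagrange equations
  \<open>d/dt (\<partial>L/\<partial>y\<^sup>i (x, x')) = \<partial>L/\<partial>x\<^sup>i (x, x')\<close> of \<open>L = F^2/2\<close>; they automatically have constant speed.\<close>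

definition geodesic ::
    "('a, real^'n::finite) chart set \<Rightarrow> ('a, 'n) finsler \<Rightarrow> (real \<Rightarrow> 'a) \<Rightarrow> bool"
  where "geodesic A F \<sigma> \<longleftrightarrow> smooth_into A UNIV \<sigma> \<and> (\<forall>t. velocity A \<sigma> t \<noteq> 0) \<and>
    (\<forall>c\<in>A. \<forall>t. \<sigma> t \<in> fst c \<longrightarrow>
      (let z = (\<lambda>s. snd (tangent_chart A c) (canonical_lift A \<sigma> s));
           dL = (\<lambda>s. frechet_derivative (energy_in_chart A F c) (at (z s)))
       in \<forall>i. ((\<lambda>s. dL s (0, axis i 1)) has_real_derivative dL t (axis i 1, 0)) (at t)))"

definition jacobi_field ::
    "('a, real^'n::finite) chart set \<Rightarrow> ('a, 'n) finsler \<Rightarrow> (real \<Rightarrow> 'a) \<Rightarrow>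
      (real \<Rightarrow> ('a, real^'n) tangent_vector) \<Rightarrow> bool"
  where "jacobi_field A F \<sigma> J \<longleftrightarrow>
    (\<exists>\<Gamma>. \<exists>\<epsilon>>0. smooth_into A ({-\<epsilon><..<\<epsilon>} \<times> UNIV) \<Gamma> \<and>
       (\<forall>s\<in>{-\<epsilon><..<\<epsilon>}. geodesic A F (\<lambda>t. \<Gamma> (s, t))) \<and>
       (\<forall>t. \<Gamma> (0, t) = \<sigma> t) \<and>
       (\<forall>t. J t = velocity A (\<lambda>s. \<Gamma> (s, t)) 0))"

definition no_conjugate_points ::
    "('a, real^'n::finite) chart set \<Rightarrow> ('a, 'n) finsler \<Rightarrow> bool"
  where "no_conjugate_points A F \<longleftrightarrow>
    (\<forall>\<sigma> J. geodesic A F \<sigma> \<and> jacobi_field A F \<sigma> J \<and> (\<exists>t. J t \<noteq> 0) \<longrightarrow>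
       \<not> (\<exists>a b. a \<noteq> b \<and> J a = 0 \<and> J b = 0))"

text \<open>The flow on the slit tangent bundle. Its restriction to the unit tangent bundle is the flow
  \<open>\<phi>\<^sub>t\<close>, and the differential of \<open>\<phi>\<^sub>t\<close> is the restriction of the differential of this flow.\<close>

definition geodesic_flow ::
    "('a, real^'n::finite) chart set \<Rightarrow> ('a, 'n) finsler \<Rightarrow> real \<Rightarrow>
      ('a, real^'n) tangent_point \<Rightarrow> ('a, real^'n) tangent_point"
  where "geodesic_flow A F t \<theta> = (THE \<eta>. \<exists>\<sigma>. geodesic A F \<sigma> \<and>
    canonical_lift A \<sigma> 0 = \<theta> \<and> canonical_lift A \<sigma> t = \<eta>)"

definition flow_differential ::
    "('a, real^'n::finite) chart set \<Rightarrow> ('a, 'n) finsler \<Rightarrow> real \<Rightarrow> ('a, real^'n) tangent_point \<Rightarrow>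
      (('a, real^'n) tangent_point, (real^'n) \<times> (real^'n)) tangent_vector \<Rightarrow>
      (('a, real^'n) tangent_point, (real^'n) \<times> (real^'n)) tangent_vector"
  where "flow_differential A F t =
    differential (tangent_atlas A) (tangent_atlas A) (geodesic_flow A F t)"

definition flow_generator ::
    "('a, real^'n::finite) chart set \<Rightarrow> ('a, 'n) finsler \<Rightarrow> ('a, real^'n) tangent_point \<Rightarrow>
      (('a, real^'n) tangent_point, (real^'n) \<times> (real^'n)) tangent_vector"
  where "flow_generator A F \<theta> = velocity (tangent_atlas A) (\<lambda>t. geodesic_flow A F t \<theta>) 0"

definition transitive_geodesic_flow ::
    "('a, real^'n::finite) chart set \<Rightarrow> ('a, 'n) finsler \<Rightarrow> bool"
  where "transitive_geodesic_flow A F \<longleftrightarrow>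
    (\<exists>\<theta>\<in>unit_tangent_bundle A F.
       subtopology (manifold_topology (tangent_atlas A)) (unit_tangent_bundle A F)
         closure_of range (\<lambda>t. geodesic_flow A F t \<theta>) = unit_tangent_bundle A F)"


section \<open>S-curvature\<close>

definition busemann_hausdorff_density ::
    "('a, 'n::finite) finsler \<Rightarrow> 'a \<Rightarrow> ('n \<Rightarrow> ('a, real^'n) tangent_vector) \<Rightarrow> real"
  where "busemann_hausdorff_density F p b =
    measure lborel (ball (0::real^'n) 1) /
    measure lborel {y::real^'n. F (p, \<Sum>i\<in>UNIV. (y $ i) *\<^sub>R b i) < 1}"

text \<open>The distortion does not depend on the basis used to compute it.\<close>

definition distortion ::
    "('a, real^'n::finite) chart set \<Rightarrow> ('a, 'n) finsler \<Rightarrow> ('a, real^'n) tangent_point \<Rightarrow> real"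
  where "distortion A F \<theta> =
    (let b = (SOME b. tangent_basis A (fst \<theta>) b)
     in ln (sqrt (det (fundamental_matrix F b \<theta>)) / busemann_hausdorff_density F (fst \<theta>) b))"

definition S_curvature ::
    "('a, real^'n::finite) chart set \<Rightarrow> ('a, 'n) finsler \<Rightarrow> ('a, real^'n) tangent_point \<Rightarrow> real"
  where "S_curvature A F \<theta> = deriv (\<lambda>t. distortion A F (geodesic_flow A F t \<theta>)) 0"

definition constant_S_curvature ::
    "('a, real^'n::finite) chart set \<Rightarrow> ('a, 'n) finsler \<Rightarrow> bool"
  where "constant_S_curvature A F \<longleftrightarrow>
    (\<exists>c. \<forall>\<theta>\<in>slit_tangent_bundle A. S_curvature A F \<theta> = (real CARD('n) + 1) * c * F \<theta>)"


section \<open>Green bundles\<close>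

text \<open>The unit tangent bundle is a regular level set of \<open>F\<close>, so its tangent spaces are the kernels
  of the differential of \<open>F\<close>.\<close>

definition unit_tangent_space ::
    "('a, real^'n::finite) chart set \<Rightarrow> ('a, 'n) finsler \<Rightarrow> ('a, real^'n) tangent_point \<Rightarrow>
      (('a, real^'n) tangent_point, (real^'n) \<times> (real^'n)) tangent_vector set"
  where "unit_tangent_space A F \<theta> =
    {\<xi> \<in> tangent_space (tangent_atlas A) \<theta>. directional_deriv (tangent_atlas A) F \<theta> \<xi> = 0}"

abbreviation projection_differential ::
    "('a, real^'n::finite) chart set \<Rightarrow> ('a, real^'n) tangent_point \<Rightarrow>
      (('a, real^'n) tangent_point, (real^'n) \<times> (real^'n)) tangent_vector \<Rightarrow>
      ('a, real^'n) tangent_vector"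
  where "projection_differential A \<equiv> differential (tangent_atlas A) A fst"

definition normal_bundle ::
    "('a, real^'n::finite) chart set \<Rightarrow> ('a, 'n) finsler \<Rightarrow> ('a, real^'n) tangent_point \<Rightarrow>
      (('a, real^'n) tangent_point, (real^'n) \<times> (real^'n)) tangent_vector set"
  where "normal_bundle A F \<theta> = {\<xi> \<in> unit_tangent_space A F \<theta>.
    fundamental_tensor F \<theta> (snd \<theta>) (projection_differential A \<theta> \<xi>) = 0}"

definition vertical_bundle ::
    "('a, real^'n::finite) chart set \<Rightarrow> ('a, 'n) finsler \<Rightarrow> ('a, real^'n) tangent_point \<Rightarrow>
      (('a, real^'n) tangent_point, (real^'n) \<times> (real^'n)) tangent_vector set"
  where "vertical_bundle A F \<theta> =
    {\<xi> \<in> unit_tangent_space A F \<theta>. projection_differential A \<theta> \<xi> = 0}"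

text \<open>The limit of \<open>d\<phi>\<^sub>-\<^sub>t(V(\<phi>\<^sub>t(\<theta>)))\<close> along a filter of times \<open>t\<close>: \<open>at_top\<close> yields the stable and
  \<open>at_bot\<close> the unstable Green bundle.\<close>

definition green_bundle ::
    "real filter \<Rightarrow> ('a, real^'n::finite) chart set \<Rightarrow> ('a, 'n) finsler \<Rightarrow>
      ('a, real^'n) tangent_point \<Rightarrow>
      (('a, real^'n) tangent_point, (real^'n) \<times> (real^'n)) tangent_vector set"
  where "green_bundle \<F> A F \<theta> = (THE G. G \<subseteq> normal_bundle A F \<theta> \<and>
    limitin (grassmann_topology (tangent_atlas A) (CARD('n) - 1))
      (\<lambda>t. (\<theta>, flow_differential A F (- t) (geodesic_flow A F t \<theta>) `
                 vertical_bundle A F (geodesic_flow A F t \<theta>)))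
      (\<theta>, G) \<F>)"

abbreviation "stable_green_bundle \<equiv> green_bundle at_top"
abbreviation "unstable_green_bundle \<equiv> green_bundle at_bot"

definition continuous_on_unit_bundle ::
    "('a, real^'n::finite) chart set \<Rightarrow> ('a, 'n) finsler \<Rightarrow>
      (('a, real^'n) tangent_point \<Rightarrow>
        (('a, real^'n) tangent_point, (real^'n) \<times> (real^'n)) tangent_vector set) \<Rightarrow> bool"
  where "continuous_on_unit_bundle A F G \<longleftrightarrow>
    continuous_map
      (subtopology (manifold_topology (tangent_atlas A)) (unit_tangent_bundle A F))
      (grassmann_topology (tangent_atlas A) (CARD('n) - 1))
      (\<lambda>\<theta>. (\<theta>, G \<theta>))"


section \<open>Hyperbolicity\<close>

text \<open>The metric on the unit tangent bundle is taken to be the one induced by a Riemannian metric \<open>h\<close>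
  on the tangent bundle; every metric on this closed submanifold is of this form, and by
  compactness the choice of \<open>h\<close> is immaterial.\<close>

definition hyperbolic_set ::
    "('a, real^'n::finite) chart set \<Rightarrow> ('a, 'n) finsler \<Rightarrow> ('a, real^'n) tangent_point set \<Rightarrow> bool"
  where "hyperbolic_set A F \<Lambda> \<longleftrightarrow>
    \<Lambda> \<subseteq> unit_tangent_bundle A F \<and> (\<forall>t. geodesic_flow A F t ` \<Lambda> \<subseteq> \<Lambda>) \<and>
    (\<exists>h. riemannian_metric (tangent_atlas A) h \<and>
      (\<exists>C>0. \<exists>\<mu>>0. \<exists>Es Eu. \<forall>\<theta>\<in>\<Lambda>.
         subspace (Es \<theta>) \<and> Es \<theta> \<subseteq> unit_tangent_space A F \<theta> \<and>
         subspace (Eu \<theta>) \<and> Eu \<theta> \<subseteq> unit_tangent_space A F \<theta> \<and>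
         (\<forall>t. flow_differential A F t \<theta> ` Es \<theta> = Es (geodesic_flow A F t \<theta>)) \<and>
         (\<forall>t. flow_differential A F t \<theta> ` Eu \<theta> = Eu (geodesic_flow A F t \<theta>)) \<and>
         (\<forall>\<xi>\<in>unit_tangent_space A F \<theta>. \<exists>u\<in>Es \<theta>. \<exists>v\<in>Eu \<theta>. \<exists>r.
            \<xi> = u + v + r *\<^sub>R flow_generator A F \<theta>) \<and>
         (\<forall>u\<in>Es \<theta>. \<forall>v\<in>Eu \<theta>. \<forall>r. u + v + r *\<^sub>R flow_generator A F \<theta> = 0 \<longrightarrow>
            u = 0 \<and> v = 0 \<and> r = 0) \<and>
         (let nrm = (\<lambda>\<eta> \<xi>. sqrt (h \<eta> \<xi> \<xi>)) in
            (\<forall>t\<ge>0. \<forall>\<xi>\<in>Es \<theta>. nrm (geodesic_flow A F t \<theta>) (flow_differential A F t \<theta> \<xi>)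
               \<le> C * exp (- \<mu> * t) * nrm \<theta> \<xi>) \<and>
            (\<forall>t\<le>0. \<forall>\<xi>\<in>Eu \<theta>. nrm (geodesic_flow A F t \<theta>) (flow_differential A F t \<theta> \<xi>)
               \<le> C * exp (\<mu> * t) * nrm \<theta> \<xi>))))"

definition hyperbolic_closed_geodesic ::
    "('a, real^'n::finite) chart set \<Rightarrow> ('a, 'n) finsler \<Rightarrow> (real \<Rightarrow> 'a) \<Rightarrow> bool"
  where "hyperbolic_closed_geodesic A F \<sigma> \<longleftrightarrow>
    geodesic A F \<sigma> \<and> (\<forall>t. F (canonical_lift A \<sigma> t) = 1) \<and>
    (\<exists>T>0. \<forall>t. \<sigma> (t + T) = \<sigma> t) \<and>
    hyperbolic_set A F (range (canonical_lift A \<sigma>))"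

end

theory Submission
  imports Defs
begin

text \<open>
  Along a geodesic the S-curvature is the derivative of the distortion \<open>\<tau>\<close>, so constant S-curvature means
  that \<open>\<tau>\<close> changes at the constant rate \<open>(n + 1) c\<close> along unit speed geodesics
  (\<open>distortion_along_geodesic\<close>). On a closed geodesic \<open>\<tau>\<close> is periodic, which forces \<open>c = 0\<close>. Then \<open>\<tau>\<close> is
  constant on a dense orbit and, being continuous, on the whole unit tangent bundle. In a single tangent
  space the volume factor of \<open>\<tau>\<close> is a constant, so the determinant of the fundamental tensor \<open>g\<close> does not depend
  on the direction \<open>y\<close>. By Deicke's theorem \<open>g\<close> itself does not depend on \<open>y\<close>
  (\<open>hessian_const_if_distortion_const\<close>), and then \<open>F\<^sup>2\<close> is a quadratic form on each tangent space
  (\<open>riemannian_if_fibre_hessian_const\<close>).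

  Deicke's theorem (\<open>deicke\<close>) is proved by integration over a shell. Let \<open>h\<close> be the inverse of \<open>g\<close> and
  \<open>f = g\<^sub>\<xi>\<^sub>\<xi>\<close> for a fixed vector \<open>\<xi>\<close>. Differentiating the constant \<open>log det g\<close> once shows that the matrix \<open>h\<close> is
  divergence free (\<open>div_h\<close>); differentiating twice shows that \<open>\<Sum> h\<^sub>k\<^sub>l \<partial>\<^sub>k \<partial>\<^sub>l f\<close> is the squared norm
  of \<open>\<partial>\<^sub>\<xi> g\<close> with respect to \<open>h\<close> (\<open>subsolution\<close>). The field \<open>h \<nabla>f\<close> is tangent to the level sets of \<open>F\<close>, because
  \<open>f\<close> is constant on rays. So the integral of this squared norm, weighted by a cutoff function of \<open>F\<close>, is zero
  and \<open>\<partial>\<^sub>\<xi> g\<close> vanishes (\<open>dg_eq_0\<close>).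

  Two analytic facts connect this with the definitions. The distortion has to be differentiable, which
  comes down to the volume of the unit balls (\<open>vol_differentiable\<close>). And the geodesic flow is given by
  a definite description, so it has to be shown that a geodesic is determined by its initial
  velocity (\<open>geodesic_unique\<close>); the existence of a geodesic for the dense orbit follows from the
  density of this orbit (\<open>dense_orbit_geodesic\<close>).
\<close>

section \<open>Calculus of smooth functions\<close>

text \<open>The derivative in direction \<open>v\<close> as a function of the point, so that it can be iterated.\<close>

abbreviation dd :: "('e::real_normed_vector \<Rightarrow> 'f::real_normed_vector) \<Rightarrow> 'e \<Rightarrow> 'e \<Rightarrow> 'f"
  where "dd f v \<equiv> (\<lambda>x. frechet_derivative f (at x) v)"

lemma frechet_derivative_cong_open:
  assumes "open S" "x \<in> S" "\<And>y. y \<in> S \<Longrightarrow> f y = g y" "f differentiable (at x)"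
  shows "frechet_derivative f (at x) = frechet_derivative g (at x)" "g differentiable (at x)"
proof -
  have d: "(f has_derivative frechet_derivative f (at x)) (at x)"
    using assms(4) frechet_derivative_works by blast
  have "(g has_derivative frechet_derivative f (at x)) (at x)"
    by (rule has_derivative_transform_within_open[OF d assms(1,2)]) (use assms(3) in auto)
  then show "frechet_derivative f (at x) = frechet_derivative g (at x)" "g differentiable (at x)"
    using frechet_derivative_at differentiableI by blast+
qed

lemma Ck_on_cong:
  assumes "open S" "\<And>y. y \<in> S \<Longrightarrow> f y = g y" "Ck_on k S f"
  shows "Ck_on k S g"
  using assms(2,3)
proof (induction k arbitrary: f g)
  case 0
  then show ?case by (simp cong: continuous_on_cong)
next
  case (Suc k)
  have *: "frechet_derivative f (at x) = frechet_derivative g (at x)" "g differentiable (at x)"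
    if "x \<in> S" for x
    using frechet_derivative_cong_open[OF assms(1) that, of f g] Suc.prems that by auto
  show ?case
  proof (simp, intro conjI ballI allI)
    show "Ck_on k S (\<lambda>x. dd g v x)" for v
      by (rule Suc.IH[of "\<lambda>x. dd f v x"]) (use Suc.prems(2) * in auto)
  qed (use * in blast)
qed

lemma Ck_on_SucD: "Ck_on (Suc k) S f \<Longrightarrow> Ck_on k S f"
proof (induction k arbitrary: f)
  case 0
  then show ?case
    by (auto intro!: differentiable_imp_continuous_on differentiable_at_imp_differentiable_on)
next
  case (Suc k)
  then show ?case by simp
qed

lemma Ck_on_subset: "Ck_on k S f \<Longrightarrow> T \<subseteq> S \<Longrightarrow> Ck_on k T f"
  by (induction k arbitrary: f) (auto intro: continuous_on_subset)

lemma Ck_on_const: "Ck_on k S (\<lambda>x. c)"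
  by (induction k arbitrary: c) auto

lemma Ck_on_add:
  assumes "open S" "Ck_on k S f" "Ck_on k S g"
  shows "Ck_on k S (\<lambda>x. f x + g x)"
  using assms(2,3)
proof (induction k arbitrary: f g)
  case 0
  then show ?case by (auto intro: continuous_intros)
next
  case (Suc k)
  have eq: "dd f v x + dd g v x
      = frechet_derivative (\<lambda>x. f x + g x) (at x) v" if "x \<in> S" for x v
  proof -
    have df: "(f has_derivative frechet_derivative f (at x)) (at x)" and dg: "(g has_derivative frechet_derivative g (at x)) (at x)"
      using Suc.prems that frechet_derivative_works by (metis Ck_on.simps(2))+
    have "((\<lambda>x. f x + g x) has_derivative (\<lambda>v. dd f v x + dd g v x)) (at x)"
      using df dg by (rule has_derivative_add)
    from fun_cong[OF frechet_derivative_at[OF this], of v] show ?thesis by simp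
  qed
  then show ?case
    using Suc.prems Suc.IH Ck_on_cong[OF assms(1) eq] by (simp add: differentiable_add)
qed

lemma Ck_on_mult:
  fixes f g :: "'e::euclidean_space \<Rightarrow> real"
  assumes "open S" "Ck_on k S f" "Ck_on k S g"
  shows "Ck_on k S (\<lambda>x. f x * g x)"
  using assms(2,3)
proof (induction k arbitrary: f g)
  case 0
  then show ?case by (auto intro: continuous_intros)
next
  case (Suc k)
  have eq: "f x * dd g v x + dd f v x * g x
      = frechet_derivative (\<lambda>x. f x * g x) (at x) v" if "x \<in> S" for x v
  proof -
    have df: "(f has_derivative frechet_derivative f (at x)) (at x)" and dg: "(g has_derivative frechet_derivative g (at x)) (at x)"
      using Suc.prems that frechet_derivative_works by (metis Ck_on.simps(2))+
    have "((\<lambda>x. f x * g x) has_derivative (\<lambda>v. f x * dd g v x + dd f v x * g x)) (at x)"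
      using df dg by (rule has_derivative_mult)
    from fun_cong[OF frechet_derivative_at[OF this], of v] show ?thesis by simp
  qed
  have "Ck_on k S (\<lambda>x. f x * dd g v x + dd f v x * g x)" for v
    by (intro Ck_on_add Suc.IH assms Ck_on_SucD[OF Suc.prems(1)] Ck_on_SucD[OF Suc.prems(2)]) (use Suc.prems in auto)
  then show ?case
    using Suc.prems Ck_on_cong[OF assms(1) eq] by (simp add: differentiable_mult)
qed

lemma Ck_on_affine_comp:
  fixes l :: "'d::euclidean_space \<Rightarrow> 'e::euclidean_space"
  assumes "bounded_linear l" "open S" "Ck_on k S f"
  shows "Ck_on k ((\<lambda>x. a + l x) -` S) (\<lambda>x. f (a + l x))"
  using assms(3)
proof (induction k arbitrary: f)
  case 0
  then show ?case
    by (auto intro!: continuous_on_compose2[of S f] continuous_intros bounded_linear.continuous_on[OF assms(1)])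
next
  case (Suc k)
  have o: "open ((\<lambda>x. a + l x) -` S)"
    by (intro open_vimage assms continuous_intros bounded_linear.continuous_on[OF assms(1)])
  have d: "((\<lambda>x. f (a + l x)) has_derivative (\<lambda>v. frechet_derivative f (at (a + l x)) (l v))) (at x)"
    if "a + l x \<in> S" for x
  proof -
    have "(f has_derivative frechet_derivative f (at (a + l x))) (at (a + l x))"
      using Suc.prems that frechet_derivative_works by auto
    moreover have "((\<lambda>x. a + l x) has_derivative l) (at x)"
      using assms(1) by (auto intro!: derivative_eq_intros bounded_linear_imp_has_derivative)
    ultimately show ?thesis
      using diff_chain_at[of "\<lambda>x. a + l x" l x f] by (simp add: o_def)
  qed
  have eq: "frechet_derivative f (at (a + l x)) (l v) = frechet_derivative (\<lambda>x. f (a + l x)) (at x) v"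
    if "x \<in> (\<lambda>x. a + l x) -` S" for x v
    using frechet_derivative_at[OF d] that by (metis vimageE)
  have "Ck_on k ((\<lambda>x. a + l x) -` S) (\<lambda>x. frechet_derivative f (at (a + l x)) (l v))" for v
    using Suc by auto
  then show ?case
    using Ck_on_cong[OF o eq] by (auto intro: differentiableI[OF d])
qed

lemma smooth_onD_differentiable: "smooth_on S f \<Longrightarrow> x \<in> S \<Longrightarrow> f differentiable (at x)"
  unfolding smooth_on_def by (metis Ck_on.simps(2))

lemma smooth_on_has_derivative:
  "smooth_on S f \<Longrightarrow> x \<in> S \<Longrightarrow> (f has_derivative frechet_derivative f (at x)) (at x)"
  using smooth_onD_differentiable frechet_derivative_works by blast

lemma smooth_on_continuous_on: "smooth_on S f \<Longrightarrow> continuous_on S f"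
  unfolding smooth_on_def by (metis Ck_on.simps(1))

lemma smooth_on_dd: "smooth_on S f \<Longrightarrow> smooth_on S (\<lambda>x. dd f v x)"
  unfolding smooth_on_def by (metis Ck_on.simps(2))

lemma smooth_on_cong: "open S \<Longrightarrow> smooth_on S f \<Longrightarrow> (\<And>y. y \<in> S \<Longrightarrow> f y = g y) \<Longrightarrow> smooth_on S g"
  unfolding smooth_on_def using Ck_on_cong by blast

lemma smooth_on_subset: "smooth_on S f \<Longrightarrow> T \<subseteq> S \<Longrightarrow> smooth_on T f"
  unfolding smooth_on_def using Ck_on_subset by blast

lemma smooth_on_const: "smooth_on S (\<lambda>x. c)"
  unfolding smooth_on_def using Ck_on_const by blast

lemma smooth_on_add: "open S \<Longrightarrow> smooth_on S f \<Longrightarrow> smooth_on S g \<Longrightarrow> smooth_on S (\<lambda>x. f x + g x)"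
  unfolding smooth_on_def using Ck_on_add by blast

lemma smooth_on_mult:
  fixes f g :: "'e::euclidean_space \<Rightarrow> real"
  shows "open S \<Longrightarrow> smooth_on S f \<Longrightarrow> smooth_on S g \<Longrightarrow> smooth_on S (\<lambda>x. f x * g x)"
  unfolding smooth_on_def using Ck_on_mult by blast

lemma smooth_on_sum:
  assumes "open S" "\<And>i. i \<in> I \<Longrightarrow> smooth_on S (f i)"
  shows "smooth_on S (\<lambda>x. \<Sum>i\<in>I. f i x)"
  using assms(2)
  by (induction I rule: infinite_finite_induct) (auto intro: smooth_on_add smooth_on_const assms(1))

lemma smooth_on_prod:
  fixes f :: "'i \<Rightarrow> 'e::euclidean_space \<Rightarrow> real"
  assumes "open S" "\<And>i. i \<in> I \<Longrightarrow> smooth_on S (f i)"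
  shows "smooth_on S (\<lambda>x. \<Prod>i\<in>I. f i x)"
  using assms(2)
  by (induction I rule: infinite_finite_induct) (auto intro: smooth_on_mult smooth_on_const assms(1))

lemma smooth_on_affine_comp:
  fixes l :: "'d::euclidean_space \<Rightarrow> 'e::euclidean_space"
  shows "bounded_linear l \<Longrightarrow> open S \<Longrightarrow> smooth_on S f \<Longrightarrow> smooth_on ((\<lambda>x. a + l x) -` S) (\<lambda>x. f (a + l x))"
  unfolding smooth_on_def using Ck_on_affine_comp by blast

lemma smooth_on_det:
  fixes M :: "'e::euclidean_space \<Rightarrow> real^'n^'n"
  assumes "open S" "\<And>i j. smooth_on S (\<lambda>x. M x $ i $ j)"
  shows "smooth_on S (\<lambda>x. det (M x))"
  unfolding det_def by (intro smooth_on_sum smooth_on_mult smooth_on_prod smooth_on_const assms)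

lemma DERIV_along_line:
  fixes f :: "'e::real_normed_vector \<Rightarrow> real"
  assumes "f differentiable (at (x + s *\<^sub>R w))"
  shows "((\<lambda>s. f (x + s *\<^sub>R w)) has_real_derivative dd f w (x + s *\<^sub>R w)) (at s)"
proof -
  have "((\<lambda>s. x + s *\<^sub>R w) has_derivative (\<lambda>r. r *\<^sub>R w)) (at s)"
    by (auto intro!: derivative_eq_intros)
  from diff_chain_at[OF this frechet_derivative_works[THEN iffD1, OF assms]] show ?thesis
    by (simp add: has_field_derivative_def o_def linear_cmul[OF linear_frechet_derivative[OF assms]] mult_commute_abs)
qed

lemma frechet_derivative_expand:
  fixes f :: "'e::euclidean_space \<Rightarrow> real"
  assumes "f differentiable (at x)"
  shows "dd f v x = (\<Sum>b\<in>Basis. (v \<bullet> b) * frechet_derivative f (at x) b)"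
proof -
  interpret linear "frechet_derivative f (at x)" by (rule linear_frechet_derivative[OF assms])
  have "dd f v x = frechet_derivative f (at x) (\<Sum>b\<in>Basis. (v \<bullet> b) *\<^sub>R b)"
    by (simp only: euclidean_representation)
  then show ?thesis by (simp only: sum scaleR real_scaleR_def)
qed

text \<open>Both mixed derivatives are limits of one and the same second difference quotient, by the mean
  value theorem applied in either order.\<close>

lemma second_difference_mean_value:
  fixes f :: "'e::euclidean_space \<Rightarrow> real"
  assumes S: "smooth_on S f" and h: "h > 0"
    and sub: "\<And>s t. s \<in> {0..h} \<Longrightarrow> t \<in> {0..h} \<Longrightarrow> x + s *\<^sub>R u + t *\<^sub>R v \<in> S"
  shows "\<exists>s\<in>{0..h}. \<exists>t\<in>{0..h}. f (x + h *\<^sub>R u + h *\<^sub>R v) - f (x + h *\<^sub>R u) - f (x + h *\<^sub>R v) + f x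
    = h\<^sup>2 * frechet_derivative (\<lambda>z. dd f u z) (at (x + s *\<^sub>R u + t *\<^sub>R v)) v"
proof -
  have d: "((\<lambda>s. g (y + s *\<^sub>R w)) has_real_derivative dd g w (y + s *\<^sub>R w)) (at s)"
    if "smooth_on S g" "y + s *\<^sub>R w \<in> S" for g :: "'e \<Rightarrow> real" and y s w
    by (rule DERIV_along_line[OF smooth_onD_differentiable[OF that]])
  have rw: "x + h *\<^sub>R v + s *\<^sub>R u = x + s *\<^sub>R u + h *\<^sub>R v" for s by simp
  define k where "k = (\<lambda>s. f (x + h *\<^sub>R v + s *\<^sub>R u) - f (x + s *\<^sub>R u))"
  have "\<exists>s>0. s < h \<and> k h - k 0 = (h - 0) * (dd f u (x + h *\<^sub>R v + s *\<^sub>R u) - dd f u (x + s *\<^sub>R u))"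
    unfolding k_def
  proof (rule MVT2[OF h])
    fix s assume "0 \<le> s" "s \<le> h"
    then have "x + h *\<^sub>R v + s *\<^sub>R u \<in> S" "x + s *\<^sub>R u \<in> S"
      using sub[of s h] sub[of s 0] h by (auto simp: rw)
    then show "((\<lambda>s. f (x + h *\<^sub>R v + s *\<^sub>R u) - f (x + s *\<^sub>R u)) has_real_derivative
       dd f u (x + h *\<^sub>R v + s *\<^sub>R u) - dd f u (x + s *\<^sub>R u)) (at s)"
      by (intro DERIV_diff d S)
  qed
  then obtain s where s: "0 < s" "s < h"
    "k h - k 0 = h * (dd f u (x + s *\<^sub>R u + h *\<^sub>R v) - dd f u (x + s *\<^sub>R u))"
    unfolding rw by auto
  define m where "m = (\<lambda>t. dd f u (x + s *\<^sub>R u + t *\<^sub>R v))"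
  have "\<exists>t>0. t < h \<and> m h - m 0 = (h - 0) * frechet_derivative (\<lambda>z. dd f u z) (at (x + s *\<^sub>R u + t *\<^sub>R v)) v"
    unfolding m_def
    by (rule MVT2[OF h], rule d) (use S s sub in \<open>auto intro: smooth_on_dd\<close>)
  then obtain t where t: "0 < t" "t < h"
    "m h - m 0 = h * frechet_derivative (\<lambda>z. dd f u z) (at (x + s *\<^sub>R u + t *\<^sub>R v)) v"
    by auto
  have "k h - k 0 = h * (m h - m 0)"
    using s by (simp add: m_def)
  then show ?thesis
    using s(1,2) t by (intro bexI[of _ s] bexI[of _ t]) (auto simp: k_def power2_eq_square algebra_simps)
qed

lemma frechet_derivative_commute:
  fixes f :: "'e::euclidean_space \<Rightarrow> real"
  assumes S: "smooth_on S f" "open S" "x \<in> S"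
  shows "frechet_derivative (\<lambda>z. dd f u z) (at x) v
       = frechet_derivative (\<lambda>z. dd f v z) (at x) u"
proof -
  define D where "D = (\<lambda>a b y. frechet_derivative (\<lambda>z. frechet_derivative f (at z) a) (at y) b)"
  have cont: "continuous_on S (D a b)" for a b
    unfolding D_def by (intro smooth_on_continuous_on smooth_on_dd S)
  have "dist (D u v x) (D v u x) \<le> e" if "e > 0" for e
  proof -
    obtain d1 where d1: "d1 > 0" "\<And>y. y \<in> S \<Longrightarrow> dist y x < d1 \<Longrightarrow> dist (D u v y) (D u v x) < e/2"
      using cont[of u v] S(3) \<open>e > 0\<close> unfolding continuous_on_iff by (meson half_gt_zero)
    obtain d2 where d2: "d2 > 0" "\<And>y. y \<in> S \<Longrightarrow> dist y x < d2 \<Longrightarrow> dist (D v u y) (D v u x) < e/2"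
      using cont[of v u] S(3) \<open>e > 0\<close> unfolding continuous_on_iff by (meson half_gt_zero)
    obtain d3 where d3: "d3 > 0" "ball x d3 \<subseteq> S" using S(2,3) openE by blast
    define d where "d = min d1 (min d2 d3)"
    define h where "h = d / (2 * (norm u + norm v + 1))"
    have np: "norm u + norm v + 1 > 0" by (simp add: add_nonneg_pos)
    have "d > 0" using d1 d2 d3 d_def by auto
    then have "h > 0" using np by (simp add: h_def)
    have near: "dist (x + s *\<^sub>R u + t *\<^sub>R v) x < d" if "s \<in> {0..h}" "t \<in> {0..h}" for s t
    proof -
      have "dist (x + s *\<^sub>R u + t *\<^sub>R v) x = norm (s *\<^sub>R u + t *\<^sub>R v)" by (simp add: dist_norm)
      also have "\<dots> \<le> s * norm u + t * norm v"
        using norm_triangle_ineq[of "s *\<^sub>R u" "t *\<^sub>R v"] that by simp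
      also have "\<dots> \<le> h * norm u + h * norm v"
        using that by (intro add_mono mult_right_mono) auto
      also have "\<dots> \<le> h * (norm u + norm v + 1)" using \<open>h > 0\<close> by (simp add: algebra_simps)
      also have "\<dots> = d / 2"
      proof -
        have "d / (2 * K) * K = d / 2" if "K > 0" for K :: real using that by simp
        then show ?thesis using np unfolding h_def by blast
      qed
      also have "\<dots> < d" using \<open>d > 0\<close> by simp
      finally show ?thesis .
    qed
    have sub: "x + s *\<^sub>R u + t *\<^sub>R v \<in> S" if "s \<in> {0..h}" "t \<in> {0..h}" for s t
      using near[OF that] d3 by (auto simp: d_def dist_commute)
    have sub': "x + t *\<^sub>R v + s *\<^sub>R u \<in> S" if "t \<in> {0..h}" "s \<in> {0..h}" for s t
      using sub[OF that(2,1)] by (simp add: add_ac)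
    obtain s t where st: "s \<in> {0..h}" "t \<in> {0..h}"
      "f (x + h *\<^sub>R u + h *\<^sub>R v) - f (x + h *\<^sub>R u) - f (x + h *\<^sub>R v) + f x = h\<^sup>2 * D u v (x + s *\<^sub>R u + t *\<^sub>R v)"
      using second_difference_mean_value[OF S(1) \<open>h > 0\<close> sub] unfolding D_def by blast
    obtain t' s' where st': "t' \<in> {0..h}" "s' \<in> {0..h}"
      "f (x + h *\<^sub>R v + h *\<^sub>R u) - f (x + h *\<^sub>R v) - f (x + h *\<^sub>R u) + f x = h\<^sup>2 * D v u (x + t' *\<^sub>R v + s' *\<^sub>R u)"
      using second_difference_mean_value[OF S(1) \<open>h > 0\<close> sub'] unfolding D_def by blast
    have "h\<^sup>2 * D u v (x + s *\<^sub>R u + t *\<^sub>R v) = h\<^sup>2 * D v u (x + t' *\<^sub>R v + s' *\<^sub>R u)"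
      using st(3) st'(3) by (simp only: add_ac diff_diff_eq)
    then have eq: "D u v (x + s *\<^sub>R u + t *\<^sub>R v) = D v u (x + t' *\<^sub>R v + s' *\<^sub>R u)"
      using \<open>h > 0\<close> by simp
    have "dist (D u v (x + s *\<^sub>R u + t *\<^sub>R v)) (D u v x) < e/2"
      by (intro d1 sub st) (use near[OF st(1,2)] d_def in auto)
    moreover have "dist (D v u (x + t' *\<^sub>R v + s' *\<^sub>R u)) (D v u x) < e/2"
      by (intro d2 sub' st') (use near[OF st'(2,1)] d_def in \<open>auto simp: add_ac\<close>)
    ultimately show ?thesis unfolding eq
      by (metis dist_commute dist_triangle_half_r less_imp_le)
  qed
  then have "dist (D u v x) (D v u x) \<le> 0" by (meson field_le_epsilon dense_ge)
  then show ?thesis by (simp add: D_def)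
qed

lemma dd_eqI: "(f has_derivative f') (at x) \<Longrightarrow> dd f v x = f' v"
  by (metis frechet_derivative_at)

lemma dd_mult:
  fixes f g :: "'e::euclidean_space \<Rightarrow> real"
  assumes "f differentiable (at x)" "g differentiable (at x)"
  shows "dd (\<lambda>x. f x * g x) v x = f x * dd g v x + dd f v x * g x"
  by (rule dd_eqI, rule has_derivative_mult)
    (use assms frechet_derivative_works in blast)+

lemma dd_sum:
  assumes "\<And>i. i \<in> I \<Longrightarrow> f i differentiable (at x)"
  shows "dd (\<lambda>x. \<Sum>i\<in>I. f i x) v x = (\<Sum>i\<in>I. dd (f i) v x)"
  by (rule dd_eqI, rule has_derivative_sum) (use assms frechet_derivative_works in blast)+

lemma dd_cong_open:
  assumes "open S" "x \<in> S" "\<And>y. y \<in> S \<Longrightarrow> f y = g y" "f differentiable (at x)"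
  shows "dd g v x = dd f v x"
  using frechet_derivative_cong_open(1)[OF assms] by simp

lemma dd_expand:
  fixes f :: "real^'n \<Rightarrow> real"
  assumes "f differentiable (at x)"
  shows "dd f v x = (\<Sum>i\<in>UNIV. v $ i * dd f (axis i 1) x)"
proof -
  have "(\<Sum>b\<in>Basis. (v \<bullet> b) * dd f b x) = (\<Sum>b\<in>range (\<lambda>i. axis i 1). (v \<bullet> b) * dd f b x)"
    by (rule sum.cong) (auto simp: Basis_vec_def)
  also have "\<dots> = (\<Sum>i\<in>UNIV. v $ i * dd f (axis i 1) x)"
    by (subst sum.reindex) (auto simp: inj_on_def axis_eq_axis inner_axis)
  finally show ?thesis using frechet_derivative_expand[OF assms, of v] by simp
qed

section \<open>Linear algebra: the derivative of the determinant, and traces\<close>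

lemma has_derivative_det:
  fixes M :: "'e::real_normed_vector \<Rightarrow> real^'n^'n"
  assumes "\<And>i j. ((\<lambda>x. M x $ i $ j) has_derivative (\<lambda>v. M' v $ i $ j)) (at x)"
  shows "((\<lambda>x. det (M x)) has_derivative
     (\<lambda>v. \<Sum>i\<in>UNIV. det (\<chi> a. if a = i then M' v $ a else M x $ a))) (at x)"
proof -
  have "((\<lambda>x. det (M x)) has_derivative
      (\<lambda>v. \<Sum>p | p permutes UNIV. of_int (sign p) *
         (\<Sum>i\<in>UNIV. M' v $ i $ p i * (\<Prod>j\<in>UNIV - {i}. M x $ j $ p j)))) (at x)"
    unfolding det_def
    by (intro has_derivative_sum has_derivative_mult_right has_derivative_prod assms)
  moreover have "(\<Sum>p | p permutes UNIV. of_int (sign p) *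
         (\<Sum>i\<in>UNIV. M' v $ i $ p i * (\<Prod>j\<in>UNIV - {i}. M x $ j $ p j)))
      = (\<Sum>i\<in>UNIV. det (\<chi> a. if a = i then M' v $ a else M x $ a))" for v
  proof -
    have "M' v $ i $ p i * (\<Prod>j\<in>UNIV - {i}. M x $ j $ p j)
        = (\<Prod>j\<in>UNIV. (\<chi> a. if a = i then M' v $ a else M x $ a) $ j $ p j)" for i and p :: "'n \<Rightarrow> 'n"
      by (subst prod.remove[of _ i]) (auto intro!: prod.cong)
    then show ?thesis
      unfolding det_def by (simp add: sum_distrib_left sum.swap[of _ UNIV "{p. p permutes UNIV}"])
  qed
  ultimately show ?thesis by simp
qed

text \<open>Jacobi's formula: replacing the row \<open>i\<close> of \<open>G\<close> by that of \<open>B = (B H) G\<close> multiplies the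
  determinant by the entry \<open>(i, i)\<close> of \<open>B H\<close>, by Cramer's rule.\<close>

lemma sum_det_replaced_rows:
  fixes G H B :: "real^'n^'n"
  assumes "H ** G = mat 1"
  shows "(\<Sum>i\<in>UNIV. det (\<chi> a. if a = i then B $ a else G $ a)) = trace (B ** H) * det G"
proof -
  define C where "C = B ** H"
  have "B = C ** G" unfolding C_def by (metis assms matrix_mul_assoc matrix_mul_rid)
  then have row: "B $ a = (\<Sum>k\<in>UNIV. C $ a $ k *s row k G)" for a
    by (simp add: matrix_matrix_mult_def row_def vec_eq_iff)
  have "det (\<chi> a. if a = i then B $ a else G $ a) = C $ i $ i * det G" for i
  proof -
    have "(\<chi> a. if a = i then B $ a else G $ a)
       = (\<chi> a. if a = i then (\<Sum>k\<in>UNIV. (C $ i) $ k *s row k G) else row a G)"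
      using row[of i] by (simp add: row_def vec_eq_iff)
    then show ?thesis using cramer_lemma_transpose[of i "C $ i" G] by simp
  qed
  then show ?thesis by (simp add: trace_def flip: C_def sum_distrib_right)
qed

text \<open>Gram-Schmidt orthonormalisation with respect to a positive definite matrix.\<close>

lemma exists_orthonormal_set:
  fixes G :: "real^'n^'n"
  assumes sym: "\<And>u v. u \<bullet> (G *v v) = v \<bullet> (G *v u)" and pos: "\<And>v. v \<noteq> 0 \<Longrightarrow> v \<bullet> (G *v v) > 0"
  shows "k \<le> CARD('n) \<Longrightarrow> \<exists>S. finite S \<and> card S = k \<and> (\<forall>u\<in>S. \<forall>v\<in>S. u \<bullet> (G *v v) = (if u = v then 1 else 0))"
proof (induction k)
  case 0
  show ?case by (intro exI[of _ "{}"]) auto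
next
  case (Suc k)
  then obtain S where S: "finite S" "card S = k" "\<forall>u\<in>S. \<forall>v\<in>S. u \<bullet> (G *v v) = (if u = v then 1 else 0)"
    by auto
  have "dim S < DIM(real^'n)"
    using dim_le_card'[OF S(1)] S(2) Suc.prems by simp
  then have "span S \<noteq> UNIV" by (metis dim_UNIV dim_span less_irrefl)
  then obtain w where w: "w \<notin> span S" by auto
  define w' where "w' = w - (\<Sum>e\<in>S. (e \<bullet> (G *v w)) *\<^sub>R e)"
  have "w' \<noteq> 0"
  proof
    assume "w' = 0"
    then have "w = (\<Sum>e\<in>S. (e \<bullet> (G *v w)) *\<^sub>R e)" by (simp add: w'_def)
    moreover have "(\<Sum>e\<in>S. (e \<bullet> (G *v w)) *\<^sub>R e) \<in> span S"
      by (intro span_sum span_scale span_base)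
    ultimately show False using w by simp
  qed
  have orth: "e \<bullet> (G *v w') = 0" if "e \<in> S" for e
  proof -
    have "e \<bullet> (G *v w') = e \<bullet> (G *v w) - (\<Sum>d\<in>S. (d \<bullet> (G *v w)) * (e \<bullet> (G *v d)))"
      unfolding w'_def
      by (simp add: matrix_vector_mult_diff_distrib inner_diff_right linear_sum[OF matrix_vector_mul_linear]
          matrix_vector_mult_scaleR inner_sum_right)
    also have "(\<Sum>d\<in>S. (d \<bullet> (G *v w)) * (e \<bullet> (G *v d))) = (\<Sum>d\<in>S. if d = e then e \<bullet> (G *v w) else 0)"
      using S(3) that by (intro sum.cong) auto
    finally show ?thesis using S(1) that by simp
  qed
  define n where "n = w' \<bullet> (G *v w')"
  have "n > 0" using pos \<open>w' \<noteq> 0\<close> n_def by auto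
  define x where "x = (1 / sqrt n) *\<^sub>R w'"
  have xx: "x \<bullet> (G *v x) = 1"
    using \<open>n > 0\<close> by (simp add: x_def matrix_vector_mult_scaleR real_sqrt_mult_self flip: n_def)
  have ex: "e \<bullet> (G *v x) = 0" "x \<bullet> (G *v e) = 0" if "e \<in> S" for e
    using orth[OF that] sym[of x e] by (auto simp: x_def matrix_vector_mult_scaleR)
  have "x \<notin> S" using ex(1)[of x] xx by auto
  then show ?case
    using S xx ex by (intro exI[of _ "insert x S"]) auto
qed

text \<open>The columns of \<open>P\<close> form an orthonormal basis for \<open>G\<close>. This factorisation of the inverse replaces
  the square root of a positive definite matrix.\<close>

lemma posdef_inverse_square:
  fixes G :: "real^'n^'n"
  assumes sym: "transpose G = G" and pos: "\<And>v. v \<noteq> 0 \<Longrightarrow> v \<bullet> (G *v v) > 0"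
  obtains P :: "real^'n^'n" where "G ** (P ** transpose P) = mat 1" "invertible P"
proof -
  have "u \<bullet> (G *v v) = v \<bullet> (G *v u)" for u v
    by (metis dot_lmul_matrix inner_commute sym vector_transpose_matrix)
  from exists_orthonormal_set[OF this pos, of "CARD('n)"]
  obtain S where S: "finite S" "card S = CARD('n)" "\<forall>u\<in>S. \<forall>v\<in>S. u \<bullet> (G *v v) = (if u = v then 1 else 0)"
    by auto
  then obtain f where f: "bij_betw f (UNIV::'n set) S"
    using finite_same_card_bij[of "UNIV::'n set" S] by auto
  define P where "P = (\<chi> i j. f j $ i)"
  have col: "column j P = f j" for j by (simp add: P_def column_def vec_eq_iff)
  have "transpose P ** (G ** P) = mat 1"
  proof -
    have "(transpose P ** (G ** P)) $ i $ j = f i \<bullet> (G *v f j)" for i j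
      by (simp add: P_def transpose_def matrix_matrix_mult_def
          inner_vec_def matrix_vector_mult_def)
    moreover have "f i \<bullet> (G *v f j) = (if i = j then 1 else 0)" for i j
      using S(3) f by (metis UNIV_I bij_betw_apply bij_betw_imp_inj_on inj_eq)
    ultimately show ?thesis by (simp add: vec_eq_iff mat_def)
  qed
  then have "(G ** P) ** transpose P = mat 1" using matrix_left_right_inverse by blast
  then have 1: "G ** (P ** transpose P) = mat 1" by (simp add: matrix_mul_assoc)
  have "invertible P"
    using \<open>transpose P ** (G ** P) = mat 1\<close> unfolding invertible_def
    by (metis matrix_left_right_inverse matrix_mul_assoc)
  with 1 show ?thesis using that by blast
qed

lemma trace_square_symmetric:
  fixes C :: "real^'n^'n"
  assumes "transpose C = C"
  shows "trace (C ** C) = (\<Sum>i\<in>UNIV. \<Sum>j\<in>UNIV. (C $ i $ j)\<^sup>2)"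
proof -
  have "C $ i $ j = C $ j $ i" for i j
    using assms by (metis transpose_def vec_lambda_beta)
  then show ?thesis
    by (simp add: trace_def matrix_matrix_mult_def power2_eq_square)
qed

text \<open>With \<open>H = P P\<^sup>T\<close> the trace is that of the square of the symmetric matrix \<open>P\<^sup>T B P\<close>, hence
  the sum of the squares of its entries.\<close>

lemma trace_HBHB:
  fixes G H B :: "real^'n^'n"
  assumes sym: "transpose G = G" and pos: "\<And>v. v \<noteq> 0 \<Longrightarrow> v \<bullet> (G *v v) > 0"
    and H: "H ** G = mat 1" and B: "transpose B = B"
  shows "trace (H ** B ** H ** B) \<ge> 0" "trace (H ** B ** H ** B) = 0 \<Longrightarrow> B = 0"
proof -
  obtain P :: "real^'n^'n" where P: "G ** (P ** transpose P) = mat 1" "invertible P"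
    by (rule posdef_inverse_square[OF sym pos])
  have HP: "H = P ** transpose P"
    using H P by (metis matrix_mul_assoc matrix_mul_lid matrix_mul_rid)
  define C where "C = transpose P ** B ** P"
  have C: "transpose C = C" by (simp add: C_def matrix_transpose_mul B matrix_mul_assoc)
  have "trace (H ** B ** H ** B) = trace (P ** (transpose P ** B ** P ** transpose P ** B))"
    by (simp add: HP matrix_mul_assoc)
  also have "\<dots> = trace (C ** C)"
    by (subst trace_mul_sym) (simp add: C_def matrix_mul_assoc)
  finally have eq: "trace (H ** B ** H ** B) = (\<Sum>i\<in>UNIV. \<Sum>j\<in>UNIV. (C $ i $ j)\<^sup>2)"
    using trace_square_symmetric[OF C] by simp
  show "trace (H ** B ** H ** B) \<ge> 0" unfolding eq by (intro sum_nonneg) auto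
  assume tr0: "trace (H ** B ** H ** B) = 0"
  have "C $ i $ j = 0" for i j
  proof -
    have "(\<Sum>j\<in>UNIV. (C $ i $ j)\<^sup>2) = 0"
      using tr0 unfolding eq by (rule sum_nonneg_0[OF finite, rotated]) (simp_all add: sum_nonneg)
    then have "(C $ i $ j)\<^sup>2 = 0" by (rule sum_nonneg_0[OF finite, rotated]) simp_all
    then show ?thesis by simp
  qed
  then have "C = 0" by (simp add: vec_eq_iff)
  obtain P' where inv: "P ** P' = mat 1" using P(2) unfolding invertible_def by blast
  have "transpose (P') ** C ** P' = transpose (P ** P') ** B ** (P ** P')"
    by (simp add: C_def matrix_transpose_mul matrix_mul_assoc)
  also have "\<dots> = B" by (simp add: inv transpose_mat)
  finally show "B = 0" using \<open>C = 0\<close> by (simp add: vec_eq_iff matrix_matrix_mult_def)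
qed

section \<open>Compactly supported functions have derivatives with vanishing integral\<close>

text \<open>Where \<open>u\<close> is not assumed to be differentiable it vanishes identically. In the application \<open>S\<close> is
  the punctured space, and this extends a cut-off function across the origin.\<close>

lemma compactly_supported_C1:
  fixes u :: "'e::euclidean_space \<Rightarrow> real"
  assumes S: "open S" "compact K" "K \<subseteq> S"
    and diff: "\<And>x. x \<in> S \<Longrightarrow> u differentiable (at x)" and cont: "continuous_on S (dd u v)"
    and supp: "\<And>x. x \<notin> K \<Longrightarrow> u x = 0"
  shows "u differentiable (at x)" "continuous_on UNIV (dd u v)" "x \<notin> K \<Longrightarrow> dd u v x = 0"
proof -
  have K: "open (- K)" using S compact_imp_closed by auto
  have 0: "(u has_derivative (\<lambda>_. 0)) (at x)" if "x \<notin> K" for x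
    by (rule has_derivative_transform_within_open[of "\<lambda>_. 0" _ _ _ "- K"]) (use K that supp in auto)
  show *: "dd u v x = 0" if "x \<notin> K" for x using dd_eqI[OF 0[OF that]] .
  show "u differentiable (at x)" using 0[of x] diff[of x] S(3) differentiableI by blast
  have "continuous_on (- K) (dd u v)"
    using * continuous_on_cong[of "- K" "- K" "dd u v" "\<lambda>_. 0"] by simp
  then have "continuous_on (S \<union> - K) (dd u v)"
    using continuous_on_open_Un[OF S(1) K cont] by blast
  moreover have "S \<union> - K = UNIV" using S by auto
  ultimately show "continuous_on UNIV (dd u v)" by simp
qed

text \<open>The integral of \<open>u(y + t v)\<close> over the box does not depend on \<open>t\<close> as long as the translated
  support stays inside, and its derivative at \<open>t = 0\<close> is the integral of the derivative.\<close>

lemma integral_dd_compact_support: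
  fixes u :: "'e::euclidean_space \<Rightarrow> real"
  assumes S: "open S" "compact K" "K \<subseteq> S" "K \<subseteq> box a b"
    and diff: "\<And>x. x \<in> S \<Longrightarrow> u differentiable (at x)" and cont: "continuous_on S (dd u v)"
    and supp: "\<And>x. x \<notin> K \<Longrightarrow> u x = 0"
  shows "integral (cbox a b) (dd u v) = 0"
proof -
  note C1 = compactly_supported_C1[OF S(1-3) diff cont supp]
  obtain e where e: "e > 0" "\<And>x y. x \<in> K \<Longrightarrow> dist x y < e \<Longrightarrow> y \<in> box a b"
  proof -
    have "\<exists>e>0. (\<Union>x\<in>K. ball x e) \<subseteq> box a b"
      using compact_subset_open_imp_ball_epsilon_subset[OF S(2) open_box S(4)] by metis
    then show ?thesis using that by (metis UN_subset_iff mem_ball subset_iff)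
  qed
  define \<epsilon> where "\<epsilon> = e / (norm v + 1)"
  have nv: "norm v + 1 > 0" by (simp add: add_nonneg_pos)
  then have "\<epsilon> > 0" using e by (simp add: \<epsilon>_def)
  define U where "U = {-\<epsilon><..<\<epsilon>}"
  have cu: "continuous_on UNIV u"
    using C1(1) by (simp add: continuous_on_eq_continuous_at differentiable_imp_continuous_within)
  define J where "J = (\<lambda>t. integral (cbox a b) (\<lambda>y. u (y + t *\<^sub>R v)))"
  have "J t = integral UNIV u" if "t \<in> U" for t
  proof -
    have "norm (t *\<^sub>R v) < e"
    proof -
      have "norm (t *\<^sub>R v) \<le> \<bar>t\<bar> * (norm v + 1)" by (simp add: algebra_simps)
      also have "\<dots> < \<epsilon> * (norm v + 1)" using that nv by (intro mult_strict_right_mono) (auto simp: U_def)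
      also have "\<dots> = e" using nv by (simp add: \<epsilon>_def)
      finally show ?thesis .
    qed
    then have sub: "K \<subseteq> cbox (a + t *\<^sub>R v) (b + t *\<^sub>R v)"
    proof (intro subsetI)
      fix x assume "x \<in> K"
      then have "x - t *\<^sub>R v \<in> box a b"
        using e(2)[of x "x - t *\<^sub>R v"] \<open>norm (t *\<^sub>R v) < e\<close> by (simp add: dist_norm)
      then show "x \<in> cbox (a + t *\<^sub>R v) (b + t *\<^sub>R v)"
        by (auto simp: mem_box inner_simps algebra_simps intro: less_imp_le)
    qed
    have "u integrable_on cbox (a + t *\<^sub>R v) (b + t *\<^sub>R v)"
      by (intro integrable_continuous continuous_on_subset[OF cu]) auto
    then have "(u has_integral integral (cbox (a + t *\<^sub>R v) (b + t *\<^sub>R v)) u) UNIV"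
      by (intro has_integral_on_superset[OF integrable_integral]) (use sub supp in auto)
    then have "integral (cbox (a + t *\<^sub>R v) (b + t *\<^sub>R v)) u = integral UNIV u"
      by (simp add: integral_unique)
    moreover have "J t = integral (cbox (a + t *\<^sub>R v) (b + t *\<^sub>R v)) u"
      unfolding J_def by (subst integral_shift_cbox_plus[symmetric]) (simp add: o_def add_ac)
    ultimately show ?thesis by simp
  qed
  then have J0: "(J has_real_derivative 0) (at 0 within U)"
    using \<open>\<epsilon> > 0\<close> by (intro has_field_derivative_transform_within[OF DERIV_const[of "integral UNIV u"], of 1])
       (auto simp: U_def)
  have "(J has_real_derivative integral (cbox a b) (\<lambda>y. dd u v (y + 0 *\<^sub>R v))) (at 0 within U)"
    unfolding J_def
  proof (rule leibniz_rule_field_derivative)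
    fix t y
    have "((\<lambda>t. u (y + t *\<^sub>R v)) has_real_derivative dd u v (y + t *\<^sub>R v)) (at t)"
      by (rule DERIV_along_line[OF C1(1)])
    then show "((\<lambda>t. u (y + t *\<^sub>R v)) has_real_derivative dd u v (y + t *\<^sub>R v)) (at t within U)"
      by (rule has_field_derivative_at_within)
    show "(\<lambda>y. u (y + t *\<^sub>R v)) integrable_on cbox a b"
      by (intro integrable_continuous continuous_on_compose2[OF cu] continuous_intros) auto
    show "continuous_on (U \<times> cbox a b) (\<lambda>(t, y). dd u v (y + t *\<^sub>R v))"
      unfolding case_prod_beta
      by (intro continuous_on_compose2[OF C1(2)] continuous_intros) auto
  qed (use \<open>\<epsilon> > 0\<close> in \<open>auto simp: U_def\<close>)
  then have "(J has_real_derivative integral (cbox a b) (dd u v)) (at 0 within U)" by simp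
  moreover have "at 0 within U = at 0"
    using \<open>\<epsilon> > 0\<close> by (intro at_within_open) (auto simp: U_def)
  ultimately show ?thesis using J0 DERIV_unique by fastforce
qed

section \<open>Deicke's theorem\<close>

definition hessian :: "(real^'n \<Rightarrow> real) \<Rightarrow> real^'n \<Rightarrow> real^'n^'n"
  where "hessian f y = (\<chi> i j. dd (dd f (axis j 1)) (axis i 1) y)"

lemma dd_homogeneous:
  fixes f :: "'e::euclidean_space \<Rightarrow> real"
  assumes hom: "\<And>\<mu> y. \<mu> > 0 \<Longrightarrow> y \<noteq> 0 \<Longrightarrow> f (\<mu> *\<^sub>R y) = \<mu> ^ k * f y"
    and diff: "\<And>y. y \<noteq> 0 \<Longrightarrow> f differentiable (at y)"
    and "\<mu> > 0" "y \<noteq> 0"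
  shows "\<mu> * dd f v (\<mu> *\<^sub>R y) = \<mu> ^ k * dd f v y"
proof -
  have f: "(f has_derivative frechet_derivative f (at (\<mu> *\<^sub>R y))) (at (\<mu> *\<^sub>R y))"
    using diff assms(3,4) frechet_derivative_works by (metis less_irrefl scaleR_eq_0_iff)
  have "((\<lambda>z. \<mu> *\<^sub>R z) has_derivative (\<lambda>v. \<mu> *\<^sub>R v)) (at y)"
    by (auto intro!: derivative_eq_intros)
  from diff_chain_at[OF this f]
  have 1: "((\<lambda>z. f (\<mu> *\<^sub>R z)) has_derivative (\<lambda>v. dd f (\<mu> *\<^sub>R v) (\<mu> *\<^sub>R y))) (at y)"
    by (simp add: o_def)
  have "((\<lambda>z. \<mu> ^ k * f z) has_derivative (\<lambda>v. \<mu> ^ k * dd f v y)) (at y)"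
    using diff[OF assms(4)] frechet_derivative_works by (intro has_derivative_mult_right) blast
  then have 2: "((\<lambda>z. f (\<mu> *\<^sub>R z)) has_derivative (\<lambda>v. \<mu> ^ k * dd f v y)) (at y)"
    by (rule has_derivative_transform_within_open[of _ _ _ _ "- {0}"]) (use hom assms(3,4) in auto)
  have "dd f (\<mu> *\<^sub>R v) (\<mu> *\<^sub>R y) = \<mu> ^ k * dd f v y"
    using fun_cong[OF has_derivative_unique[OF 1 2], of v] by simp
  then show ?thesis
    using has_derivative_linear[OF f] by (simp add: linear_cmul)
qed

text \<open>Differentiate \<open>t \<mapsto> f(t y)\<close> at \<open>t = 1\<close>.\<close>

lemma euler_homogeneous:
  fixes f :: "'e::euclidean_space \<Rightarrow> real"
  assumes hom: "\<And>\<mu> y. \<mu> > 0 \<Longrightarrow> y \<noteq> 0 \<Longrightarrow> f (\<mu> *\<^sub>R y) = \<mu> ^ k * f y"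
    and diff: "f differentiable (at y)" and "y \<noteq> 0"
  shows "dd f y y = k * f y"
proof -
  have f: "(f has_derivative frechet_derivative f (at (1 *\<^sub>R y))) (at (1 *\<^sub>R y))"
    using diff frechet_derivative_works by (metis scaleR_one)
  have "((\<lambda>t. t *\<^sub>R y) has_derivative (\<lambda>t. t *\<^sub>R y)) (at 1)"
    by (auto intro!: derivative_eq_intros)
  from diff_chain_at[OF this f]
  have 1: "((\<lambda>t. f (t *\<^sub>R y)) has_derivative (\<lambda>t. dd f (t *\<^sub>R y) y)) (at 1)"
    by (simp add: o_def)
  have "((\<lambda>t. t ^ k * f y) has_derivative (\<lambda>t. t * (k * f y))) (at 1)"
    by (auto intro!: derivative_eq_intros)
  then have 2: "((\<lambda>t. f (t *\<^sub>R y)) has_derivative (\<lambda>t. t * (k * f y))) (at 1)"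
    by (rule has_derivative_transform_within_open[of _ _ _ _ "{0<..}"]) (use hom assms(3) in auto)
  show ?thesis using fun_cong[OF has_derivative_unique[OF 1 2], of 1] by simp
qed

text \<open>For \<open>a > 0\<close> a \<open>C\<^sup>1\<close> bump with support \<open>[a/2, 2 a]\<close>, positive at \<open>a\<close>; the square makes the two corners of the
  positive part disappear.\<close>

definition cutoff :: "real \<Rightarrow> real \<Rightarrow> real"
  where "cutoff a r = (max 0 ((r - a/2) * (2 * a - r)))\<^sup>2"

definition cutoff_deriv :: "real \<Rightarrow> real \<Rightarrow> real"
  where "cutoff_deriv a r = 2 * max 0 ((r - a/2) * (2 * a - r)) * (5 * a / 2 - 2 * r)"

lemma DERIV_max_square: "((\<lambda>x. (max 0 x)\<^sup>2) has_real_derivative 2 * max 0 x) (at x)" for x :: real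
proof -
  consider "x > 0" | "x < 0" | "x = 0" by linarith
  then show ?thesis
  proof cases
    case 1
    have "((\<lambda>x. x\<^sup>2) has_real_derivative 2 * x) (at x)" by (auto intro!: derivative_eq_intros)
    then have "((\<lambda>x. (max 0 x)\<^sup>2) has_real_derivative 2 * x) (at x)"
      by (rule has_field_derivative_transform_within_open[of _ _ _ "{0<..}"]) (use 1 in auto)
    then show ?thesis using 1 by simp
  next
    case 2
    have "((\<lambda>x. (max 0 x)\<^sup>2) has_real_derivative 0) (at x)"
      by (rule has_field_derivative_transform_within_open[OF DERIV_const, of "{..<0}"]) (use 2 in auto)
    then show ?thesis using 2 by simp
  next
    case 3
    have "((\<lambda>h. (max 0 h)\<^sup>2 / h) \<longlongrightarrow> 0) (at (0::real))"
    proof (rule Lim_null_comparison)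
      show "\<forall>\<^sub>F h in at (0::real). norm ((max 0 h)\<^sup>2 / h) \<le> \<bar>h\<bar>"
        by (intro always_eventually) (auto simp: max_def power2_eq_square)
      show "((\<lambda>h. \<bar>h\<bar>) \<longlongrightarrow> 0) (at (0::real))"
        by (auto intro!: tendsto_eq_intros)
    qed
    then show ?thesis using 3 by (simp add: DERIV_def)
  qed
qed

lemma DERIV_cutoff: "(cutoff a has_real_derivative cutoff_deriv a r) (at r)"
proof -
  have "((\<lambda>r. (r - a/2) * (2 * a - r)) has_real_derivative (5 * a / 2 - 2 * r)) (at r)"
    by (auto intro!: derivative_eq_intros simp: field_simps)
  from DERIV_chain2[OF DERIV_max_square this] show ?thesis
    unfolding cutoff_def cutoff_deriv_def by simp
qed

lemma cutoff_nonneg: "cutoff a r \<ge> 0"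
  by (simp add: cutoff_def)

lemma cutoff_pos: "a > 0 \<Longrightarrow> cutoff a a > 0"
  by (simp add: cutoff_def)

lemma cutoff_support: "a > 0 \<Longrightarrow> cutoff a r \<noteq> 0 \<Longrightarrow> a/2 \<le> r \<and> r \<le> 2 * a"
proof -
  assume a: "a > 0" and "cutoff a r \<noteq> 0"
  then have "max 0 ((r - a/2) * (2 * a - r)) \<noteq> 0" unfolding cutoff_def power2_eq_square by (metis mult_zero_left)
  then have "(r - a/2) * (2 * a - r) > 0" by (metis max.absorb1 not_le)
  then show ?thesis using a by (auto simp: zero_less_mult_iff)
qed

text \<open>Here \<open>\<phi>\<close> is half the square of a Minkowski norm, so its Hessian \<open>g\<close> is the fundamental tensor and
  the third derivatives of \<open>\<phi>\<close> form the Cartan tensor.\<close>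

locale minkowski_energy =
  fixes \<phi> :: "real^'n \<Rightarrow> real"
  assumes smooth: "smooth_on (- {0}) \<phi>"
    and hom: "\<And>\<mu> y. \<mu> > 0 \<Longrightarrow> \<phi> (\<mu> *\<^sub>R y) = \<mu>\<^sup>2 * \<phi> y"
    and posdef: "\<And>y v. y \<noteq> 0 \<Longrightarrow> v \<noteq> 0 \<Longrightarrow> v \<bullet> (hessian \<phi> y *v v) > 0"
begin

abbreviation e :: "'n \<Rightarrow> real^'n" where "e i \<equiv> axis i 1"
abbreviation g :: "'n \<Rightarrow> 'n \<Rightarrow> real^'n \<Rightarrow> real" where "g i j \<equiv> dd (dd \<phi> (e j)) (e i)"

lemma open_nz: "open (- {0::real^'n})" by auto

lemmas smooth_intros = smooth_on_dd smooth
lemma smooth_g: "smooth_on (- {0}) (g i j)" by (intro smooth_intros)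
lemma diffS: "smooth_on (- {0}) f \<Longrightarrow> y \<noteq> 0 \<Longrightarrow> f differentiable (at y)" for f :: "real^'n \<Rightarrow> real"
  using smooth_onD_differentiable by blast

lemma commute: "smooth_on (- {0}) f \<Longrightarrow> y \<noteq> 0 \<Longrightarrow> dd (dd f u) v y = dd (dd f v) u y"
  for f :: "real^'n \<Rightarrow> real"
  using frechet_derivative_commute[OF _ open_nz] by blast

lemma cong: "(\<And>y. y \<noteq> 0 \<Longrightarrow> f y = f' y) \<Longrightarrow> smooth_on (- {0}) f \<Longrightarrow> y \<noteq> 0 \<Longrightarrow> dd f v y = dd f' v y"
  for f :: "real^'n \<Rightarrow> real"
  using dd_cong_open[OF open_nz, of y f f' v] diffS by auto

lemma hessian_nth: "hessian \<phi> y $ i $ j = g i j y" by (simp add: hessian_def)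

lemma g_sym: "y \<noteq> 0 \<Longrightarrow> g i j y = g j i y" by (rule commute[OF smooth])

lemma dg_sym: "y \<noteq> 0 \<Longrightarrow> dd (g i j) v y = dd (g j i) v y"
  by (rule cong[OF g_sym]) (auto intro: smooth_intros)

lemma hessian_sym: assumes "y \<noteq> 0" shows "transpose (hessian \<phi> y) = hessian \<phi> y"
proof -
  have "transpose (hessian \<phi> y) $ i $ j = hessian \<phi> y $ i $ j" for i j
    unfolding transpose_def vec_lambda_beta hessian_nth by (rule g_sym[OF assms])
  then show ?thesis by (simp only: vec_eq_iff) blast
qed

lemma hessian_det: assumes "y \<noteq> 0" shows "det (hessian \<phi> y) \<noteq> 0"
proof
  assume "det (hessian \<phi> y) = 0"
  then have "\<not> invertible (hessian \<phi> y)" by (simp add: invertible_det_nz)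
  then obtain v where "v \<noteq> 0" "hessian \<phi> y *v v = 0"
    by (metis invertible_left_inverse matrix_left_invertible_ker)
  then show False using posdef[OF assms, of v] by simp
qed

definition H :: "real^'n \<Rightarrow> real^'n^'n" where "H y = (SOME M. hessian \<phi> y ** M = mat 1)"
abbreviation h :: "'n \<Rightarrow> 'n \<Rightarrow> real^'n \<Rightarrow> real" where "h i j \<equiv> (\<lambda>y. H y $ i $ j)"

lemma H: assumes "y \<noteq> 0" shows "hessian \<phi> y ** H y = mat 1" "H y ** hessian \<phi> y = mat 1"
proof -
  have "\<exists>M. hessian \<phi> y ** M = mat 1"
    using hessian_det[OF assms] by (simp add: invertible_det_nz flip: invertible_right_inverse)
  then show "hessian \<phi> y ** H y = mat 1" unfolding H_def by (rule someI_ex)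
  then show "H y ** hessian \<phi> y = mat 1" using matrix_left_right_inverse by blast
qed

lemma H_sym: assumes "y \<noteq> 0" shows "h i j y = h j i y"
proof -
  have "transpose (H y) ** hessian \<phi> y = mat 1"
    by (metis H(1) assms hessian_sym matrix_transpose_mul transpose_mat)
  then have "transpose (H y) = H y"
    using H(1)[OF assms] matrix_mul_assoc[of "transpose (H y)" "hessian \<phi> y" "H y"] by simp
  moreover have "transpose (H y) $ i $ j = h j i y" by (simp add: transpose_def)
  ultimately show ?thesis by simp
qed

subsection \<open>Euler relations\<close>

lemma diff_d: "y \<noteq> 0 \<Longrightarrow> dd \<phi> v differentiable (at y)"
  by (rule diffS[OF smooth_on_dd[OF smooth]])

lemma hom_d: assumes "\<mu> > 0" "y \<noteq> 0" shows "dd \<phi> v (\<mu> *\<^sub>R y) = \<mu> * dd \<phi> v y"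
  using dd_homogeneous[of \<phi> 2 \<mu> y v] hom diffS[OF smooth] assms by (simp add: power2_eq_square)

lemma hom_dd: assumes "\<mu> > 0" "y \<noteq> 0" shows "dd (dd \<phi> v) w (\<mu> *\<^sub>R y) = dd (dd \<phi> v) w y"
  using dd_homogeneous[of "dd \<phi> v" 1 \<mu> y w] hom_d diff_d assms by simp

lemma euler_d: assumes "y \<noteq> 0" shows "dd \<phi> (e k) y = (\<Sum>l\<in>UNIV. g k l y * y $ l)"
proof -
  have "dd \<phi> (e k) y = dd (dd \<phi> (e k)) y y"
    using euler_homogeneous[of "dd \<phi> (e k)" 1 y] hom_d diff_d assms by simp
  also have "\<dots> = (\<Sum>l\<in>UNIV. y $ l * g l k y)"
    by (rule dd_expand) (intro diffS smooth_intros assms)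
  finally show ?thesis using g_sym[OF assms] by (simp add: mult.commute cong: sum.cong)
qed

lemma euler: assumes "y \<noteq> 0" shows "\<phi> y = (y \<bullet> (hessian \<phi> y *v y)) / 2"
proof -
  have "2 * \<phi> y = dd \<phi> y y"
    using euler_homogeneous[of \<phi> 2 y] hom diffS[OF smooth] assms by simp
  also have "\<dots> = (\<Sum>k\<in>UNIV. y $ k * dd \<phi> (e k) y)"
    by (rule dd_expand) (intro diffS smooth_intros assms)
  also have "\<dots> = y \<bullet> (hessian \<phi> y *v y)"
    by (simp add: euler_d[OF assms] inner_vec_def matrix_vector_mult_def hessian_nth)
  finally show ?thesis by simp
qed

lemma phi_0: "\<phi> 0 = 0" using hom[of 2 0] by simp

lemma phi_pos: "y \<noteq> 0 \<Longrightarrow> \<phi> y > 0" using euler[of y] posdef[of y y] by linarith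

text \<open>By homogeneity the extreme values on the unit sphere serve as constants.\<close>

lemma phi_bounds:
  obtains m M where "m > 0" "M > 0" "\<And>y. m * (norm y)\<^sup>2 \<le> \<phi> y" "\<And>y. \<phi> y \<le> M * (norm y)\<^sup>2"
proof -
  have cont: "continuous_on (sphere 0 1) \<phi>"
    by (rule continuous_on_subset[OF smooth_on_continuous_on[OF smooth]]) auto
  have ne: "sphere (0::real^'n) 1 \<noteq> {}" by simp
  obtain a where a: "a \<in> sphere 0 1" "\<And>y. y \<in> sphere 0 1 \<Longrightarrow> \<phi> a \<le> \<phi> y"
    using continuous_attains_inf[OF compact_sphere ne cont] by blast
  obtain b where b: "b \<in> sphere 0 1" "\<And>y. y \<in> sphere 0 1 \<Longrightarrow> \<phi> y \<le> \<phi> b"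
    using continuous_attains_sup[OF compact_sphere ne cont] by blast
  have eq: "\<phi> y = \<phi> (y /\<^sub>R norm y) * (norm y)\<^sup>2" if "y \<noteq> 0" for y
    using hom[of "norm y" "y /\<^sub>R norm y"] that by simp
  have "\<phi> a * (norm y)\<^sup>2 \<le> \<phi> y \<and> \<phi> y \<le> \<phi> b * (norm y)\<^sup>2" for y
  proof (cases "y = 0")
    case False
    then have "y /\<^sub>R norm y \<in> sphere 0 1" by simp
    then have "\<phi> a \<le> \<phi> (y /\<^sub>R norm y)" "\<phi> (y /\<^sub>R norm y) \<le> \<phi> b" using a(2) b(2) by blast+
    then show ?thesis unfolding eq[OF False] by (auto intro!: mult_right_mono)
  qed (simp add: phi_0)
  moreover have "\<phi> a > 0" by (rule phi_pos) (use a in auto)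
  moreover have "\<phi> b > 0" by (rule phi_pos) (use b in auto)
  ultimately show ?thesis using that by blast
qed

lemma continuous_phi: "continuous_on UNIV \<phi>"
proof -
  obtain m M where M: "m > 0" "M > 0" "\<And>y. m * (norm y)\<^sup>2 \<le> \<phi> y" "\<And>y. \<phi> y \<le> M * (norm y)\<^sup>2"
    using phi_bounds by blast
  have "isCont \<phi> y" for y
  proof (cases "y = 0")
    case False
    then show ?thesis
      using smooth_on_continuous_on[OF smooth] open_nz by (simp add: continuous_on_eq_continuous_at)
  next
    case True
    have "(\<phi> \<longlongrightarrow> 0) (at 0)"
    proof (rule Lim_null_comparison)
      show "\<forall>\<^sub>F y in at 0. norm (\<phi> y) \<le> M * (norm y)\<^sup>2"
      proof (intro always_eventually allI)
        fix y :: "real^'n"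
        have "\<phi> y \<ge> 0" using phi_pos[of y] phi_0 by (cases "y = 0") auto
        then show "norm (\<phi> y) \<le> M * (norm y)\<^sup>2" using M(4)[of y] by simp
      qed
      show "((\<lambda>y. M * (norm y)\<^sup>2) \<longlongrightarrow> 0) (at (0::real^'n))"
        by (auto intro!: tendsto_eq_intros)
    qed
    then show ?thesis using True by (simp add: isCont_def phi_0)
  qed
  then show ?thesis by (simp add: continuous_on_eq_continuous_at)
qed

lemma compact_shell: "compact {y. a \<le> \<phi> y \<and> \<phi> y \<le> b}"
proof -
  obtain m M where M: "m > 0" "M > 0" "\<And>y. m * (norm y)\<^sup>2 \<le> \<phi> y" "\<And>y. \<phi> y \<le> M * (norm y)\<^sup>2"
    using phi_bounds by blast
  have "closed {y. a \<le> \<phi> y \<and> \<phi> y \<le> b}"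
    by (intro closed_Collect_conj closed_Collect_le continuous_on_const continuous_phi)
  moreover have "bounded {y. a \<le> \<phi> y \<and> \<phi> y \<le> b}"
  proof (rule boundedI)
    fix y assume "y \<in> {y. a \<le> \<phi> y \<and> \<phi> y \<le> b}"
    then have "m * (norm y)\<^sup>2 \<le> b" using M(3)[of y] by auto
    then have "(norm y)\<^sup>2 \<le> b / m" using M(1) by (simp add: field_simps)
    then show "norm y \<le> sqrt (b / m)" by (rule real_le_rsqrt)
  qed
  ultimately show ?thesis using compact_eq_bounded_closed by blast
qed

end

locale minkowski_energy_const_det = minkowski_energy \<phi> for \<phi> :: "real^'n \<Rightarrow> real" +
  assumes det_const: "\<And>y z. y \<noteq> 0 \<Longrightarrow> z \<noteq> 0 \<Longrightarrow> det (hessian \<phi> y) = det (hessian \<phi> z)"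
begin

text \<open>Cramer's rule writes the entries of the inverse as polynomials in those of \<open>g\<close>, divided by the
  constant \<open>det g\<close>.\<close>

lemma smooth_h: "smooth_on (- {0}) (h k j)"
proof -
  obtain y0 :: "real^'n" where y0: "y0 \<noteq> 0" by (metis axis_eq_0_iff one_neq_zero)
  define c where "c = det (hessian \<phi> y0)"
  have *: "h k j y = det (\<chi> a l. if l = k then e j $ a else hessian \<phi> y $ a $ l) * (1 / c)" if "y \<noteq> 0" for y
  proof -
    have "hessian \<phi> y *v (column j (H y)) = e j"
      using H(1)[OF that]
      by (simp add: vec_eq_iff matrix_matrix_mult_def matrix_vector_mult_def column_def mat_def axis_def)
    then have "column j (H y) = (\<chi> k. det (\<chi> a l. if l = k then e j $ a else hessian \<phi> y $ a $ l) / det (hessian \<phi> y))"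
      using cramer[OF hessian_det[OF that]] by blast
    moreover have "h k j y = column j (H y) $ k" by (simp add: column_def)
    ultimately show ?thesis using det_const[OF that y0] by (simp add: c_def)
  qed
  have "smooth_on (- {0}) (\<lambda>y. det (\<chi> a l. if l = k then e j $ a else hessian \<phi> y $ a $ l) * (1 / c))"
  proof (intro smooth_on_mult smooth_on_det open_nz smooth_on_const)
    show "smooth_on (- {0}) (\<lambda>y. (\<chi> a l. if l = k then e j $ a else hessian \<phi> y $ a $ l) $ a $ l)" for a l
      using smooth_g[where i = a and j = l] by (cases "l = k") (simp_all add: hessian_nth smooth_on_const)
  qed
  then show ?thesis by (rule smooth_on_cong[OF open_nz]) (use * in auto)
qed

text \<open>The logarithmic derivative of the constant \<open>det g\<close> vanishes. In the language of Finsler geometry: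
  the mean Cartan torsion is zero.\<close>

lemma trace_dg: assumes "y \<noteq> 0" shows "(\<Sum>k\<in>UNIV. \<Sum>l\<in>UNIV. h k l y * dd (g k l) v y) = 0"
proof -
  define B where "B = (\<lambda>v. (\<chi> i j. dd (g i j) v y))"
  have "((\<lambda>y. det (hessian \<phi> y)) has_derivative
     (\<lambda>v. \<Sum>i\<in>UNIV. det (\<chi> a. if a = i then B v $ a else hessian \<phi> y $ a))) (at y)"
    by (rule has_derivative_det)
      (use smooth_on_has_derivative[OF smooth_g] assms in \<open>simp add: B_def hessian_nth\<close>)
  note 1 = this
  have 2: "((\<lambda>y. det (hessian \<phi> y)) has_derivative (\<lambda>v. 0)) (at y)"
    by (rule has_derivative_transform_within_open[OF has_derivative_const open_nz, of y "det (hessian \<phi> y)"])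
      (use assms in \<open>auto intro: det_const\<close>)
  have "(\<Sum>i\<in>UNIV. det (\<chi> a. if a = i then B v $ a else hessian \<phi> y $ a)) = 0"
    using fun_cong[OF has_derivative_unique[OF 1 2], of v] by simp
  then have "trace (B v ** H y) = 0"
    using sum_det_replaced_rows[OF H(2)[OF assms], of "B v"] hessian_det[OF assms] by simp
  then have "(\<Sum>k\<in>UNIV. \<Sum>l\<in>UNIV. dd (g k l) v y * h l k y) = 0"
    by (simp add: trace_def matrix_matrix_mult_def B_def)
  then show ?thesis by (simp add: H_sym[OF assms] mult.commute cong: sum.cong)
qed

text \<open>Differentiate \<open>g h = 1\<close> and multiply by \<open>h\<close>.\<close>

lemma dh: assumes "y \<noteq> 0"
  shows "dd (h k l) v y = - (\<Sum>a\<in>UNIV. \<Sum>b\<in>UNIV. h k a y * dd (g a b) v y * h b l y)"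
proof -
  define B where "B = (\<chi> i j. dd (g i j) v y)"
  define C where "C = (\<chi> i j. dd (h i j) v y)"
  have "(B ** H y + hessian \<phi> y ** C) $ i $ j = 0" for i j
  proof -
    have "dd (\<lambda>y. \<Sum>l\<in>UNIV. g i l y * h l j y) v y = (\<Sum>l\<in>UNIV. g i l y * dd (h l j) v y + dd (g i l) v y * h l j y)"
      using assms diffS[OF smooth_g] diffS[OF smooth_h] by (simp add: dd_sum dd_mult differentiable_mult)
    moreover have "dd (\<lambda>y. \<Sum>l\<in>UNIV. g i l y * h l j y) v y = dd (\<lambda>y. mat 1 $ i $ j) v y"
    proof (rule dd_cong_open[OF open_nz])
      fix z :: "real^'n" assume "z \<in> - {0}"
      then have "(hessian \<phi> z ** H z) $ i $ j = mat 1 $ i $ j" using H(1) by simp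
      then show "mat 1 $ i $ j = (\<Sum>l\<in>UNIV. g i l z * h l j z)"
        by (simp add: matrix_matrix_mult_def hessian_nth)
    qed (use assms in auto)
    ultimately show ?thesis
      by (simp add: B_def C_def matrix_matrix_mult_def hessian_nth sum.distrib)
  qed
  then have "B ** H y + hessian \<phi> y ** C = 0" by (simp add: vec_eq_iff)
  then have "H y ** (B ** H y + hessian \<phi> y ** C) = 0" by (simp add: matrix_matrix_mult_def vec_eq_iff)
  then have "H y ** (B ** H y) + H y ** (hessian \<phi> y ** C) = 0" by (simp add: matrix_add_ldistrib)
  then have "H y ** (B ** H y) + C = 0"
    using H(2)[OF assms] by (simp add: matrix_mul_assoc)
  then have "(H y ** (B ** H y)) $ k $ l + C $ k $ l = 0" by (metis vector_add_component zero_index)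
  then show ?thesis
    by (simp add: B_def C_def matrix_matrix_mult_def sum_distrib_left mult.assoc)
qed

text \<open>Since \<open>g\<close> is a Hessian, its derivative is totally symmetric; hence the divergence of the
  inverse matrix is again a logarithmic derivative of \<open>det g\<close>.\<close>

lemma div_h: assumes "y \<noteq> 0" shows "(\<Sum>k\<in>UNIV. dd (h k l) (e k) y) = 0"
proof -
  have sym: "dd (g a b) (e k) y = dd (g k a) (e b) y" for a b k
  proof -
    have "dd (g a b) (e k) y = dd (g k b) (e a) y" by (rule commute) (intro smooth_intros, fact)
    also have "\<dots> = dd (g b k) (e a) y" by (rule dg_sym[OF assms])
    also have "\<dots> = dd (g a k) (e b) y" by (rule commute) (intro smooth_intros, fact)
    also have "\<dots> = dd (g k a) (e b) y" by (rule dg_sym[OF assms])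
    finally show ?thesis .
  qed
  have "(\<Sum>k\<in>UNIV. dd (h k l) (e k) y)
      = - (\<Sum>k\<in>UNIV. \<Sum>a\<in>UNIV. \<Sum>b\<in>UNIV. h k a y * dd (g k a) (e b) y * h b l y)"
    by (simp add: dh[OF assms] sum_negf sym)
  also have "(\<Sum>k\<in>UNIV. \<Sum>a\<in>UNIV. \<Sum>b\<in>UNIV. h k a y * dd (g k a) (e b) y * h b l y)
      = (\<Sum>k\<in>UNIV. \<Sum>b\<in>UNIV. \<Sum>a\<in>UNIV. h k a y * dd (g k a) (e b) y * h b l y)"
    by (intro sum.cong refl sum.swap)
  also have "\<dots> = (\<Sum>b\<in>UNIV. \<Sum>k\<in>UNIV. \<Sum>a\<in>UNIV. h k a y * dd (g k a) (e b) y * h b l y)"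
    by (rule sum.swap)
  also have "\<dots> = (\<Sum>b\<in>UNIV. (\<Sum>k\<in>UNIV. \<Sum>a\<in>UNIV. h k a y * dd (g k a) (e b) y) * h b l y)"
    by (simp add: sum_distrib_right)
  also have "\<dots> = 0" by (simp add: trace_dg[OF assms])
  finally show ?thesis by simp
qed

text \<open>Moves the direction \<open>v\<close> to the inside past the two \<open>\<xi>\<close>; applied twice below, it reorders the
  fourth derivatives of \<open>\<phi>\<close>.\<close>

lemma dd3: "smooth_on (- {0}) p \<Longrightarrow> y \<noteq> 0 \<Longrightarrow> dd (dd (dd p \<xi>) \<xi>) v y = dd (dd (dd p v) \<xi>) \<xi> y"
  for p :: "real^'n \<Rightarrow> real"
  by (subst commute, rule smooth_on_dd, assumption+)
    (auto intro!: cong commute smooth_on_dd)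

text \<open>Differentiating the relation \<open>trace_dg\<close> once more: \<open>g\<^sub>\<xi>\<^sub>\<xi>\<close> is subharmonic for the operator
  with coefficients \<open>h\<close>.\<close>

lemma subsolution:
  fixes \<xi> y :: "real^'n"
  assumes "y \<noteq> 0"
  defines "B \<equiv> (\<chi> i j. dd (g i j) \<xi> y)"
  shows "(\<Sum>k\<in>UNIV. \<Sum>l\<in>UNIV. h k l y * dd (dd (dd (dd \<phi> \<xi>) \<xi>) (e l)) (e k) y)
    = trace (H y ** B ** H y ** B)"
proof -
  have d4: "dd (dd (dd (dd \<phi> \<xi>) \<xi>) (e l)) (e k) y = dd (dd (g k l) \<xi>) \<xi> y" for k l
  proof -
    have "dd (dd (dd (dd \<phi> \<xi>) \<xi>) (e l)) (e k) y = dd (dd (dd (dd \<phi> (e l)) \<xi>) \<xi>) (e k) y"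
      by (rule cong[OF dd3[OF smooth]]) (intro smooth_intros assms | simp)+
    also have "\<dots> = dd (dd (g k l) \<xi>) \<xi> y"
      by (rule dd3) (intro smooth_intros assms)+
    finally show ?thesis .
  qed
  have "0 = dd (\<lambda>y. \<Sum>k\<in>UNIV. \<Sum>l\<in>UNIV. h k l y * dd (g k l) \<xi> y) \<xi> y"
    using dd_cong_open[OF open_nz, of y "\<lambda>_. 0" "\<lambda>y. \<Sum>k\<in>UNIV. \<Sum>l\<in>UNIV. h k l y * dd (g k l) \<xi> y" \<xi>] assms(1) trace_dg
    by simp
  also have "\<dots> = (\<Sum>k\<in>UNIV. \<Sum>l\<in>UNIV. h k l y * dd (dd (g k l) \<xi>) \<xi> y + dd (h k l) \<xi> y * dd (g k l) \<xi> y)"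
    using assms(1) diffS[OF smooth_h] diffS[OF smooth_on_dd[OF smooth_g]]
    by (simp add: dd_sum dd_mult differentiable_mult differentiable_sum)
  finally have "(\<Sum>k\<in>UNIV. \<Sum>l\<in>UNIV. h k l y * dd (dd (g k l) \<xi>) \<xi> y)
      = - (\<Sum>k\<in>UNIV. \<Sum>l\<in>UNIV. dd (h k l) \<xi> y * dd (g k l) \<xi> y)"
    by (simp add: sum.distrib)
  also have "\<dots> = (\<Sum>k\<in>UNIV. \<Sum>l\<in>UNIV. (H y ** B ** H y) $ k $ l * B $ l $ k)"
  proof -
    have "(H y ** B ** H y) $ k $ l = - dd (h k l) \<xi> y" for k l
      unfolding matrix_mul_assoc[symmetric]
      by (simp add: matrix_matrix_mult_def B_def dh[OF assms(1)] sum_distrib_left mult.assoc)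
    moreover have "B $ l $ k = dd (g k l) \<xi> y" for k l
      using dg_sym[OF assms(1)] by (simp add: B_def)
    ultimately show ?thesis by (simp add: sum_negf)
  qed
  also have "\<dots> = trace (H y ** B ** H y ** B)"
    by (simp add: trace_def matrix_matrix_mult_def[of "H y ** B ** H y"])
  finally show ?thesis by (simp add: d4)
qed

text \<open>The vector field \<open>\<chi>(\<phi>) h \<nabla>g\<^sub>\<xi>\<^sub>\<xi>\<close>, with a cutoff \<open>\<chi>\<close> supported in a shell, has no flux through the
  level sets of \<open>\<phi>\<close>, because \<open>h \<nabla>\<phi>\<close> is the radial field and \<open>g\<^sub>\<xi>\<^sub>\<xi>\<close> is constant on rays. Since \<open>h\<close> is divergence free, the
  divergence of the field is the cutoff times the nonnegative quantity of \<open>subsolution\<close>, which must vanish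
  because the integral of the divergence does.\<close>

lemma dg_eq_0:
  assumes y0: "y0 \<noteq> 0"
  shows "dd (g i j) \<xi> y0 = 0"
proof -
  define B where "B = (\<lambda>y. (\<chi> i j. dd (g i j) \<xi> y))"
  define Q where "Q = (\<lambda>y. trace (H y ** B y ** H y ** B y))"
  have B_sym: "transpose (B y) = B y" if "y \<noteq> 0" for y
    using dg_sym[OF that] by (simp add: B_def vec_eq_iff transpose_def)
  have Q: "Q y \<ge> 0" "Q y = 0 \<Longrightarrow> B y = 0" if "y \<noteq> 0" for y
    using trace_HBHB[OF hessian_sym[OF that] posdef[OF that] H(2)[OF that] B_sym[OF that]]
    by (auto simp: Q_def)
  define f where "f = dd (dd \<phi> \<xi>) \<xi>"
  have f: "smooth_on (- {0}) f" unfolding f_def by (intro smooth_intros)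
  define a where "a = \<phi> y0"
  have a: "a > 0" using phi_pos[OF y0] by (simp add: a_def)
  define K where "K = {y. a / 2 \<le> \<phi> y \<and> \<phi> y \<le> 2 * a}"
  have K: "compact K" unfolding K_def by (rule compact_shell)
  have K: "compact K" "K \<subseteq> - {0}" using K by (auto simp: K_def phi_0 a not_le)
  define V where "V = (\<lambda>k y. \<Sum>l\<in>UNIV. h k l y * dd f (e l) y)"
  have V: "smooth_on (- {0}) (V k)" for k
    unfolding V_def by (intro smooth_on_sum smooth_on_mult smooth_h open_nz smooth_on_dd f)
  define W where "W = (\<lambda>k y. cutoff a (\<phi> y) * V k y)"
  have c: "((\<lambda>y. cutoff a (\<phi> y)) has_derivative (\<lambda>v. cutoff_deriv a (\<phi> y) * dd \<phi> v y)) (at y)" if "y \<noteq> 0" for y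
  proof -
    have "(cutoff a has_derivative (\<lambda>r. cutoff_deriv a (\<phi> y) * r)) (at (\<phi> y))"
      using DERIV_cutoff by (simp add: has_field_derivative_def)
    from diff_chain_at[OF smooth_on_has_derivative[OF smooth] this] that show ?thesis by (simp add: o_def)
  qed
  have W: "(W k has_derivative (\<lambda>v. cutoff a (\<phi> y) * dd (V k) v y + (cutoff_deriv a (\<phi> y) * dd \<phi> v y) * V k y)) (at y)"
    if "y \<noteq> 0" for k y
    unfolding W_def by (rule has_derivative_mult[OF c[OF that] smooth_on_has_derivative[OF V]]) (use that in auto)
  have Wdd: "dd (W k) v y = cutoff a (\<phi> y) * dd (V k) v y + cutoff_deriv a (\<phi> y) * dd \<phi> v y * V k y"
    if "y \<noteq> 0" for k y v
    using dd_eqI[OF W[OF that]] .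
  have Wdiff: "W k differentiable (at y)" if "y \<in> - {0}" for k y
    by (rule differentiableI[OF W]) (use that in simp)
  have Wcont: "continuous_on (- {0}) (dd (W k) v)" for k v
  proof -
    have 1: "continuous_on (- {0}) \<phi>" using continuous_phi continuous_on_subset by blast
    have "continuous_on (- {0}) (\<lambda>y. cutoff a (\<phi> y) * dd (V k) v y + cutoff_deriv a (\<phi> y) * dd \<phi> v y * V k y)"
      unfolding cutoff_def cutoff_deriv_def
      by (intro continuous_intros 1 smooth_on_continuous_on smooth_on_dd V smooth)
    then show ?thesis by (rule continuous_on_cong[THEN iffD2, rotated 2]) (use Wdd in auto)
  qed
  have Wsupp: "W k y = 0" if "y \<notin> K" for k y
    using cutoff_support[OF a, of "\<phi> y"] that by (auto simp: W_def K_def)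
  note C1 = compactly_supported_C1[OF open_nz K Wdiff Wcont Wsupp]
  define D where "D = (\<lambda>y. \<Sum>k\<in>UNIV. dd (W k) (e k) y)"
  have D: "D y = cutoff a (\<phi> y) * Q y" if "y \<noteq> 0" for y
  proof -
    \<comment> \<open>The term with the derivative of the cutoff: \<open>h \<nabla>\<phi>\<close> is the radial field \<open>y\<close>, and \<open>f\<close> is
      constant on rays.\<close>
    have "(\<Sum>k\<in>UNIV. dd \<phi> (e k) y * V k y) = 0"
    proof -
      have "(\<Sum>k\<in>UNIV. h k l y * dd \<phi> (e k) y) = y $ l" for l
      proof -
        have "dd \<phi> (e k) y = (hessian \<phi> y *v y) $ k" for k
          by (simp add: euler_d[OF that] matrix_vector_mult_def hessian_nth)
        then have "(\<Sum>k\<in>UNIV. h k l y * dd \<phi> (e k) y) = (H y *v (hessian \<phi> y *v y)) $ l"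
          using H_sym[OF that] by (simp add: matrix_vector_mult_def[of "H y"])
        then show ?thesis using H(2)[OF that] by (simp add: matrix_vector_mul_assoc)
      qed
      then have "(\<Sum>l\<in>UNIV. (\<Sum>k\<in>UNIV. h k l y * dd \<phi> (e k) y) * dd f (e l) y) = dd f y y"
        using dd_expand[OF diffS[OF f that], of y] by simp
      also have "dd f y y = 0"
        using euler_homogeneous[of f 0 y] hom_dd diffS[OF f that] that by (simp add: f_def)
      finally have "(\<Sum>l\<in>UNIV. \<Sum>k\<in>UNIV. h k l y * dd \<phi> (e k) y * dd f (e l) y) = 0"
        by (simp add: sum_distrib_right)
      then show ?thesis
        unfolding V_def sum_distrib_left by (subst sum.swap) (simp add: ac_simps)
    qed
    moreover have "(\<Sum>k\<in>UNIV. dd (V k) (e k) y) = Q y"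
    proof -
      have "dd (V k) (e k) y = (\<Sum>l\<in>UNIV. h k l y * dd (dd f (e l)) (e k) y + dd (h k l) (e k) y * dd f (e l) y)" for k
        using that diffS[OF smooth_h] diffS[OF smooth_on_dd[OF f]]
        by (simp add: V_def dd_sum dd_mult differentiable_mult)
      then have "(\<Sum>k\<in>UNIV. dd (V k) (e k) y) = (\<Sum>k\<in>UNIV. \<Sum>l\<in>UNIV. h k l y * dd (dd f (e l)) (e k) y)
          + (\<Sum>k\<in>UNIV. \<Sum>l\<in>UNIV. dd (h k l) (e k) y * dd f (e l) y)"
        by (simp add: sum.distrib)
      also have "(\<Sum>k\<in>UNIV. \<Sum>l\<in>UNIV. dd (h k l) (e k) y * dd f (e l) y)
          = (\<Sum>l\<in>UNIV. (\<Sum>k\<in>UNIV. dd (h k l) (e k) y) * dd f (e l) y)"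
        by (subst sum.swap) (simp add: sum_distrib_right)
      also have "\<dots> = 0" by (simp add: div_h[OF that])
      also have "(\<Sum>k\<in>UNIV. \<Sum>l\<in>UNIV. h k l y * dd (dd f (e l)) (e k) y) = Q y"
        using subsolution[OF that, of \<xi>] by (simp add: f_def Q_def B_def)
      finally show ?thesis by simp
    qed
    ultimately show ?thesis
      by (simp add: D_def Wdd[OF that] sum.distrib mult.assoc flip: sum_distrib_left)
  qed
  obtain b where b: "K \<subseteq> box (- b) b"
    using bounded_subset_box_symmetric[OF compact_imp_bounded[OF K(1)]] by blast
  have "y0 \<in> K" using a by (simp add: K_def a_def)
  have nonneg: "D y \<ge> 0" for y
  proof (cases "y = 0")
    case True
    then have "y \<notin> K" using K by auto
    then show ?thesis using C1(3) by (simp add: D_def)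
  next
    case False
    then show ?thesis using D Q cutoff_nonneg by simp
  qed
  have contD: "continuous_on (cbox (- b) b) D"
    unfolding D_def by (intro continuous_on_sum continuous_on_subset[OF C1(2)]) auto
  have int: "dd (W k) v integrable_on cbox (- b) b" for k v
    by (intro integrable_continuous continuous_on_subset[OF C1(2)]) auto
  have "integral (cbox (- b) b) D = (\<Sum>k\<in>UNIV. integral (cbox (- b) b) (dd (W k) (e k)))"
    unfolding D_def by (rule integral_sum) (use int in auto)
  also have "\<dots> = 0"
    using integral_dd_compact_support[OF open_nz K b Wdiff Wcont Wsupp] by simp
  finally have "\<forall>y\<in>cbox (- b) b. D y = 0"
    using integral_cbox_eq_0_iff[OF contD] nonneg b \<open>y0 \<in> K\<close> by auto
  then have "D y0 = 0" using b \<open>y0 \<in> K\<close> box_subset_cbox by blast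
  then have "Q y0 = 0" using D[OF y0] cutoff_pos[OF a] by (simp add: a_def)
  then have "B y0 $ i $ j = 0" using Q[OF y0] by simp
  then show ?thesis by (simp add: B_def)
qed

text \<open>From dimension two on the punctured space is connected, so \<open>g\<close>, having zero derivative, is constant. In
  dimension one the two half-lines are matched by the hypothesis on the determinant.\<close>

theorem deicke:
  assumes "y \<noteq> 0" "z \<noteq> 0"
  shows "hessian \<phi> y = hessian \<phi> z"
proof (cases "CARD('n) = 1")
  case True
  have "g i j y = g i j z" for i j
  proof -
    have ray: "hessian \<phi> (\<mu> *\<^sub>R x) = hessian \<phi> x" if "\<mu> > 0" "x \<noteq> 0" for \<mu> x
      using hom_dd[OF that] by (simp add: hessian_def)
    have U: "UNIV = {i}" using True by (metis UNIV_I card_1_singletonE singletonD)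
    have det: "det M = M $ i $ i" for M :: "real^'n^'n"
      unfolding det_def U by (simp add: sign_id permutes_sing)
    have "j = i" using U by (metis UNIV_I singletonD)
    then show ?thesis
      using det_const[OF assms] by (simp add: det hessian_nth)
  qed
  then show ?thesis by (simp add: vec_eq_iff hessian_nth)
next
  case False
  then have "2 \<le> CARD('n)"
    by (metis One_nat_def Suc_1 Suc_leI finite_UNIV_card_ge_0 finite le_neq_implies_less)
  then have conn: "connected (- {0::real^'n})" by (intro connected_punctured_universe) simp
  have "g i j y = g i j z" for i j
  proof -
    have "(g i j has_derivative (\<lambda>h. 0)) (at x)" if "x \<in> - {0}" for x
    proof -
      have "frechet_derivative (g i j) (at x) = (\<lambda>h. 0)"
        using dg_eq_0[of x] that by (intro ext) simp
      then show ?thesis using smooth_on_has_derivative[OF smooth_g[where i = i and j = j] that] by metis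
    qed
    then show ?thesis
      using has_derivative_zero_unique_connected[OF open_nz conn, of "g i j" y z] assms by simp
  qed
  then show ?thesis by (simp add: vec_eq_iff hessian_nth)
qed

end

section \<open>The volume of the unit balls of a smooth family of norms\<close>

text \<open>A continuous weight for radii between \<open>1\<close> and \<open>2\<close>. Its tail integral is \<open>C\<^sup>1\<close>, vanishes for large
  arguments and is constant near \<open>0\<close>, where a norm fails to be differentiable.\<close>

definition bump :: "real \<Rightarrow> real"
  where "bump r = max 0 ((r - 1) * (2 - r))"

definition bump_tail :: "real \<Rightarrow> real"
  where "bump_tail s = integral {-1..2} bump - integral {-1..s} bump"

lemma continuous_bump: "continuous_on S bump"
  unfolding bump_def by (intro continuous_intros)

lemma bump_nonneg: "bump r \<ge> 0"
  by (simp add: bump_def)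

lemma bump_eq_0: "r \<le> 1 \<or> r \<ge> 2 \<Longrightarrow> bump r = 0"
  unfolding bump_def by (intro max.absorb1) (auto intro: mult_nonpos_nonneg mult_nonneg_nonpos)

lemma bump_integrable: "bump integrable_on {a..b}"
  by (intro integrable_continuous_real continuous_bump)

lemma DERIV_bump_tail: assumes "s > -1" shows "(bump_tail has_real_derivative - bump s) (at s)"
proof -
  have "((\<lambda>x. integral {-1..x} bump) has_real_derivative bump s) (at s within {-1..s+1})"
    by (rule integral_has_real_derivative[OF continuous_bump]) (use assms in auto)
  then have "((\<lambda>x. integral {-1..x} bump) has_real_derivative bump s) (at s)"
    using assms by (simp add: at_within_Icc_at)
  then show ?thesis unfolding bump_tail_def by (auto intro!: derivative_eq_intros)
qed

lemma bump_tail_eq: assumes "s \<ge> -1" shows "bump_tail s = integral {s..2} bump"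
proof (cases "s \<le> 2")
  case True
  then show ?thesis
    using Henstock_Kurzweil_Integration.integral_combine[where f = bump and a = "-1" and c = s and b = 2] assms bump_integrable by (simp add: bump_tail_def)
next
  case False
  then have "integral {2..s} bump = integral {2..s} (\<lambda>_. 0)"
    by (intro integral_cong) (auto simp: bump_eq_0)
  then show ?thesis
    using False Henstock_Kurzweil_Integration.integral_combine[where f = bump and a = "-1" and c = 2 and b = s] bump_integrable by (simp add: bump_tail_def)
qed

lemma bump_tail_nonneg: "s \<ge> -1 \<Longrightarrow> bump_tail s \<ge> 0"
  by (simp add: bump_tail_eq integral_nonneg bump_integrable bump_nonneg)

lemma bump_tail_eq_0: "s \<ge> 2 \<Longrightarrow> bump_tail s = 0"
  using integral_null[of s 2 bump] by (simp add: bump_tail_eq)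

lemma nn_integral_bump:
  assumes "s \<ge> 0"
  shows "(\<integral>\<^sup>+r. ennreal (bump r) * indicator {s<..} r \<partial>lborel) = ennreal (bump_tail s)"
proof -
  have "(bump has_integral bump_tail s) {s..2}"
    using bump_tail_eq[of s] assms integrable_integral[OF bump_integrable, of s 2] by simp
  then have "((\<lambda>r. if r \<in> {s..2} then bump r else 0) has_integral bump_tail s) UNIV"
    by (simp only: has_integral_restrict_UNIV)
  then have "((\<lambda>r. bump r * indicator {s<..} r) has_integral bump_tail s) UNIV"
    by (rule has_integral_spike[of "{s}", rotated 2]) (auto simp: bump_eq_0)
  then have "(\<integral>\<^sup>+r. ennreal (bump r * indicator {s<..} r) \<partial>lborel) = ennreal (bump_tail s)"
    using borel_measurable_continuous_onI[OF continuous_bump]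
    by (intro nn_integral_has_integral_lborel) (auto simp: bump_nonneg)
  moreover have "ennreal (bump r * indicator {s<..} r) = ennreal (bump r) * indicator {s<..} r" for r
    by (simp add: indicator_def)
  ultimately show ?thesis by simp
qed

definition bump_moment :: "nat \<Rightarrow> real"
  where "bump_moment n = integral {1..2} (\<lambda>r. bump r * r ^ n)"

lemma bump_moment_pos: "bump_moment n > 0"
proof -
  have c: "continuous_on (cbox 1 2) (\<lambda>r. bump r * r ^ n)" by (intro continuous_intros continuous_bump)
  have "bump_moment n \<noteq> 0"
  proof
    assume "bump_moment n = 0"
    then have "\<forall>r\<in>cbox 1 2. bump r * r ^ n = 0"
      using integral_cbox_eq_0_iff[OF c] bump_nonneg by (simp add: bump_moment_def)
    then have "bump (3/2) * (3/2) ^ n = 0"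
      by (rule bspec) simp
    then show False by (simp add: bump_def)
  qed
  moreover have "bump_moment n \<ge> 0"
    unfolding bump_moment_def
    by (intro integral_nonneg integrable_continuous_real) (use c bump_nonneg in auto)
  ultimately show ?thesis by simp
qed

text \<open>Layer-cake formula. Weighting with the \<open>C\<^sup>1\<close> function \<open>bump_tail\<close> instead of the
  indicator of the ball makes the volume accessible to differentiation under the integral.\<close>

lemma integral_bump_tail:
  fixes N :: "'d::euclidean_space \<Rightarrow> real"
  assumes cont: "continuous_on UNIV N" and nonneg: "\<And>y. N y \<ge> 0"
    and hom: "\<And>\<mu> y. \<mu> > 0 \<Longrightarrow> N (\<mu> *\<^sub>R y) = \<mu> * N y"
  shows "(\<integral>\<^sup>+y. ennreal (bump_tail (N y)) \<partial>lborel) = ennreal (bump_moment DIM('d)) * emeasure lborel {y. N y < 1}"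
proof -
  have [measurable]: "N \<in> borel_measurable borel" "bump \<in> borel_measurable borel"
    using cont continuous_bump by (auto intro: borel_measurable_continuous_onI)
  have op: "open {y. N y < r}" for r
    by (intro open_Collect_less cont continuous_on_const)
  have scale: "emeasure lborel {y. N y < r} = ennreal (r ^ DIM('d)) * emeasure lborel {y. N y < 1}" if "r > 0" for r
  proof -
    have "{y. N y < r} = (\<lambda>y. r *\<^sub>R y + 0) ` {y. N y < 1}"
    proof (intro set_eqI iffI)
      fix y assume "y \<in> {y. N y < r}"
      then have "inverse r * N y < 1" using that by (simp add: field_simps)
      then have "N (inverse r *\<^sub>R y) < 1" using hom[of "inverse r" y] that by simp
      moreover have "y = r *\<^sub>R (inverse r *\<^sub>R y) + 0" using that by simp
      ultimately show "y \<in> (\<lambda>y. r *\<^sub>R y + 0) ` {y. N y < 1}" by blast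
    qed (use hom that in auto)
    then have "emeasure lebesgue {y. N y < r} = ennreal (r ^ DIM('d)) * emeasure lebesgue {y. N y < 1}"
      using emeasure_lebesgue_affine[of r 0 "{y. N y < 1}"] that by (simp add: ennreal_power)
    then show ?thesis using op by simp
  qed
  have "(\<integral>\<^sup>+y. ennreal (bump_tail (N y)) \<partial>lborel)
      = (\<integral>\<^sup>+y. (\<integral>\<^sup>+r. ennreal (bump r) * indicator {N y<..} r \<partial>lborel) \<partial>lborel)"
    using nn_integral_bump nonneg by simp
  also have "\<dots> = (\<integral>\<^sup>+y. (\<integral>\<^sup>+r. (if N y < r then ennreal (bump r) else 0) \<partial>lborel) \<partial>lborel)"
    by (intro nn_integral_cong) (auto simp: indicator_def)
  also have "\<dots> = (\<integral>\<^sup>+r. (\<integral>\<^sup>+y. (if N y < r then ennreal (bump r) else 0) \<partial>lborel) \<partial>lborel)"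
    by (rule lborel_pair.Fubini') measurable
  also have "\<dots> = (\<integral>\<^sup>+r. ennreal (bump r) * emeasure lborel {y. N y < r} \<partial>lborel)"
  proof (rule nn_integral_cong)
    fix r
    have "(\<integral>\<^sup>+y. (if N y < r then ennreal (bump r) else 0) \<partial>lborel)
        = (\<integral>\<^sup>+y. ennreal (bump r) * indicator {y. N y < r} y \<partial>lborel)"
      by (intro nn_integral_cong) auto
    also have "\<dots> = ennreal (bump r) * emeasure lborel {y. N y < r}"
      using op[of r] by (intro nn_integral_cmult_indicator) simp
    finally show "(\<integral>\<^sup>+y. (if N y < r then ennreal (bump r) else 0) \<partial>lborel) = ennreal (bump r) * emeasure lborel {y. N y < r}" .
  qed
  also have "\<dots> = (\<integral>\<^sup>+r. ennreal (bump r * r ^ DIM('d)) * emeasure lborel {y. N y < 1} \<partial>lborel)"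
  proof (rule nn_integral_cong)
    fix r
    show "ennreal (bump r) * emeasure lborel {y. N y < r} = ennreal (bump r * r ^ DIM('d)) * emeasure lborel {y. N y < 1}"
      using scale[of r] bump_eq_0[of r] by (cases "r > 0") (auto simp: ennreal_mult bump_nonneg mult.assoc)
  qed
  also have "\<dots> = (\<integral>\<^sup>+r. ennreal (bump r * r ^ DIM('d)) \<partial>lborel) * emeasure lborel {y. N y < 1}"
    by (rule nn_integral_multc) measurable
  also have "(\<integral>\<^sup>+r. ennreal (bump r * r ^ DIM('d)) \<partial>lborel) = ennreal (bump_moment DIM('d))"
  proof (rule nn_integral_has_integral_lborel)
    have "((\<lambda>r. bump r * r ^ DIM('d)) has_integral bump_moment DIM('d)) {1..2}"
      unfolding bump_moment_def
      by (intro integrable_integral integrable_continuous_real continuous_intros continuous_bump)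
    then show "((\<lambda>r. bump r * r ^ DIM('d)) has_integral bump_moment DIM('d)) UNIV"
      by (rule has_integral_on_superset) (auto simp: bump_eq_0)
    show "0 \<le> bump r * r ^ DIM('d)" for r :: real
      using bump_eq_0[of r] bump_nonneg[of r] by (cases "r \<le> 1") auto
  qed measurable
  finally show ?thesis .
qed

lemma measure_unit_ball_eq_integral:
  fixes N :: "'d::euclidean_space \<Rightarrow> real"
  assumes cont: "continuous_on UNIV N" and nonneg: "\<And>y. N y \<ge> 0"
    and hom: "\<And>\<mu> y. \<mu> > 0 \<Longrightarrow> N (\<mu> *\<^sub>R y) = \<mu> * N y"
    and supp: "\<And>y. N y \<le> 2 \<Longrightarrow> y \<in> cbox a b"
  shows "measure lborel {y. N y < 1} = integral (cbox a b) (\<lambda>y. bump_tail (N y)) / bump_moment DIM('d)"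
    and "continuous_on UNIV (\<lambda>y. bump_tail (N y))"
proof -
  have "isCont bump_tail s" if "s \<ge> 0" for s
    using DERIV_isCont[OF DERIV_bump_tail] that by simp
  then have ct: "continuous_on {0..} bump_tail" by (simp add: continuous_at_imp_continuous_on)
  show c: "continuous_on UNIV (\<lambda>y. bump_tail (N y))"
    by (rule continuous_on_compose2[OF ct cont]) (use nonneg in auto)
  have "bump_tail (N y) = 0" if "y \<notin> cbox a b" for y
    using supp[of y] that bump_tail_eq_0[of "N y"] by force
  then have "((\<lambda>y. bump_tail (N y)) has_integral integral (cbox a b) (\<lambda>y. bump_tail (N y))) UNIV"
    by (intro has_integral_on_superset[OF integrable_integral] integrable_continuous
        continuous_on_subset[OF c]) auto
  then have "(\<integral>\<^sup>+y. ennreal (bump_tail (N y)) \<partial>lborel) = ennreal (integral (cbox a b) (\<lambda>y. bump_tail (N y)))"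
    using nonneg by (intro nn_integral_has_integral_lborel borel_measurable_continuous_onI c)
       (auto intro!: bump_tail_nonneg order_trans[OF _ nonneg])
  then have eq: "ennreal (bump_moment DIM('d)) * emeasure lborel {y. N y < 1} = ennreal (integral (cbox a b) (\<lambda>y. bump_tail (N y)))"
    using integral_bump_tail[OF cont nonneg hom] by simp
  have "integral (cbox a b) (\<lambda>y. bump_tail (N y)) \<ge> 0"
    by (intro integral_nonneg integrable_continuous continuous_on_subset[OF c])
      (auto intro!: bump_tail_nonneg order_trans[OF _ nonneg])
  then have "bump_moment DIM('d) * measure lborel {y. N y < 1} = integral (cbox a b) (\<lambda>y. bump_tail (N y))"
    using arg_cong[OF eq, of enn2real] bump_moment_pos[of "DIM('d)"] by (simp add: enn2real_mult measure_def)
  then show "measure lborel {y. N y < 1} = integral (cbox a b) (\<lambda>y. bump_tail (N y)) / bump_moment DIM('d)"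
    using bump_moment_pos[of "DIM('d)"] by (simp add: field_simps)
qed

locale smooth_norm_family =
  fixes U :: "'e::euclidean_space set" and f :: "'e \<times> 'd::euclidean_space \<Rightarrow> real"
  assumes U: "open U"
    and smooth: "smooth_on (U \<times> - {0}) f"
    and pos: "\<And>x y. x \<in> U \<Longrightarrow> y \<noteq> 0 \<Longrightarrow> f (x, y) > 0"
    and hom: "\<And>x y \<mu>. x \<in> U \<Longrightarrow> \<mu> > 0 \<Longrightarrow> f (x, \<mu> *\<^sub>R y) = \<mu> * f (x, y)"
begin

lemma zero: "x \<in> U \<Longrightarrow> f (x, 0) = 0"
  using hom[of x 2 0] by simp

lemma nonneg: "x \<in> U \<Longrightarrow> f (x, y) \<ge> 0"
  using pos[of x y] zero[of x] by (cases "y = 0") auto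

lemma locally_bounded:
  assumes "x0 \<in> U"
  obtains r m M where "r > 0" "m > 0" "M > 0" "ball x0 r \<subseteq> U"
    "\<And>x y. x \<in> ball x0 r \<Longrightarrow> m * norm y \<le> f (x, y)" "\<And>x y. x \<in> ball x0 r \<Longrightarrow> f (x, y) \<le> M * norm y"
proof -
  obtain r where r: "r > 0" "cball x0 r \<subseteq> U" using U assms open_contains_cball by blast
  define K where "K = cball x0 r \<times> sphere (0::'d) 1"
  have K: "compact K" unfolding K_def by (intro compact_Times) auto
  obtain s where "s \<in> sphere (0::'d) 1" using vector_choose_size[of 1] by (metis mem_sphere_0 zero_le_one)
  then have ne: "K \<noteq> {}" using r unfolding K_def by force
  have sub: "K \<subseteq> U \<times> - {0}" using r by (auto simp: K_def)
  have cont: "continuous_on K f"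
    using smooth_on_continuous_on[OF smooth] sub continuous_on_subset by blast
  obtain a where a: "a \<in> K" "\<And>z. z \<in> K \<Longrightarrow> f a \<le> f z"
    using continuous_attains_inf[OF K ne cont] by blast
  obtain b where b: "b \<in> K" "\<And>z. z \<in> K \<Longrightarrow> f z \<le> f b"
    using continuous_attains_sup[OF K ne cont] by blast
  have fp: "f z > 0" if "z \<in> K" for z using pos[of "fst z" "snd z"] that sub by (cases z) auto
  have ap: "f a > 0" and bp: "f b > 0" using fp a(1) b(1) by auto
  have main: "f a * norm y \<le> f (x, y) \<and> f (x, y) \<le> f b * norm y" if "x \<in> ball x0 r" for x y
  proof (cases "y = 0")
    case False
    have xU: "x \<in> U" using that r by auto
    have "(x, y /\<^sub>R norm y) \<in> K" using False that by (auto simp: K_def)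
    then have "f a \<le> f (x, y /\<^sub>R norm y)" "f (x, y /\<^sub>R norm y) \<le> f b" using a(2) b(2) by blast+
    moreover have "f (x, y) = f (x, y /\<^sub>R norm y) * norm y"
      using hom[OF xU, of "norm y" "y /\<^sub>R norm y"] False by simp
    ultimately show ?thesis by (auto intro!: mult_right_mono)
  next
    case True
    moreover have "x \<in> U" using that r by auto
    ultimately show ?thesis using zero[of x] by simp
  qed
  show ?thesis by (rule that[of r "f a" "f b"]) (use main r ap bp in auto)
qed

lemma continuous_fibre: assumes "x \<in> U" shows "continuous_on UNIV (\<lambda>y. f (x, y))"
proof -
  obtain r m M where M: "r > 0" "m > 0" "M > 0" "ball x r \<subseteq> U"
    "\<And>z y. z \<in> ball x r \<Longrightarrow> m * norm y \<le> f (z, y)" "\<And>z y. z \<in> ball x r \<Longrightarrow> f (z, y) \<le> M * norm y"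
    using locally_bounded[OF assms] by metis
  have "isCont (\<lambda>y. f (x, y)) y" for y
  proof (cases "y = 0")
    case False
    have "continuous_on (- {0}) (\<lambda>y. f (x, y))"
      by (rule continuous_on_compose2[OF smooth_on_continuous_on[OF smooth]])
        (use assms in \<open>auto intro!: continuous_intros\<close>)
    then show ?thesis using False continuous_on_eq_continuous_at[of "- {0}"] by auto
  next
    case True
    have "((\<lambda>y. f (x, y)) \<longlongrightarrow> 0) (at 0)"
    proof (rule Lim_null_comparison)
      show "\<forall>\<^sub>F y in at 0. norm (f (x, y)) \<le> M * norm y"
        using M nonneg[OF assms] by (intro always_eventually) simp
      show "((\<lambda>y. M * norm y) \<longlongrightarrow> 0) (at (0::'d))"
        by (auto intro!: tendsto_eq_intros)
    qed
    then show ?thesis using True zero[OF assms] by (simp add: isCont_def)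
  qed
  then show ?thesis by (simp add: continuous_on_eq_continuous_at)
qed

definition vol :: "'e \<Rightarrow> real" where "vol x = measure lborel {y. f (x, y) < 1}"

lemma open_ball_fibre: "x \<in> U \<Longrightarrow> open {y. f (x, y) < 1}"
  by (intro open_Collect_less continuous_fibre continuous_on_const)

lemma bounded_ball_fibre: assumes "x \<in> U" shows "bounded {y. f (x, y) < 1}"
proof -
  obtain r m M where M: "r > 0" "m > 0" "M > 0" "ball x r \<subseteq> U"
    "\<And>z y. z \<in> ball x r \<Longrightarrow> m * norm y \<le> f (z, y)" "\<And>z y. z \<in> ball x r \<Longrightarrow> f (z, y) \<le> M * norm y"
    using locally_bounded[OF assms] by metis
  show ?thesis
  proof (rule boundedI)
    fix y assume "y \<in> {y. f (x, y) < 1}"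
    then have "m * norm y < 1" using M(5)[of x y] M(1) by auto
    then show "norm y \<le> 1 / m" using M(2) by (simp add: field_simps)
  qed
qed

lemma vol_pos: assumes "x \<in> U" shows "vol x > 0"
proof -
  have "{y. f (x, y) < 1} \<noteq> {}" using zero[OF assms] by (metis empty_Collect_eq less_numeral_extra(1))
  then have "\<not> negligible {y. f (x, y) < 1}" using open_not_negligible[OF open_ball_fibre[OF assms]] by blast
  moreover have "{y. f (x, y) < 1} \<in> lmeasurable"
    by (intro lmeasurable_open open_ball_fibre bounded_ball_fibre assms)
  ultimately have "measure lebesgue {y. f (x, y) < 1} \<noteq> 0" using negligible_iff_measure by blast
  then show ?thesis using open_ball_fibre[OF assms] by (simp add: vol_def less_le)
qed

text \<open>Up to a constant factor the volume is the integral of \<open>bump_tail (f (x, y))\<close> over a fixed box, and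
  the integrand is \<open>C\<^sup>1\<close> in \<open>x\<close>, also at \<open>y = 0\<close>.\<close>

lemma vol_differentiable: assumes x0: "x0 \<in> U" shows "vol differentiable (at x0)"
proof -
  obtain r m M where M: "r > 0" "m > 0" "M > 0" "ball x0 r \<subseteq> U"
    "\<And>x y. x \<in> ball x0 r \<Longrightarrow> m * norm y \<le> f (x, y)" "\<And>x y. x \<in> ball x0 r \<Longrightarrow> f (x, y) \<le> M * norm y"
    using locally_bounded[OF assms] by metis
  define B where "B = ball x0 r"
  obtain b where b: "cball (0::'d) (2 / m) \<subseteq> box (- b) b"
    using bounded_subset_box_symmetric[OF bounded_cball] by blast
  have supp: "y \<in> cbox (- b) b" if "x \<in> B" "f (x, y) \<le> 2" for x y
  proof -
    have "m * norm y \<le> 2" using M(5)[of x y] that by (auto simp: B_def)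
    then have "norm y \<le> 2 / m" using M(2) by (simp add: field_simps)
    then show ?thesis using b box_subset_cbox by (metis mem_cball_0 subsetD)
  qed
  have BU: "B \<subseteq> U" using M by (simp add: B_def)
  define J where "J = (\<lambda>x. integral (cbox (- b) b) (\<lambda>y. bump_tail (f (x, y))))"
  have vol: "vol x = J x / bump_moment DIM('d)" if "x \<in> B" for x
    unfolding vol_def J_def using that BU
    by (intro measure_unit_ball_eq_integral(1) continuous_fibre nonneg hom supp) auto
  \<comment> \<open>The partial derivative of the integrand in the direction \<open>i\<close>; it vanishes for \<open>y\<close> near \<open>0\<close>
    because \<open>bump\<close> does so up to \<open>1\<close>.\<close>
  define c where "c = (\<lambda>i (x, y). if y = 0 then 0 else - bump (f (x, y)) * dd f (i, 0) (x, y))"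
  have c: "continuous_on (B \<times> UNIV) (c i)" for i :: 'e
  proof -
    have o1: "open (B \<times> - {0::'d})" and o2: "open (B \<times> ball (0::'d) (1 / M))"
      by (auto intro!: open_Times simp: B_def)
    have "continuous_on (B \<times> - {0}) (\<lambda>z. - bump (f z) * dd f (i, 0) z)"
      by (intro continuous_intros continuous_on_compose2[OF continuous_bump[of UNIV]]
          continuous_on_subset[OF smooth_on_continuous_on[OF smooth]]
          continuous_on_subset[OF smooth_on_continuous_on[OF smooth_on_dd[OF smooth]]])
        (use BU in auto)
    then have 1: "continuous_on (B \<times> - {0}) (c i)"
      by (rule continuous_on_cong[THEN iffD2, OF refl, rotated]) (auto simp: c_def split: if_splits)
    have "c i z = 0" if "z \<in> B \<times> ball (0::'d) (1 / M)" for z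
    proof -
      have "f z \<le> M * norm (snd z)" using M(6)[of "fst z" "snd z"] that by (auto simp: B_def)
      also have "\<dots> \<le> 1" using that M(3) by (auto simp: field_simps)
      finally show ?thesis using bump_eq_0[of "f z"] by (auto simp: c_def split: prod.splits)
    qed
    then have 2: "continuous_on (B \<times> ball (0::'d) (1 / M)) (c i)"
      using continuous_on_cong[of _ _ "c i" "\<lambda>_. 0"] by simp
    have "B \<times> - {0} \<union> B \<times> ball (0::'d) (1 / M) = B \<times> UNIV" using M(3) by auto
    then show ?thesis using continuous_on_open_Un[OF o1 o2 1 2] by simp
  qed
  define fx where "fx = (\<lambda>x y. \<Sum>i\<in>Basis. c i (x, y) *\<^sub>R blinfun_inner_right i)"
  have "(J has_derivative integral (cbox (- b) b) (fx x0)) (at x0 within B)"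
    unfolding J_def
  proof (rule leibniz_rule)
    fix x and y :: 'd assume x: "x \<in> B"
    have "((\<lambda>x. bump_tail (f (x, y))) has_derivative blinfun_apply (fx x y)) (at x)"
    proof (cases "y = 0")
      case True
      have "((\<lambda>x. bump_tail (f (x, y))) has_derivative (\<lambda>_. 0)) (at x)"
        by (rule has_derivative_transform_within_open[of "\<lambda>_. bump_tail 0" _ _ _ B])
          (use True x BU zero in \<open>auto simp: B_def\<close>)
      moreover have "blinfun_apply (fx x y) = (\<lambda>_. 0)"
        by (auto simp: fx_def c_def True)
      ultimately show ?thesis by simp
    next
      case False
      have xU: "(x, y) \<in> U \<times> - {0}" using False x BU by auto
      have f: "(f has_derivative frechet_derivative f (at (x, y))) (at (x, y))"
        by (rule smooth_on_has_derivative[OF smooth xU])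
      interpret lf: linear "frechet_derivative f (at (x, y))" using has_derivative_linear[OF f] .
      have "((\<lambda>x. (x, y)) has_derivative (\<lambda>v. (v, 0))) (at x)"
        by (auto intro!: derivative_eq_intros)
      from diff_chain_at[OF this f]
      have 1: "((\<lambda>x. f (x, y)) has_derivative (\<lambda>v. dd f (v, 0) (x, y))) (at x)" by (simp add: o_def)
      have "f (x, y) > -1" using nonneg[of x y] x BU by force
      then have "(bump_tail has_derivative (\<lambda>t. - bump (f (x, y)) * t)) (at (f (x, y)))"
        using DERIV_bump_tail unfolding has_field_derivative_def by blast
      from diff_chain_at[OF 1 this]
      have 2: "((\<lambda>x. bump_tail (f (x, y))) has_derivative (\<lambda>v. - bump (f (x, y)) * dd f (v, 0) (x, y))) (at x)"
        by (simp add: o_def)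
      have expand: "dd f (v, 0) (x, y) = (\<Sum>i\<in>Basis. (v \<bullet> i) * dd f (i, 0) (x, y))" for v
      proof -
        have "(v, 0::'d) = (\<Sum>i\<in>Basis. (v \<bullet> i) *\<^sub>R (i, 0))"
          by (simp add: prod_eq_iff fst_sum snd_sum euclidean_representation)
        then have "dd f (v, 0) (x, y) = dd f (\<Sum>i\<in>Basis. (v \<bullet> i) *\<^sub>R (i, 0)) (x, y)" by simp
        then show ?thesis by (simp only: lf.sum lf.scaleR real_scaleR_def)
      qed
      have "blinfun_apply (fx x y) v = (\<Sum>i\<in>Basis. - bump (f (x, y)) * ((v \<bullet> i) * dd f (i, 0) (x, y)))" for v
        using False unfolding fx_def blinfun.sum_left blinfun.scaleR_left
        by (intro sum.cong refl) (simp add: c_def inner_commute)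
      then have "blinfun_apply (fx x y) v = - bump (f (x, y)) * dd f (v, 0) (x, y)" for v
        unfolding expand[of v] sum_distrib_left .
      then have "blinfun_apply (fx x y) = (\<lambda>v. - bump (f (x, y)) * dd f (v, 0) (x, y))" by blast
      with 2 show ?thesis by simp
    qed
    then show "((\<lambda>x. bump_tail (f (x, y))) has_derivative blinfun_apply (fx x y)) (at x within B)"
      by (rule has_derivative_at_withinI)
  next
    fix x assume "x \<in> B"
    then show "(\<lambda>y. bump_tail (f (x, y))) integrable_on cbox (- b) b"
      using BU supp
      by (intro integrable_continuous continuous_on_subset[OF measure_unit_ball_eq_integral(2)[of "\<lambda>y. f (x, y)" "- b" b]]
          continuous_fibre nonneg hom) auto
  next
    show "continuous_on (B \<times> cbox (- b) b) (\<lambda>(x, y). fx x y)"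
      unfolding fx_def case_prod_beta
      by (intro continuous_on_sum continuous_on_scaleR continuous_on_const)
        (simp, rule continuous_on_subset[OF c], auto)
  qed (use M in \<open>auto simp: B_def\<close>)
  moreover have "at x0 within B = at x0" by (rule at_within_open) (use M in \<open>auto simp: B_def\<close>)
  ultimately have "(J has_derivative integral (cbox (- b) b) (fx x0)) (at x0)" by simp
  then have "((\<lambda>x. J x / bump_moment DIM('d)) has_derivative
      (\<lambda>v. integral (cbox (- b) b) (fx x0) v / bump_moment DIM('d))) (at x0)"
    using bump_moment_pos[of "DIM('d)"] by (auto intro!: derivative_eq_intros)
  then have "(vol has_derivative
      (\<lambda>v. integral (cbox (- b) b) (fx x0) v / bump_moment DIM('d))) (at x0)"
    by (rule has_derivative_transform_within_open[of _ _ _ _ B]) (use M vol in \<open>auto simp: B_def\<close>)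
  then show ?thesis by (rule differentiableI)
qed

end

section \<open>Linear images scale the volume by the determinant\<close>

text \<open>The volume factor and the determinant are both multiplicative in \<open>f\<close>, so it suffices to treat
  elementary maps. Transpositions of coordinates and shears preserve the volume and have determinant
  \<open>1\<close> up to sign.\<close>

lemma measure_linear_image_det:
  fixes f :: "real^'n \<Rightarrow> real^'n"
  assumes "linear f" "S \<in> lmeasurable"
  shows "f ` S \<in> lmeasurable \<and> measure lebesgue (f ` S) = \<bar>det (matrix f)\<bar> * measure lebesgue S"
proof -
  define P where "P = (\<lambda>f :: real^'n \<Rightarrow> real^'n. \<forall>S\<in>lmeasurable.
    f ` S \<in> lmeasurable \<and> measure lebesgue (f ` S) = \<bar>det (matrix f)\<bar> * measure lebesgue S)"
  have unimodular: "P h"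
    if "linear h" "\<And>a b. measure lebesgue (h ` cbox a b) = measure lebesgue (cbox a b)" "\<bar>det (matrix h)\<bar> = 1" for h
    unfolding P_def
  proof
    fix S :: "(real^'n) set" assume S: "S \<in> lmeasurable"
    have "h ` S \<in> lmeasurable \<and> 1 * measure lebesgue S = measure lebesgue (h ` S)"
      by (rule measure_linear_sufficient[OF that(1) S]) (simp only: that(2) mult_1)
    then show "h ` S \<in> lmeasurable \<and> measure lebesgue (h ` S) = \<bar>det (matrix h)\<bar> * measure lebesgue S"
      using that(3) by (metis mult_1)
  qed
  have "P f"
  proof (rule induct_linear_elementary[OF \<open>linear f\<close>])
    fix f g assume "linear f" "linear g" "P f" "P g"
    then show "P (f \<circ> g)"
      unfolding P_def image_comp[symmetric] matrix_compose[OF \<open>linear g\<close> \<open>linear f\<close>] det_mul abs_mult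
      by simp
  next
    fix f :: "real^'n \<Rightarrow> real^'n" and i assume f: "linear f" "\<And>x. f x $ i = 0"
    have "\<not> surj f"
    proof
      assume "surj f"
      then obtain x where "f x = axis i 1" by (metis surjD)
      then have "f x $ i = 1" by simp
      then show False using f(2) by simp
    qed
    then have "\<not> inj f" using linear_injective_imp_surjective[OF f(1)] by blast
    then have "det (matrix f) = 0" "negligible (f ` T)" for T
      using det_nz_iff_inj[OF f(1)] negligible_linear_singular_image[OF f(1)] by blast+
    then show "P f"
      unfolding P_def by (simp add: negligible_iff_measure)
  next
    fix c :: "'n \<Rightarrow> real"
    show "P (\<lambda>x. \<chi> i. c i * x $ i)"
      unfolding P_def by (simp add: measurable_stretch measure_stretch matrix_def axis_def det_diagonal)
  next
    fix m n :: 'n assume "m \<noteq> n"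
    let ?\<tau> = "Transposition.transpose m n"
    let ?h = "\<lambda>x::real^'n. \<chi> i. x $ ?\<tau> i"
    show "P ?h"
    proof (rule unimodular)
      show "linear ?h" by (rule linearI) (simp_all add: vec_eq_iff)
      have eq: "?h ` cbox a b = cbox (?h a) (?h b)" for a b
      proof (intro set_eqI iffI)
        fix x assume x: "x \<in> cbox (?h a) (?h b)"
        have "a $ i \<le> ?h x $ i \<and> ?h x $ i \<le> b $ i" for i
          using x unfolding mem_box_cart by (drule_tac spec[of _ "?\<tau> i"]) simp
        then have "?h x \<in> cbox a b" unfolding mem_box_cart by blast
        moreover have "x = ?h (?h x)" by (simp add: vec_eq_iff)
        ultimately show "x \<in> ?h ` cbox a b" by blast
      qed (auto simp: mem_box_cart)
      show "measure lebesgue (?h ` cbox a b) = measure lebesgue (cbox a b)" for a b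
      proof (cases "cbox a b = {}")
        case False
        then have "cbox (?h a) (?h b) \<noteq> {}" using eq[of a b] by blast
        moreover have "(\<Prod>i\<in>UNIV. b $ ?\<tau> i - a $ ?\<tau> i) = (\<Prod>i\<in>UNIV. b $ i - a $ i)"
          by (rule prod.reindex_bij_betw[where g = "\<lambda>i. b $ i - a $ i"]) simp
        ultimately show ?thesis using False by (simp add: eq content_cbox_cart)
      qed simp
      have "matrix ?h = (\<chi> i. mat 1 $ ?\<tau> i)"
        by (simp add: matrix_def mat_def axis_def vec_eq_iff)
      then show "\<bar>det (matrix ?h)\<bar> = 1"
        using det_permute_rows[OF permutes_swap_id[of m UNIV n], of "mat 1 :: real^'n^'n"]
        by (simp add: sign_swap_id)
    qed
  next
    fix m n :: 'n assume mn: "m \<noteq> n"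
    let ?h = "\<lambda>x::real^'n. \<chi> i. if i = m then x $ m + x $ n else x $ i"
    show "P ?h"
    proof (rule unimodular)
      show lin: "linear ?h" by (rule linearI) (simp_all add: vec_eq_iff algebra_simps)
      show "measure lebesgue (?h ` cbox a b) = measure lebesgue (cbox a b)" for a b
      proof (cases "cbox a b = {}")
        case False
        define d where "d = axis n (- (a $ n))"
        have eq: "cbox (d + a) (d + b) = (+) d ` cbox a b" by (rule cbox_translation)
        have "?h ` cbox (d + a) (d + b) = (+) (?h d) ` ?h ` cbox a b"
          unfolding eq image_image by (simp add: linear_add[OF lin])
        then have "measure lebesgue (?h ` cbox (d + a) (d + b)) = measure lebesgue (?h ` cbox a b)"
          by (simp add: measure_translation)
        moreover have "measure lebesgue (?h ` cbox (d + a) (d + b)) = measure lebesgue (cbox (d + a) (d + b))"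
          by (rule measure_shear_interval[OF mn]) (use False eq in \<open>auto simp: d_def\<close>)
        moreover have "measure lebesgue (cbox (d + a) (d + b)) = measure lebesgue (cbox a b)"
          unfolding eq by (rule measure_translation)
        ultimately show ?thesis by simp
      qed simp
      have "matrix ?h = (\<chi> k. if k = m then row m (mat 1) + 1 *s row n (mat 1) else row k (mat 1))"
        using mn by (auto simp: matrix_def mat_def axis_def row_def vec_eq_iff)
      then show "\<bar>det (matrix ?h)\<bar> = 1"
        using det_row_operation[OF mn, where A = "mat 1 :: real^'n^'n" and c = 1] by simp
    qed
  qed
  then show ?thesis using assms(2) by (simp add: P_def)
qed

section \<open>Charts and tangent vectors\<close>

lemma fun_vector_apply [simp]: "(u + v) c = u c + v c" "(r *\<^sub>R u) c = r *\<^sub>R u c" "(0::'c \<Rightarrow> 'v) c = 0"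
  for u v :: "'c \<Rightarrow> 'v::real_vector"
  by (auto simp: scaleR_fun_def)

lemma fun_sum_apply: "(\<Sum>i\<in>I. f i) c = (\<Sum>i\<in>I. f i c)" for f :: "'i \<Rightarrow> 'c \<Rightarrow> 'v::real_vector"
  by (induction I rule: infinite_finite_induct) auto

locale manifold =
  fixes A :: "('a, 'e::euclidean_space) chart set"
  assumes smooth_manifold: "smooth_manifold A"
begin

lemma inj_chart: "c \<in> A \<Longrightarrow> inj_on (snd c) (fst c)"
  and open_chart: "c \<in> A \<Longrightarrow> open (snd c ` fst c)"
  and open_overlap: "c \<in> A \<Longrightarrow> d \<in> A \<Longrightarrow> open (snd c ` (fst c \<inter> fst d))"
  and smooth_transition: "c \<in> A \<Longrightarrow> d \<in> A \<Longrightarrow> smooth_on (snd c ` (fst c \<inter> fst d)) (snd d \<circ> chart_inv c)"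
  using smooth_manifold unfolding smooth_manifold_def by auto

lemma chart_inv_left: "c \<in> A \<Longrightarrow> p \<in> fst c \<Longrightarrow> chart_inv c (snd c p) = p"
  by (simp add: chart_inv_def inj_chart)

lemma chart_inv_right: "x \<in> snd c ` fst c \<Longrightarrow> snd c (chart_inv c x) = x"
  by (simp add: chart_inv_def f_inv_into_f)

lemma chart_inv_in: "x \<in> snd c ` fst c \<Longrightarrow> chart_inv c x \<in> fst c"
  by (simp add: chart_inv_def inv_into_into)

abbreviation lift :: "(real \<Rightarrow> 'a) \<Rightarrow> real \<Rightarrow> ('a, 'e) tangent_point"
  where "lift \<equiv> canonical_lift A"

abbreviation TC :: "('a, 'e) chart \<Rightarrow> (('a, 'e) tangent_point, 'e \<times> 'e) chart"
  where "TC \<equiv> tangent_chart A"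

abbreviation rng :: "('a, 'e) chart \<Rightarrow> 'e set"
  where "rng c \<equiv> snd c ` fst c"

abbreviation trans_deriv :: "('a, 'e) chart \<Rightarrow> ('a, 'e) chart \<Rightarrow> 'a \<Rightarrow> 'e \<Rightarrow> 'e"
  where "trans_deriv c d p \<equiv> frechet_derivative (snd d \<circ> chart_inv c) (at (snd c p))"

lemma has_derivative_transition:
  assumes "c \<in> A" "d \<in> A" "p \<in> fst c" "p \<in> fst d"
  shows "((snd d \<circ> chart_inv c) has_derivative trans_deriv c d p) (at (snd c p))"
  using smooth_on_has_derivative[OF smooth_transition[OF assms(1,2)]] assms by blast

lemma linear_trans_deriv:
  assumes "c \<in> A" "d \<in> A" "p \<in> fst c" "p \<in> fst d"
  shows "linear (trans_deriv c d p)"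
  using has_derivative_linear[OF has_derivative_transition[OF assms]] .

lemma trans_deriv_same:
  assumes "c \<in> A" "p \<in> fst c"
  shows "trans_deriv c c p u = u"
proof -
  have "((snd c \<circ> chart_inv c) has_derivative (\<lambda>u. u)) (at (snd c p))"
    by (rule has_derivative_transform_within_open[OF has_derivative_ident open_chart[OF assms(1)]])
      (use assms chart_inv_right in \<open>auto simp: chart_inv_left\<close>)
  from fun_cong[OF frechet_derivative_at[OF this], of u] show ?thesis by simp
qed

lemma trans_deriv_chain:
  assumes c: "c \<in> A" "p \<in> fst c" and d: "d \<in> A" "p \<in> fst d" and e: "e \<in> A" "p \<in> fst e"
  shows "trans_deriv d e p (trans_deriv c d p u) = trans_deriv c e p u"
proof -
  have cp: "chart_inv c (snd c p) = p" using chart_inv_left c by blast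
  have "((snd d \<circ> chart_inv c) has_derivative trans_deriv c d p) (at (snd c p))"
    using has_derivative_transition c d by blast
  moreover have "((snd e \<circ> chart_inv d) has_derivative trans_deriv d e p) (at ((snd d \<circ> chart_inv c) (snd c p)))"
    using has_derivative_transition[OF d(1) e(1) d(2) e(2)] by (simp add: cp)
  ultimately have "(((snd e \<circ> chart_inv d) \<circ> (snd d \<circ> chart_inv c)) has_derivative
      (trans_deriv d e p \<circ> trans_deriv c d p)) (at (snd c p))"
    by (rule diff_chain_at)
  then have "((snd e \<circ> chart_inv c) has_derivative (trans_deriv d e p \<circ> trans_deriv c d p)) (at (snd c p))"
    by (rule has_derivative_transform_within_open[OF _ open_overlap[OF c(1) d(1)]])
      (use c d in \<open>auto simp: chart_inv_left\<close>)
  from fun_cong[OF frechet_derivative_at[OF this], of u] show ?thesis by simp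
qed

lemma coord_vector_apply: "d \<in> A \<Longrightarrow> p \<in> fst d \<Longrightarrow> coord_vector A c p u d = trans_deriv c d p u"
  by (simp add: coord_vector_def)

lemma coord_vector_same: "c \<in> A \<Longrightarrow> p \<in> fst c \<Longrightarrow> coord_vector A c p u c = u"
  by (simp add: coord_vector_apply trans_deriv_same)

lemma coord_vector_tangent:
  assumes "c \<in> A" "p \<in> fst c"
  shows "coord_vector A c p u \<in> tangent_space A p"
  unfolding tangent_space_def
proof (intro CollectI conjI allI ballI impI)
  fix d e assume "d \<in> A" "e \<in> A" "p \<in> fst d" "p \<in> fst e"
  then show "coord_vector A c p u e = trans_deriv d e p (coord_vector A c p u d)"
    using trans_deriv_chain[OF assms] by (simp add: coord_vector_apply)
qed (auto simp: coord_vector_def)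

lemma tangent_eq_coord_vector:
  assumes "c \<in> A" "p \<in> fst c" "v \<in> tangent_space A p"
  shows "v = coord_vector A c p (v c)"
proof (rule ext)
  fix d
  show "v d = coord_vector A c p (v c) d"
  proof (cases "d \<in> A \<and> p \<in> fst d")
    case True
    then have "v d = trans_deriv c d p (v c)" using assms unfolding tangent_space_def by blast
    with True show ?thesis by (simp add: coord_vector_def)
  next
    case False
    then have "v d = 0" using assms(3) unfolding tangent_space_def by blast
    with False show ?thesis unfolding coord_vector_def by auto
  qed
qed

lemma tangent_eqI:
  assumes "c \<in> A" "p \<in> fst c" "v \<in> tangent_space A p" "w \<in> tangent_space A p" "v c = w c"
  shows "v = w"
  by (subst tangent_eq_coord_vector[OF assms(1,2,3)], subst tangent_eq_coord_vector[OF assms(1,2,4)])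
    (simp add: assms(5))

lemma subspace_tangent_space: "subspace (tangent_space A p)"
proof (rule subspaceI)
  show "0 \<in> tangent_space A p"
    unfolding tangent_space_def using linear_0[OF linear_trans_deriv] by auto
next
  fix x y assume x: "x \<in> tangent_space A p" and y: "y \<in> tangent_space A p"
  show "x + y \<in> tangent_space A p"
    unfolding tangent_space_def
  proof (intro CollectI conjI allI ballI impI)
    fix c d assume *: "c \<in> A" "d \<in> A" "p \<in> fst c" "p \<in> fst d"
    have "x d = trans_deriv c d p (x c)" "y d = trans_deriv c d p (y c)"
      using x y * unfolding tangent_space_def by blast+
    then show "(x + y) d = trans_deriv c d p ((x + y) c)"
      by (simp add: linear_add[OF linear_trans_deriv[OF *]])
  qed (use x y in \<open>auto simp: tangent_space_def\<close>)
next
  fix r :: real and x assume x: "x \<in> tangent_space A p"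
  show "r *\<^sub>R x \<in> tangent_space A p"
    unfolding tangent_space_def
  proof (intro CollectI conjI allI ballI impI)
    fix c d assume *: "c \<in> A" "d \<in> A" "p \<in> fst c" "p \<in> fst d"
    have "x d = trans_deriv c d p (x c)"
      using x * unfolding tangent_space_def by blast
    then show "(r *\<^sub>R x) d = trans_deriv c d p ((r *\<^sub>R x) c)"
      by (simp add: linear_cmul[OF linear_trans_deriv[OF *]])
  qed (use x in \<open>auto simp: tangent_space_def\<close>)
qed

lemma coord_vector_linear:
  assumes c: "c \<in> A" "p \<in> fst c"
  shows "coord_vector A c p (u + w) = coord_vector A c p u + coord_vector A c p w"
    and "coord_vector A c p (r *\<^sub>R u) = r *\<^sub>R coord_vector A c p u"
  by (rule tangent_eqI[OF c];
    auto intro!: coord_vector_tangent c subspace_add[OF subspace_tangent_space]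
      subspace_scale[OF subspace_tangent_space] simp: coord_vector_same[OF c])+

lemma coord_vector_eq_0:
  assumes c: "c \<in> A" "p \<in> fst c"
  shows "coord_vector A c p u = 0 \<longleftrightarrow> u = 0"
proof -
  have "coord_vector A c p 0 = 0"
    by (rule tangent_eqI[OF c coord_vector_tangent[OF c] subspace_0[OF subspace_tangent_space]])
       (simp add: coord_vector_same[OF c])
  then show ?thesis using coord_vector_same[OF c, of u] by fastforce
qed

lemma carrier_chart: "p \<in> carrier_of A \<Longrightarrow> \<exists>c\<in>A. p \<in> fst c"
  by (auto simp: carrier_of_def)

lemma tangent_chart_fst: "(p, v) \<in> fst (TC c) \<longleftrightarrow> p \<in> fst c \<and> v \<in> tangent_space A p"
  by (simp add: tangent_chart_def)

lemma tangent_chart_snd: "snd (TC c) (p, v) = (snd c p, v c)"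
  by (simp add: tangent_chart_def)

lemma inj_tangent_chart: "c \<in> A \<Longrightarrow> inj_on (snd (TC c)) (fst (TC c))"
  unfolding inj_on_def tangent_chart_def
  by (clarsimp) (metis chart_inv_left tangent_eqI)

lemma tangent_chart_inv:
  assumes "c \<in> A" "x \<in> rng c"
  shows "chart_inv (TC c) (x, y) = (chart_inv c x, coord_vector A c (chart_inv c x) y)"
proof -
  let ?\<theta> = "(chart_inv c x, coord_vector A c (chart_inv c x) y)"
  have "?\<theta> \<in> fst (TC c)"
    using assms by (simp add: tangent_chart_fst chart_inv_in coord_vector_tangent)
  moreover have "snd (TC c) ?\<theta> = (x, y)"
    using assms by (simp add: tangent_chart_snd chart_inv_right chart_inv_in coord_vector_same)
  ultimately show ?thesis
    unfolding chart_inv_def[of "TC c"] using inv_into_f_eq[OF inj_tangent_chart[OF assms(1)]] by blast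
qed

end

section \<open>Finsler structures in charts\<close>

locale finsler_manifold = manifold A for A :: "('a, real^'n::finite) chart set" +
  fixes F :: "('a, 'n) finsler"
  assumes finsler: "finsler_structure A F"
begin

definition Fc :: "('a, real^'n) chart \<Rightarrow> (real^'n) \<times> (real^'n) \<Rightarrow> real"
  where "Fc c = F \<circ> chart_inv (TC c)"

abbreviation E :: "('a, real^'n) chart \<Rightarrow> (real^'n) \<times> (real^'n) \<Rightarrow> real"
  where "E \<equiv> energy_in_chart A F"

lemma E_eq: "E c z = (Fc c z)\<^sup>2 / 2"
  by (simp add: energy_in_chart_def Fc_def)

lemma Fc_eq:
  assumes "c \<in> A" "x \<in> rng c"
  shows "Fc c (x, y) = F (chart_inv c x, coord_vector A c (chart_inv c x) y)"
  by (simp add: Fc_def tangent_chart_inv[OF assms])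

lemma Fc_coord:
  assumes "c \<in> A" "p \<in> fst c" "v \<in> tangent_space A p"
  shows "Fc c (snd c p, v c) = F (p, v)"
  using assms Fc_eq[of c "snd c p" "v c"] by (simp add: chart_inv_left flip: tangent_eq_coord_vector)

lemma tangent_bundle_chart: "c \<in> A \<Longrightarrow> p \<in> fst c \<Longrightarrow> v \<in> tangent_space A p \<Longrightarrow> (p, v) \<in> tangent_bundle A"
  by (auto simp: tangent_bundle_def carrier_of_def)

lemma F_hom: "(p, v) \<in> tangent_bundle A \<Longrightarrow> \<mu> > 0 \<Longrightarrow> F (p, \<mu> *\<^sub>R v) = \<mu> * F (p, v)"
  using finsler unfolding finsler_structure_def by blast

lemma F_nonneg: "\<theta> \<in> tangent_bundle A \<Longrightarrow> F \<theta> \<ge> 0"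
  using finsler unfolding finsler_structure_def by blast

lemma smooth_Fc:
  assumes "c \<in> A"
  shows "smooth_on (rng c \<times> - {0}) (Fc c)"
proof -
  have "smooth_on (snd (TC c) ` (fst (TC c) \<inter> slit_tangent_bundle A)) (Fc c)"
    using finsler assms unfolding finsler_structure_def smooth_fun_on_def tangent_atlas_def Fc_def by blast
  moreover have "rng c \<times> - {0} \<subseteq> snd (TC c) ` (fst (TC c) \<inter> slit_tangent_bundle A)"
  proof
    fix z assume "z \<in> rng c \<times> - {0::real^'n}"
    then obtain p y where z: "z = (snd c p, y)" and *: "p \<in> fst c" "y \<noteq> 0" by auto
    let ?\<theta> = "(p, coord_vector A c p y)"
    have "?\<theta> \<in> fst (TC c) \<inter> slit_tangent_bundle A"
      using * assms by (auto simp: tangent_chart_fst coord_vector_tangent slit_tangent_bundle_def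
          tangent_bundle_chart coord_vector_eq_0)
    moreover have "(snd c p, y) = snd (TC c) ?\<theta>"
      using * assms by (simp add: tangent_chart_snd coord_vector_same)
    ultimately show "z \<in> snd (TC c) ` (fst (TC c) \<inter> slit_tangent_bundle A)"
      unfolding z by blast
  qed
  ultimately show ?thesis by (rule smooth_on_subset)
qed

lemma open_slit: "c \<in> A \<Longrightarrow> open (rng c \<times> - {0::real^'n})"
  by (intro open_Times open_chart) auto

lemma smooth_E:
  assumes "c \<in> A"
  shows "smooth_on (rng c \<times> - {0}) (E c)"
proof -
  have "smooth_on (rng c \<times> - {0}) (\<lambda>z. Fc c z * Fc c z * (1/2))"
    by (intro smooth_on_mult smooth_on_const smooth_Fc assms open_slit)
  then show ?thesis
    by (rule smooth_on_cong[OF open_slit[OF assms]]) (simp add: E_eq power2_eq_square)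
qed

lemma Fc_hom:
  assumes "c \<in> A" "x \<in> rng c" "\<mu> > 0"
  shows "Fc c (x, \<mu> *\<^sub>R y) = \<mu> * Fc c (x, y)"
  using F_hom[OF tangent_bundle_chart[OF assms(1) chart_inv_in[OF assms(2)] coord_vector_tangent] assms(3)]
  by (simp add: Fc_eq[OF assms(1,2)] coord_vector_linear assms chart_inv_in)

abbreviation (input) fibre_energy :: "('a, real^'n) chart \<Rightarrow> real^'n \<Rightarrow> real^'n \<Rightarrow> real"
  where "fibre_energy c x \<equiv> (\<lambda>y. E c (x, y))"

lemma smooth_fibre:
  assumes "c \<in> A" "x \<in> rng c"
  shows "smooth_on (- {0}) (fibre_energy c x)"
proof -
  have "bounded_linear (\<lambda>y. (0::real^'n, y::real^'n))" by (intro bounded_linear_intros)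
  from smooth_on_affine_comp[OF this open_slit[OF assms(1)] smooth_E[OF assms(1)], of "(x, 0)"]
  have "smooth_on ((\<lambda>y. (x, 0) + (0, y)) -` (rng c \<times> - {0})) (fibre_energy c x)" by simp
  then show ?thesis by (rule smooth_on_subset) (use assms in auto)
qed

lemma dd_fibre:
  assumes "c \<in> A" "x \<in> rng c" "y \<noteq> 0" "smooth_on (rng c \<times> - {0}) f"
  shows "dd (\<lambda>y. f (x, y)) v y = dd f (0, v) (x, y)"
proof -
  have f: "(f has_derivative frechet_derivative f (at (x, y))) (at (x, y))"
    using smooth_on_has_derivative[OF assms(4), of "(x, y)"] assms by auto
  have "((\<lambda>y. (x, y)) has_derivative (\<lambda>v. (0, v))) (at y)" by (auto intro!: derivative_eq_intros)
  from diff_chain_at[OF this f] have "((\<lambda>y. f (x, y)) has_derivative (\<lambda>v. dd f (0, v) (x, y))) (at y)"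
    by (simp add: o_def)
  then show ?thesis by (rule dd_eqI)
qed

lemma hessian_fibre:
  assumes "c \<in> A" "x \<in> rng c" "y \<noteq> 0"
  shows "hessian (fibre_energy c x) y $ i $ j = dd (dd (E c) (0, axis j 1)) (0, axis i 1) (x, y)"
proof -
  have "dd (dd (fibre_energy c x) (axis j 1)) (axis i 1) y = dd (\<lambda>y. dd (E c) (0, axis j 1) (x, y)) (axis i 1) y"
    by (rule dd_cong_open[of "- {0}" y "dd (fibre_energy c x) (axis j 1)", symmetric])
      (use assms dd_fibre[OF assms(1,2) _ smooth_E[OF assms(1)]]
        smooth_onD_differentiable[OF smooth_on_dd[OF smooth_fibre[OF assms(1,2)]]] in auto)
  also have "\<dots> = dd (dd (E c) (0, axis j 1)) (0, axis i 1) (x, y)"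
    by (rule dd_fibre[OF assms]) (intro smooth_on_dd smooth_E assms)
  finally show ?thesis by (simp add: hessian_def)
qed

lemma deriv_line:
  fixes f :: "real^'n \<Rightarrow> real"
  assumes "f differentiable (at y)"
  shows "deriv (\<lambda>t. f (y + t *\<^sub>R w)) 0 = dd f w y"
  using DERIV_along_line[of f y 0 w] assms by (auto intro: DERIV_imp_deriv)

text \<open>The iterated one-variable derivatives only involve vectors near the nonzero \<open>v\<close>, where the energy is
  smooth on the fibre.\<close>

lemma fundamental_tensor_coord:
  assumes c: "c \<in> A" "p \<in> fst c" and tan: "v \<in> tangent_space A p" "u \<in> tangent_space A p" "w \<in> tangent_space A p"
    and v: "v c \<noteq> 0"
  shows "fundamental_tensor F (p, v) u w = dd (dd (fibre_energy c (snd c p)) (w c)) (u c) (v c)"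
proof -
  let ?\<phi> = "fibre_energy c (snd c p)"
  have x: "snd c p \<in> rng c" using c by simp
  note sm = smooth_fibre[OF c(1) x]
  have F: "(F (p, v + s *\<^sub>R u + t *\<^sub>R w))\<^sup>2 = 2 * ?\<phi> ((v c + s *\<^sub>R u c) + t *\<^sub>R w c)" for s t
  proof -
    have "v + s *\<^sub>R u + t *\<^sub>R w \<in> tangent_space A p"
      by (intro subspace_add subspace_scale subspace_tangent_space tan)
    from Fc_coord[OF c this] show ?thesis by (simp add: E_eq)
  qed
  have d1: "deriv (\<lambda>t. (F (p, v + s *\<^sub>R u + t *\<^sub>R w))\<^sup>2) 0 = 2 * dd ?\<phi> (w c) (v c + s *\<^sub>R u c)"
    if "v c + s *\<^sub>R u c \<noteq> 0" for s
  proof -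
    have d: "?\<phi> differentiable (at (v c + s *\<^sub>R u c))" using smooth_onD_differentiable[OF sm] that by simp
    have "deriv (\<lambda>t. (F (p, v + s *\<^sub>R u + t *\<^sub>R w))\<^sup>2) 0 = dd (\<lambda>y. 2 * ?\<phi> y) (w c) (v c + s *\<^sub>R u c)"
      unfolding F by (rule deriv_line[of "\<lambda>y. 2 * ?\<phi> y"]) (use d in \<open>auto intro: differentiable_mult\<close>)
    also have "\<dots> = 2 * dd ?\<phi> (w c) (v c + s *\<^sub>R u c)"
      using d by (simp add: dd_mult)
    finally show ?thesis .
  qed
  have "isCont (\<lambda>s. v c + s *\<^sub>R u c) 0" by (intro continuous_intros)
  then have "((\<lambda>s. v c + s *\<^sub>R u c) \<longlongrightarrow> v c) (nhds 0)"
    using tendsto_at_iff_tendsto_nhds[of "\<lambda>s. v c + s *\<^sub>R u c" 0] by (simp add: isCont_def)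
  from tendsto_imp_eventually_ne[OF this v] have "\<forall>\<^sub>F s in nhds 0. v c + s *\<^sub>R u c \<noteq> 0" .
  then have "deriv (\<lambda>s. deriv (\<lambda>t. (F (p, v + s *\<^sub>R u + t *\<^sub>R w))\<^sup>2) 0) 0
      = deriv (\<lambda>s. 2 * dd ?\<phi> (w c) (v c + s *\<^sub>R u c)) 0"
    by (intro deriv_cong_ev refl) (auto elim!: eventually_mono simp: d1)
  also have "\<dots> = dd (\<lambda>y. 2 * dd ?\<phi> (w c) y) (u c) (v c)"
    using smooth_onD_differentiable[OF smooth_on_dd[OF sm], of "v c"] v
    by (intro deriv_line[of "\<lambda>y. 2 * dd ?\<phi> (w c) y"] differentiable_mult) auto
  also have "\<dots> = 2 * dd (dd ?\<phi> (w c)) (u c) (v c)"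
    using smooth_onD_differentiable[OF smooth_on_dd[OF sm], of "v c"] v by (simp add: dd_mult)
  finally show ?thesis by (simp add: fundamental_tensor_def)
qed

text \<open>The distortion is defined with an unspecified basis at each point. The matrix \<open>P\<close> relates such a basis
  to the coordinate basis of a chart.\<close>

lemma tangent_basis_matrix:
  assumes c: "c \<in> A" "p \<in> fst c" and b: "tangent_basis A p b"
  defines "P \<equiv> (\<chi> i j. b j c $ i)"
  shows "invertible P" "b j \<in> tangent_space A p" "\<And>y. (\<Sum>i\<in>UNIV. (y $ i) *\<^sub>R b i) c = P *v y"
proof -
  have inj: "inj b" and ind: "independent (range b)" and sp: "span (range b) = tangent_space A p"
    using b by (auto simp: tangent_basis_def)
  show bt: "b j \<in> tangent_space A p" for j using span_base[of "b j" "range b"] sp by auto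
  show eq: "(\<Sum>i\<in>UNIV. (y $ i) *\<^sub>R b i) c = P *v y" for y
    by (simp add: fun_sum_apply P_def vec_eq_iff matrix_vector_mult_def mult.commute)
  have "y = 0" if "P *v y = 0" for y
  proof -
    have "(\<Sum>i\<in>UNIV. (y $ i) *\<^sub>R b i) = 0"
      by (rule tangent_eqI[OF c]) (use that eq in \<open>auto intro!: subspace_sum subspace_scale subspace_0 subspace_tangent_space bt\<close>)
    then have "(\<Sum>v\<in>range b. (y $ inv b v) *\<^sub>R v) = 0"
      using inj by (simp add: sum.reindex)
    then have "y $ inv b (b i) = 0" for i
      using independentD[OF ind, of "range b" "\<lambda>v. y $ inv b v" "b i"] by simp
    then show "y = 0" using inj by (simp add: vec_eq_iff)
  qed
  then show "invertible P" by (simp add: invertible_left_inverse matrix_left_invertible_ker)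
qed

lemma coord_tangent_basis:
  assumes c: "c \<in> A" "p \<in> fst c"
  shows "tangent_basis A p (\<lambda>i. coord_vector A c p (axis i 1))"
proof -
  let ?b = "\<lambda>i::'n. coord_vector A c p (axis i 1)"
  have inj: "inj ?b"
    by (rule injI, drule arg_cong[where f = "\<lambda>v. v c"]) (simp add: coord_vector_same[OF c] axis_eq_axis)
  have eval: "(\<Sum>i\<in>UNIV. y $ i *\<^sub>R ?b i) c = y" for y
    by (simp add: fun_sum_apply coord_vector_same[OF c])
      (metis (no_types, lifting) basis_expansion scalar_mult_eq_scaleR sum.cong)
  have ind: "independent (range ?b)"
  proof (rule independent_if_scalars_zero)
    fix f v assume 0: "(\<Sum>x\<in>range ?b. f x *\<^sub>R x) = 0" and "v \<in> range ?b"
    then obtain i where v: "v = ?b i" by auto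
    have "(\<Sum>i\<in>UNIV. (\<chi> i. f (?b i)) $ i *\<^sub>R ?b i) = 0"
      using 0 inj by (simp add: sum.reindex)
    then have "(\<chi> i. f (?b i)) = 0" using eval[of "\<chi> i. f (?b i)"] by simp
    then have "(\<chi> i. f (?b i)) $ i = 0" by simp
    then show "f v = 0" by (simp add: v)
  qed simp
  have "span (range ?b) = tangent_space A p"
  proof
    show "span (range ?b) \<subseteq> tangent_space A p"
      by (intro span_minimal subspace_tangent_space) (auto intro: coord_vector_tangent[OF c])
    show "tangent_space A p \<subseteq> span (range ?b)"
    proof
      fix v assume v: "v \<in> tangent_space A p"
      have "v = (\<Sum>i\<in>UNIV. v c $ i *\<^sub>R ?b i)"
        by (rule tangent_eqI[OF c v])
          (use eval in \<open>auto intro!: subspace_sum subspace_scale subspace_tangent_space coord_vector_tangent c\<close>)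
      also have "\<dots> \<in> span (range ?b)" by (intro span_sum span_scale span_base) auto
      finally show "v \<in> span (range ?b)" .
    qed
  qed
  with inj ind show ?thesis by (simp add: tangent_basis_def)
qed

lemma minkowski_energy_fibre:
  assumes c: "c \<in> A" "p \<in> fst c"
  shows "minkowski_energy (fibre_energy c (snd c p))"
proof
  have x: "snd c p \<in> rng c" using c by simp
  show "smooth_on (- {0}) (fibre_energy c (snd c p))" by (rule smooth_fibre[OF c(1) x])
  show "E c (snd c p, \<mu> *\<^sub>R y) = \<mu>\<^sup>2 * E c (snd c p, y)" if "\<mu> > 0" for \<mu> y
    by (simp add: E_eq Fc_hom[OF c(1) x that] power_mult_distrib)
  fix y \<eta> :: "real^'n" assume "y \<noteq> 0" "\<eta> \<noteq> 0"
  let ?v = "coord_vector A c p y" and ?b = "\<lambda>i. coord_vector A c p (axis i 1)"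
  have "(p, ?v) \<in> slit_tangent_bundle A"
    using \<open>y \<noteq> 0\<close> tangent_bundle_chart[OF c coord_vector_tangent[OF c]]
    by (simp add: slit_tangent_bundle_def coord_vector_eq_0 c)
  then have "\<eta> \<bullet> (fundamental_matrix F ?b (p, ?v) *v \<eta>) > 0"
    using finsler coord_tangent_basis[OF c] \<open>\<eta> \<noteq> 0\<close> unfolding finsler_structure_def by fastforce
  moreover have "fundamental_matrix F ?b (p, ?v) = hessian (fibre_energy c (snd c p)) y"
    using \<open>y \<noteq> 0\<close>
    using fundamental_tensor_coord[OF c coord_vector_tangent[OF c] coord_vector_tangent[OF c] coord_vector_tangent[OF c]]
    by (simp add: fundamental_matrix_def hessian_def coord_vector_same[OF c])
  ultimately show "\<eta> \<bullet> (hessian (fibre_energy c (snd c p)) y *v \<eta>) > 0" by simp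
qed

lemma minkowski_energy_fibre':
  assumes "c \<in> A" "x \<in> rng c"
  shows "minkowski_energy (fibre_energy c x)"
  using minkowski_energy_fibre[OF assms(1)] assms(2) by blast

lemma Fc_pos:
  assumes "c \<in> A" "x \<in> rng c" "y \<noteq> 0"
  shows "Fc c (x, y) > 0"
proof -
  have "E c (x, y) > 0" using minkowski_energy.phi_pos[OF minkowski_energy_fibre'[OF assms(1,2)] assms(3)] .
  then have "Fc c (x, y) \<noteq> 0" by (auto simp: E_eq)
  moreover have "Fc c (x, y) \<ge> 0"
    unfolding Fc_eq[OF assms(1,2)]
    by (intro F_nonneg tangent_bundle_chart[of c] coord_vector_tangent chart_inv_in assms)
  ultimately show ?thesis by simp
qed

lemma F_pos: "(p, v) \<in> tangent_bundle A \<Longrightarrow> v \<noteq> 0 \<Longrightarrow> F (p, v) > 0"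
proof -
  assume v: "(p, v) \<in> tangent_bundle A" "v \<noteq> 0"
  then obtain c where c: "c \<in> A" "p \<in> fst c" and t: "v \<in> tangent_space A p"
    using carrier_chart[of p] unfolding tangent_bundle_def by blast
  have "v c \<noteq> 0" using tangent_eqI[OF c t subspace_0[OF subspace_tangent_space]] v by auto
  then show "F (p, v) > 0" using Fc_pos[OF c(1), of "snd c p" "v c"] Fc_coord[OF c t] c by simp
qed

lemma F_zero: "(p, 0) \<in> tangent_bundle A \<Longrightarrow> F (p, 0) = 0"
  using F_hom[of p 0 2] by simp

lemma smooth_norm_family_Fc: "c \<in> A \<Longrightarrow> smooth_norm_family (rng c) (Fc c)"
  by unfold_locales (auto intro: open_chart smooth_Fc Fc_pos Fc_hom simp del: image_eqI)

lemma det_hessian_pos: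
  assumes "c \<in> A" "x \<in> rng c" "y \<noteq> 0"
  shows "det (hessian (fibre_energy c x) y) > 0"
proof -
  interpret minkowski_energy "fibre_energy c x" by (rule minkowski_energy_fibre'[OF assms(1,2)])
  obtain P :: "real^'n^'n" where "hessian (fibre_energy c x) y ** (P ** transpose P) = mat 1"
    using posdef_inverse_square[OF hessian_sym[OF assms(3)] posdef[OF assms(3)]] by blast
  then have "det (hessian (fibre_energy c x) y) * (det P)\<^sup>2 = 1"
    by (metis det_I det_mul det_transpose power2_eq_square)
  then show ?thesis by (smt (verit) mult_nonpos_nonneg zero_le_power2)
qed

section \<open>The distortion in a chart\<close>

definition unit_ball_volume :: "('a, real^'n) chart \<Rightarrow> real^'n \<Rightarrow> real"
  where "unit_ball_volume c x = measure lborel {y. Fc c (x, y) < 1}"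

definition chart_distortion :: "('a, real^'n) chart \<Rightarrow> (real^'n) \<times> (real^'n) \<Rightarrow> real"
  where "chart_distortion c z = ln (sqrt (det (hessian (fibre_energy c (fst z)) (snd z)))
     * unit_ball_volume c (fst z) / measure lborel (ball (0::real^'n) 1))"

text \<open>The distortion is a differentiable function of two quantities: the determinant of the fundamental tensor,
  made of second derivatives of the energy, and the volume of the unit ball.\<close>

lemma chart_distortion_differentiable:
  assumes c: "c \<in> A" and z: "z \<in> rng c \<times> - {0}"
  shows "chart_distortion c differentiable (at z)"
proof -
  interpret V: smooth_norm_family "rng c" "Fc c" by (rule smooth_norm_family_Fc[OF c])
  obtain x y where xy: "z = (x, y)" "x \<in> rng c" "y \<noteq> 0" using z by auto
  define D where "D = (\<lambda>z. det (\<chi> i j. dd (dd (E c) (0, axis j 1)) (0, axis i 1) z) :: real)"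
  have "smooth_on (rng c \<times> - {0}) D"
    unfolding D_def by (intro smooth_on_det open_slit c) (simp, intro smooth_on_dd smooth_E c)
  then have D: "(D has_derivative frechet_derivative D (at z)) (at z)"
    using smooth_on_has_derivative z by blast
  have D_eq: "D w = det (hessian (fibre_energy c (fst w)) (snd w))" if "w \<in> rng c \<times> - {0}" for w
  proof -
    obtain a b where "w = (a, b)" "a \<in> rng c" "b \<noteq> 0" using \<open>w \<in> _\<close> by auto
    then have "hessian (fibre_energy c (fst w)) (snd w) = (\<chi> i j. dd (dd (E c) (0, axis j 1)) (0, axis i 1) w)"
      using hessian_fibre[OF c] by (simp add: vec_eq_iff)
    then show ?thesis by (simp add: D_def)
  qed
  have Dpos: "D z > 0" using D_eq[OF z] det_hessian_pos[OF c xy(2,3)] by (simp add: xy(1))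
  have "V.vol = unit_ball_volume c" by (simp add: V.vol_def unit_ball_volume_def fun_eq_iff)
  then have V: "(unit_ball_volume c has_derivative frechet_derivative (unit_ball_volume c) (at (fst z))) (at (fst z))"
    and Vpos: "unit_ball_volume c (fst z) > 0"
    using V.vol_differentiable[of x] V.vol_pos[of x] xy frechet_derivative_works by auto
  have fst: "(fst has_derivative fst) (at z)" by (rule has_derivative_fst[OF has_derivative_ident])
  have V': "((\<lambda>z. unit_ball_volume c (fst z)) has_derivative (\<lambda>v. frechet_derivative (unit_ball_volume c) (at (fst z)) (fst v))) (at z)"
    using diff_chain_at[OF fst V] by (simp add: o_def)
  have ball: "measure lborel (ball (0::real^'n) 1) > 0"
    using content_ball_pos[of 1 "0::real^'n"] by simp
  have "sqrt (D z) * unit_ball_volume c (fst z) / measure lborel (ball (0::real^'n) 1) > 0"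
    using Dpos Vpos ball by simp
  then have "(\<lambda>w. ln (sqrt (D w) * unit_ball_volume c (fst w) / measure lborel (ball (0::real^'n) 1))) differentiable (at z)"
    using Dpos ball unfolding differentiable_def
    by (intro exI) (rule has_derivative_ln has_derivative_divide has_derivative_mult has_derivative_real_sqrt D V'
      has_derivative_const | simp)+
  then show ?thesis
    by (rule frechet_derivative_cong_open(2)[OF open_slit[OF c] z, rotated])
      (simp add: D_eq chart_distortion_def)
qed

text \<open>Passing to another basis multiplies the determinant of the fundamental tensor by \<open>(det P)\<^sup>2\<close> and the
  volume of the unit ball by \<open>1 / \<bar>det P\<bar>\<close>, and these factors cancel.\<close>

lemma distortion_eq_chart_distortion:
  assumes c: "c \<in> A" "p \<in> fst c" and v: "v \<in> tangent_space A p" "v \<noteq> 0"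
  shows "distortion A F (p, v) = chart_distortion c (snd c p, v c)"
proof -
  define b where "b = (SOME b. tangent_basis A p b)"
  have b: "tangent_basis A p b"
    unfolding b_def by (rule someI[of "tangent_basis A p", OF coord_tangent_basis[OF c]])
  have x: "snd c p \<in> rng c" using c by simp
  have vc: "v c \<noteq> 0" using tangent_eqI[OF c v(1) subspace_0[OF subspace_tangent_space]] v by auto
  interpret V: smooth_norm_family "rng c" "Fc c" by (rule smooth_norm_family_Fc[OF c(1)])
  define P where "P = (\<chi> i j. b j c $ i)"
  note P = tangent_basis_matrix[OF c b, folded P_def]
  define \<phi> where "\<phi> = fibre_energy c (snd c p)"
  have sm: "smooth_on (- {0}) \<phi>" unfolding \<phi>_def by (rule smooth_fibre[OF c(1) x])
  have dphi: "\<phi> differentiable (at y)" "dd \<phi> w differentiable (at y)" if "y \<noteq> 0" for y w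
    using smooth_onD_differentiable[OF sm] smooth_onD_differentiable[OF smooth_on_dd[OF sm]] that by auto
  have bil: "dd (dd \<phi> w) u (v c) = (\<Sum>k\<in>UNIV. \<Sum>l\<in>UNIV. u $ k * hessian \<phi> (v c) $ k $ l * w $ l)" for u w
  proof -
    have "dd (dd \<phi> w) u (v c) = dd (\<lambda>y. \<Sum>l\<in>UNIV. w $ l * dd \<phi> (axis l 1) y) u (v c)"
    proof (rule dd_cong_open[of "- {0}" "v c" "dd \<phi> w", symmetric])
      show "dd \<phi> w y = (\<Sum>l\<in>UNIV. w $ l * dd \<phi> (axis l 1) y)" if "y \<in> - {0}" for y
        by (rule dd_expand) (use dphi(1) that in simp)
    qed (use vc dphi(2)[OF vc] in auto)
    also have "\<dots> = (\<Sum>l\<in>UNIV. w $ l * dd (dd \<phi> (axis l 1)) u (v c))"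
      using dphi[OF vc] by (simp add: dd_sum dd_mult differentiable_mult)
    also have "\<dots> = (\<Sum>l\<in>UNIV. w $ l * (\<Sum>k\<in>UNIV. u $ k * hessian \<phi> (v c) $ k $ l))"
      unfolding dd_expand[OF dphi(2)[OF vc], of _ u] by (simp add: hessian_def)
    also have "\<dots> = (\<Sum>l\<in>UNIV. \<Sum>k\<in>UNIV. u $ k * hessian \<phi> (v c) $ k $ l * w $ l)"
      by (simp add: sum_distrib_left mult_ac)
    also have "\<dots> = (\<Sum>k\<in>UNIV. \<Sum>l\<in>UNIV. u $ k * hessian \<phi> (v c) $ k $ l * w $ l)"
      by (rule sum.swap)
    finally show ?thesis .
  qed
  have "fundamental_matrix F b (p, v) = transpose P ** hessian \<phi> (v c) ** P"
  proof -
    have "fundamental_matrix F b (p, v) $ i $ j = (transpose P ** (hessian \<phi> (v c) ** P)) $ i $ j" for i j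
    proof -
      have "fundamental_matrix F b (p, v) $ i $ j = dd (dd \<phi> (b j c)) (b i c) (v c)"
        by (simp add: fundamental_matrix_def fundamental_tensor_coord[OF c v(1) P(2) P(2) vc] \<phi>_def)
      also have "\<dots> = (transpose P ** (hessian \<phi> (v c) ** P)) $ i $ j"
        unfolding bil by (simp add: matrix_matrix_mult_def transpose_def P_def sum_distrib_left mult.assoc)
      finally show ?thesis .
    qed
    then show ?thesis by (simp add: vec_eq_iff matrix_mul_assoc)
  qed
  then have det: "det (fundamental_matrix F b (p, v)) = (det P)\<^sup>2 * det (hessian \<phi> (v c))"
    by (simp add: det_mul power2_eq_square)
  obtain Q where Q: "P ** Q = mat 1" "Q ** P = mat 1" using P(1) unfolding invertible_def by blast
  have "det P * det Q = 1" by (metis Q(1) det_I det_mul)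
  then have detPQ: "\<bar>det P\<bar> * \<bar>det Q\<bar> = 1" by (metis abs_mult abs_one)
  define B where "B = {y. Fc c (snd c p, y) < 1}"
  have "B \<in> lmeasurable"
    unfolding B_def by (intro lmeasurable_open V.open_ball_fibre V.bounded_ball_fibre x)
  have QB: "(\<lambda>y. Q *v y) ` B = (\<lambda>y. P *v y) -` B"
  proof (intro set_eqI iffI)
    fix y assume "y \<in> (\<lambda>y. P *v y) -` B"
    moreover have "y = Q *v (P *v y)" by (simp add: matrix_vector_mul_assoc Q)
    ultimately show "y \<in> (\<lambda>y. Q *v y) ` B" by blast
  qed (auto simp: matrix_vector_mul_assoc Q)
  have "measure lebesgue ((\<lambda>y. Q *v y) ` B) = \<bar>det Q\<bar> * measure lebesgue B"
    using measure_linear_image_det[OF matrix_vector_mul_linear[of Q] \<open>B \<in> lmeasurable\<close>] by simp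
  moreover have im: "(\<lambda>y. Q *v y) ` B = {y. F (p, \<Sum>i\<in>UNIV. (y $ i) *\<^sub>R b i) < 1}"
  proof -
    have "F (p, \<Sum>i\<in>UNIV. (y $ i) *\<^sub>R b i) = Fc c (snd c p, P *v y)" for y
      using Fc_coord[OF c, of "\<Sum>i\<in>UNIV. (y $ i) *\<^sub>R b i"] P(2,3)
      by (simp add: subspace_sum[OF subspace_tangent_space] subspace_scale[OF subspace_tangent_space])
    then have "{y. F (p, \<Sum>i\<in>UNIV. (y $ i) *\<^sub>R b i) < 1} = (\<lambda>y. P *v y) -` B" by (auto simp: B_def)
    then show ?thesis using QB by simp
  qed
  moreover have "B \<in> sets borel" unfolding B_def using V.open_ball_fibre[OF x] by simp
  moreover have "open ((\<lambda>y. P *v y) -` B)"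
    unfolding B_def by (intro open_vimage V.open_ball_fibre x linear_continuous_on matrix_vector_mul_bounded_linear)
  then have "(\<lambda>y. Q *v y) ` B \<in> sets borel" unfolding QB by simp
  ultimately have vol: "measure lborel {y. F (p, \<Sum>i\<in>UNIV. (y $ i) *\<^sub>R b i) < 1} = \<bar>det Q\<bar> * unit_ball_volume c (snd c p)"
    by (simp add: unit_ball_volume_def B_def)
  have "sqrt (det (fundamental_matrix F b (p, v))) / busemann_hausdorff_density F p b
      = (\<bar>det P\<bar> * \<bar>det Q\<bar>) * (sqrt (det (hessian \<phi> (v c))) * unit_ball_volume c (snd c p) / measure lborel (ball (0::real^'n) 1))"
    unfolding busemann_hausdorff_density_def vol det by (simp add: real_sqrt_mult)
  then show ?thesis
    unfolding distortion_def chart_distortion_def fst_conv snd_conv Let_def b_def[symmetric] detPQ \<phi>_def by simp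
qed

end

section \<open>Uniqueness for Euler-Lagrange equations\<close>

lemma frechet_derivative_nearby:
  fixes f :: "'e::euclidean_space \<Rightarrow> real"
  assumes "smooth_on S f" "open S" "z0 \<in> S" "\<epsilon> > 0"
  shows "\<exists>r>0. ball z0 r \<subseteq> S \<and> (\<forall>z\<in>ball z0 r. \<forall>v. \<bar>dd f v z - dd f v z0\<bar> \<le> \<epsilon> * norm v)"
proof -
  define \<delta> where "\<delta> = \<epsilon> / DIM('e)"
  have \<delta>: "\<delta> > 0" using assms(4) by (simp add: \<delta>_def)
  have "\<exists>r>0. ball z0 r \<subseteq> S \<and> (\<forall>z\<in>ball z0 r. \<bar>dd f b z - dd f b z0\<bar> < \<delta>)" for b
  proof -
    have "continuous_on S (dd f b)"
      by (intro smooth_on_continuous_on smooth_on_dd assms)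
    then have "isCont (dd f b) z0" using assms(2,3) continuous_on_eq_continuous_at by blast
    then obtain r1 where r1: "r1 > 0" "\<And>z. dist z z0 < r1 \<Longrightarrow> dist (dd f b z) (dd f b z0) < \<delta>"
      using \<delta> unfolding continuous_at_eps_delta by blast
    obtain r2 where r2: "r2 > 0" "ball z0 r2 \<subseteq> S" using assms(2,3) openE by blast
    show ?thesis
      using r1 r2 by (intro exI[of _ "min r1 r2"]) (auto simp: dist_commute dist_real_def)
  qed
  then obtain r where r: "\<And>b. r b > 0" "\<And>b. ball z0 (r b) \<subseteq> S"
    "\<And>b z. z \<in> ball z0 (r b) \<Longrightarrow> \<bar>dd f b z - dd f b z0\<bar> < \<delta>" by metis
  define R where "R = Min (r ` (Basis :: 'e set))"
  have R: "R > 0" "\<And>b. b \<in> Basis \<Longrightarrow> R \<le> r b"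
    unfolding R_def using r(1) by auto
  have sub: "ball z0 R \<subseteq> S"
    using R(2)[OF SOME_Basis] r(2) subset_ball by blast
  have "\<bar>dd f v z - dd f v z0\<bar> \<le> \<epsilon> * norm v" if z: "z \<in> ball z0 R" for z v
  proof -
    have zS: "z \<in> S" using z sub by blast
    note ex = frechet_derivative_expand[OF smooth_onD_differentiable[OF assms(1)], of _ v]
    have "\<bar>dd f v z - dd f v z0\<bar> = \<bar>\<Sum>b\<in>Basis. (v \<bullet> b) * (dd f b z - dd f b z0)\<bar>"
      unfolding ex[OF zS] ex[OF assms(3)] by (simp add: sum_subtractf right_diff_distrib)
    also have "\<dots> \<le> (\<Sum>b\<in>Basis. \<bar>(v \<bullet> b) * (dd f b z - dd f b z0)\<bar>)" by (rule sum_abs)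
    also have "\<dots> \<le> (\<Sum>b\<in>(Basis :: 'e set). norm v * \<delta>)"
    proof (rule sum_mono)
      fix b :: 'e assume b: "b \<in> Basis"
      then have "z \<in> ball z0 (r b)" using z R(2)[OF b] by auto
      then have "\<bar>dd f b z - dd f b z0\<bar> \<le> \<delta>" using r(3) less_imp_le by blast
      then show "\<bar>(v \<bullet> b) * (dd f b z - dd f b z0)\<bar> \<le> norm v * \<delta>"
        unfolding abs_mult by (intro mult_mono Basis_le_norm b) auto
    qed
    also have "\<dots> = \<epsilon> * norm v" by (simp add: \<delta>_def)
    finally show ?thesis .
  qed
  with R(1) sub show ?thesis by blast
qed

text \<open>Used for the Legendre map \<open>(x, y) \<mapsto> (x, \<partial>L/\<partial>y)\<close>: an injective differential at one point bounds the
  distances between image points near it from below.\<close>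

lemma strictly_differentiable:
  fixes f :: "'e::euclidean_space \<Rightarrow> real"
  assumes "smooth_on S f" "open S" "z0 \<in> S" "\<epsilon> > 0"
  shows "\<exists>r>0. ball z0 r \<subseteq> S \<and> (\<forall>a\<in>ball z0 r. \<forall>b\<in>ball z0 r. \<bar>f a - f b - dd f (a - b) z0\<bar> \<le> \<epsilon> * norm (a - b))"
proof -
  obtain r where r: "r > 0" "ball z0 r \<subseteq> S"
    and d: "\<And>z v. z \<in> ball z0 r \<Longrightarrow> \<bar>dd f v z - dd f v z0\<bar> \<le> \<epsilon> * norm v"
    using frechet_derivative_nearby[OF assms] by blast
  define g where "g = (\<lambda>z. f z - dd f z z0)"
  have bl: "bounded_linear (frechet_derivative f (at z0))"
    using smooth_on_has_derivative[OF assms(1,3)] has_derivative_bounded_linear by blast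
  have "norm (g a - g b) \<le> \<epsilon> * norm (a - b)" if "a \<in> ball z0 r" "b \<in> ball z0 r" for a b
  proof (rule differentiable_bound[OF convex_ball _ _ that])
    fix z assume z: "z \<in> ball z0 r"
    then have zS: "z \<in> S" using r by blast
    have "(g has_derivative (\<lambda>v. dd f v z - dd f v z0)) (at z)"
      unfolding g_def
      by (intro has_derivative_diff smooth_on_has_derivative[OF assms(1) zS] bounded_linear_imp_has_derivative bl)
    then show "(g has_derivative (\<lambda>v. dd f v z - dd f v z0)) (at z within ball z0 r)"
      by (rule has_derivative_at_withinI)
    show "onorm (\<lambda>v. dd f v z - dd f v z0) \<le> \<epsilon>"
      by (rule onorm_le) (use d[OF z] in simp)
  qed
  moreover have "g a - g b = f a - f b - dd f (a - b) z0" for a b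
    by (simp add: g_def linear_diff[OF bounded_linear.linear[OF bl]])
  ultimately show ?thesis using r by auto
qed

lemma locally_lipschitz:
  fixes f :: "'e::euclidean_space \<Rightarrow> real"
  assumes "smooth_on S f" "open S" "z0 \<in> S"
  shows "\<exists>r>0. \<exists>K\<ge>0. ball z0 r \<subseteq> S \<and> (\<forall>a\<in>ball z0 r. \<forall>b\<in>ball z0 r. \<bar>f a - f b\<bar> \<le> K * norm (a - b))"
proof -
  obtain r where r: "r > 0" "ball z0 r \<subseteq> S"
    and d: "\<And>a b. a \<in> ball z0 r \<Longrightarrow> b \<in> ball z0 r \<Longrightarrow> \<bar>f a - f b - dd f (a - b) z0\<bar> \<le> 1 * norm (a - b)"
    using strictly_differentiable[OF assms zero_less_one] by blast
  have "bounded_linear (frechet_derivative f (at z0))"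
    using smooth_on_has_derivative[OF assms(1,3)] has_derivative_bounded_linear by blast
  then obtain K where K: "K > 0" "\<And>v. norm (dd f v z0) \<le> norm v * K"
    using bounded_linear.pos_bounded by blast
  have "\<bar>f a - f b\<bar> \<le> (K + 1) * norm (a - b)" if "a \<in> ball z0 r" "b \<in> ball z0 r" for a b
    using d[OF that] K(2)[of "a - b"] by (simp add: algebra_simps)
  with r K(1) show ?thesis by (intro exI[of _ r] conjI exI[of _ "K + 1"]) auto
qed

text \<open>A Gronwall argument: on a time interval of radius less than \<open>1/C\<close> the maximum of \<open>\<bar>w\<bar>\<close> is at
  most a proper fraction of itself.\<close>

lemma zero_of_derivative_bound:
  fixes w :: "real \<Rightarrow> 'v::real_normed_vector"
  assumes w0: "w t0 = 0" and C: "C \<ge> 0" and \<delta>: "\<delta> \<ge> 0" "C * \<delta> < 1"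
    and d: "\<And>t. t \<in> cball t0 \<delta> \<Longrightarrow> (w has_vector_derivative w' t) (at t)"
    and b: "\<And>t. t \<in> cball t0 \<delta> \<Longrightarrow> norm (w' t) \<le> C * norm (w t)"
    and t: "t \<in> cball t0 \<delta>"
  shows "w t = 0"
proof -
  let ?I = "cball t0 \<delta>"
  have cont: "continuous_on ?I (\<lambda>t. norm (w t))"
    by (intro continuous_on_norm continuous_at_imp_continuous_on ballI)
      (use d has_vector_derivative_continuous in blast)
  have "?I \<noteq> {}" using \<delta> by simp
  then obtain s where s: "s \<in> ?I" "\<And>t. t \<in> ?I \<Longrightarrow> norm (w t) \<le> norm (w s)"
    using continuous_attains_sup[OF compact_cball _ cont] by blast
  have "norm (w s - w t0) \<le> (C * norm (w s)) * norm (s - t0)"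
  proof (rule differentiable_bound[OF convex_cball[of t0 \<delta>]])
    fix t assume t: "t \<in> ?I"
    then show "(w has_derivative (\<lambda>r. r *\<^sub>R w' t)) (at t within ?I)"
      using d has_vector_derivative_def has_derivative_at_withinI by metis
    have "norm (w' t) \<le> C * norm (w s)"
      using b[OF t] mult_left_mono[OF s(2)[OF t] C] by linarith
    then show "onorm (\<lambda>r. r *\<^sub>R w' t) \<le> C * norm (w s)"
      by (intro onorm_le) (simp add: mult.commute mult_left_mono)
  qed (use s \<delta> in auto)
  also have "\<dots> \<le> (C * norm (w s)) * \<delta>"
    using s(1) C by (intro mult_left_mono) (auto simp: dist_norm norm_minus_commute)
  finally have "norm (w s) * (1 - C * \<delta>) \<le> 0" using w0 by (simp add: algebra_simps)
  then have "norm (w s) \<le> 0" using \<delta>(2) by (simp add: mult_le_0_iff)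
  then show ?thesis using s(2)[OF t] by simp
qed

text \<open>In the variables \<open>(x, p)\<close> with \<open>p = \<partial>L/\<partial>y\<close> the equation reads \<open>x' = y\<close>, \<open>p' = \<partial>L/\<partial>x\<close>. If the Legendre map
  \<open>(x, y) \<mapsto> (x, p)\<close> has injective differential, then the distance of two solutions in \<open>(x, y)\<close> is bounded by
  a multiple of their distance \<open>w\<close> in \<open>(x, p)\<close>, so \<open>\<bar>w'\<bar> \<le> C \<bar>w\<bar>\<close>. The two solutions are indexed by
  \<open>k < 2\<close>.\<close>

lemma euler_lagrange_locally_unique:
  fixes L :: "(real^'n) \<times> (real^'n) \<Rightarrow> real"
  defines "p \<equiv> \<lambda>i. dd L (0, axis i 1)" and "q \<equiv> \<lambda>i. dd L (axis i 1, 0)"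
  assumes L: "smooth_on S L" "open S"
    and nondeg: "\<And>z v. z \<in> S \<Longrightarrow> (\<And>i. dd (p i) (0, v) z = 0) \<Longrightarrow> v = 0"
    and I: "open I" "t0 \<in> I"
    and x: "\<And>k t. k < (2::nat) \<Longrightarrow> t \<in> I \<Longrightarrow> (x k has_vector_derivative y k t) (at t)"
    and y: "\<And>k. k < 2 \<Longrightarrow> continuous_on I (y k)"
    and EL: "\<And>k t i. k < 2 \<Longrightarrow> t \<in> I \<Longrightarrow> ((\<lambda>s. p i (x k s, y k s)) has_real_derivative q i (x k t, y k t)) (at t)"
    and S: "\<And>k. k < 2 \<Longrightarrow> (x k t0, y k t0) \<in> S"
    and eq: "x 0 t0 = x 1 t0" "y 0 t0 = y 1 t0"
  shows "\<exists>\<delta>>0. \<forall>t\<in>ball t0 \<delta>. t \<in> I \<and> x 0 t = x 1 t \<and> y 0 t = y 1 t"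
proof -
  define z where "z = (\<lambda>k t. (x k t, y k t))"
  define z0 where "z0 = z 0 t0"
  have z0: "z0 \<in> S" "z 0 t0 = z0" "z 1 t0 = z0" using S[of 0] eq by (auto simp: z0_def z_def)
  have smp: "smooth_on S (p i)" and smq: "smooth_on S (q i)" for i
    unfolding p_def q_def by (intro smooth_on_dd L)+
  define \<Phi> where "\<Phi> = (\<lambda>z. (fst z, \<chi> i. p i z))"
  define \<Lambda> where "\<Lambda> = (\<lambda>v. (fst v, \<chi> i. dd (p i) v z0) :: (real^'n) \<times> (real^'n))"
  have lin: "linear (frechet_derivative (p i) (at z0))" for i
    using smooth_on_has_derivative[OF smp z0(1)] has_derivative_linear by blast
  have lin\<Lambda>: "linear \<Lambda>"
    by (rule linearI) (auto simp: \<Lambda>_def vec_eq_iff linear_add[OF lin] linear_cmul[OF lin])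
  have "v = 0" if "\<Lambda> v = 0" for v
  proof -
    have "fst v = 0" "\<And>i. dd (p i) v z0 = 0" using that by (auto simp: \<Lambda>_def vec_eq_iff prod_eq_iff)
    then show "v = 0" using nondeg[OF z0(1), of "snd v"] by (cases v) (auto simp: zero_prod_def)
  qed
  then have "inj \<Lambda>" using linear_injective_0[OF lin\<Lambda>] by blast
  then obtain B where B: "B > 0" "\<And>v. B * norm v \<le> norm (\<Lambda> v)"
    using linear_inj_bounded_below_pos[OF lin\<Lambda>] by blast
  define \<epsilon> where "\<epsilon> = B / (2 * CARD('n))"
  have \<epsilon>: "\<epsilon> > 0" using B by (simp add: \<epsilon>_def)
  obtain r where r: "\<And>i. r i > 0" "\<And>i. ball z0 (r i) \<subseteq> S"
    "\<And>i a b. a \<in> ball z0 (r i) \<Longrightarrow> b \<in> ball z0 (r i) \<Longrightarrow> \<bar>p i a - p i b - dd (p i) (a - b) z0\<bar> \<le> \<epsilon> * norm (a - b)"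
    using strictly_differentiable[OF smp L(2) z0(1) \<epsilon>] by metis
  obtain r' K where r': "\<And>i. r' i > 0" "\<And>i. K i \<ge> 0"
    "\<And>i a b. a \<in> ball z0 (r' i) \<Longrightarrow> b \<in> ball z0 (r' i) \<Longrightarrow> \<bar>q i a - q i b\<bar> \<le> K i * norm (a - b)"
    using locally_lipschitz[OF smq L(2) z0(1)] by metis
  define R where "R = min (Min (range r)) (Min (range r'))"
  have R: "R > 0" "\<And>i. R \<le> r i" "\<And>i. R \<le> r' i"
    unfolding R_def using r(1) r'(1) by (auto simp: min_le_iff_disj)
  define K' where "K' = 1 + (\<Sum>i\<in>UNIV. K i)"
  have K': "K' \<ge> 0" unfolding K'_def using r'(2) by (simp add: sum_nonneg)
  have lower: "B / 2 * norm (a - b) \<le> norm (\<Phi> a - \<Phi> b)" if "a \<in> ball z0 R" "b \<in> ball z0 R" for a b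
  proof -
    have "norm (\<Phi> a - \<Phi> b - \<Lambda> (a - b)) = norm (\<chi> i. p i a - p i b - dd (p i) (a - b) z0)"
    proof -
      have "\<Phi> a - \<Phi> b - \<Lambda> (a - b) = (0, \<chi> i. p i a - p i b - dd (p i) (a - b) z0)"
        by (simp add: \<Phi>_def \<Lambda>_def vec_eq_iff)
      then show ?thesis by (simp add: norm_Pair)
    qed
    also have "\<dots> \<le> (\<Sum>i\<in>UNIV. \<bar>p i a - p i b - dd (p i) (a - b) z0\<bar>)"
      using norm_le_l1_cart[of "\<chi> i. p i a - p i b - dd (p i) (a - b) z0"] by simp
    also have "\<dots> \<le> (\<Sum>i\<in>(UNIV :: 'n set). \<epsilon> * norm (a - b))"
      by (intro sum_mono r(3)) (use that R(2) in \<open>auto intro: less_le_trans\<close>)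
    also have "\<dots> = B / 2 * norm (a - b)" by (simp add: \<epsilon>_def)
    finally have "norm (\<Lambda> (a - b)) \<le> norm (\<Phi> a - \<Phi> b) + B / 2 * norm (a - b)"
      by (smt (verit) norm_triangle_ineq4 norm_minus_commute norm_triangle_sub)
    then show ?thesis using B(2)[of "a - b"] by simp
  qed
  have upper: "norm (snd (a - b), \<chi> i. q i a - q i b) \<le> K' * norm (a - b)" if "a \<in> ball z0 R" "b \<in> ball z0 R" for a b
  proof -
    have "norm (snd (a - b), \<chi> i. q i a - q i b) \<le> norm (snd (a - b)) + norm (\<chi> i. q i a - q i b)"
      by (rule norm_Pair_le)
    also have "norm (snd (a - b)) \<le> norm (a - b)" by (metis norm_snd_le prod.collapse)
    also have "norm (\<chi> i. q i a - q i b) \<le> (\<Sum>i\<in>UNIV. \<bar>q i a - q i b\<bar>)"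
      using norm_le_l1_cart[of "\<chi> i. q i a - q i b"] by simp
    also have "\<dots> \<le> (\<Sum>i\<in>UNIV. K i * norm (a - b))"
      by (intro sum_mono r'(3)) (use that R(3) in \<open>auto intro: less_le_trans\<close>)
    finally show ?thesis by (simp add: K'_def sum_distrib_right distrib_right)
  qed
  have zc: "isCont (z k) t0" if "k < 2" for k
  proof -
    have "isCont (x k) t0" using x[OF that I(2)] has_vector_derivative_continuous by blast
    moreover have "isCont (y k) t0" using y[OF that] I continuous_on_eq_continuous_at by blast
    ultimately show ?thesis unfolding z_def by (intro continuous_intros)
  qed
  have "\<exists>d>0. \<forall>t. dist t t0 < d \<longrightarrow> z k t \<in> ball z0 R" if "k < 2" for k
  proof -
    have "z k t0 = z0" using z0 that by (cases "k = 0") (auto simp: less_2_cases_iff)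
    then show ?thesis
      using zc[OF that] R(1) unfolding continuous_at_eps_delta by (metis dist_commute mem_ball)
  qed
  then obtain d0 d1 where d01: "d0 > 0" "d1 > 0" "\<And>t. dist t t0 < d0 \<Longrightarrow> z 0 t \<in> ball z0 R"
    "\<And>t. dist t t0 < d1 \<Longrightarrow> z 1 t \<in> ball z0 R" by (metis one_less_numeral_iff pos2 semiring_norm(76))
  obtain d2 where d2: "d2 > 0" "ball t0 d2 \<subseteq> I" using I openE by blast
  define C where "C = 2 * K' / B"
  have C: "C \<ge> 0" using K' B by (simp add: C_def)
  define d3 where "d3 = 1 / (C + 1)"
  have d3: "d3 > 0" using C by (simp add: d3_def)
  define \<delta> where "\<delta> = min (min d0 d1) (min d2 d3) / 2"
  have \<delta>: "\<delta> > 0" "\<delta> < d0" "\<delta> < d1" "\<delta> < d2" "\<delta> < d3"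
    using d01(1,2) d2(1) d3 unfolding \<delta>_def by (auto simp: min_def)
  have C\<delta>: "C * \<delta> < 1"
  proof -
    have "C * \<delta> \<le> (C + 1) * \<delta>" using \<delta> by simp
    also have "\<dots> < 1" using \<delta>(5) C by (simp add: d3_def field_simps)
    finally show ?thesis .
  qed
  have zb: "z 0 t \<in> ball z0 R" "z 1 t \<in> ball z0 R" "t \<in> I" if "t \<in> cball t0 \<delta>" for t
    using d01(3,4)[of t] d2(2) that \<delta> by (auto simp: dist_commute)
  define w where "w = (\<lambda>t. \<Phi> (z 0 t) - \<Phi> (z 1 t))"
  define w' where "w' = (\<lambda>t. (snd (z 0 t - z 1 t), \<chi> i. q i (z 0 t) - q i (z 1 t)))"
  have w0: "w t = 0" if "t \<in> cball t0 \<delta>" for t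
  proof (rule zero_of_derivative_bound[OF _ C _ C\<delta> _ _ that])
    show "w t0 = 0" unfolding w_def z0(2,3) by simp
    show "\<delta> \<ge> 0" using \<delta> by simp
    fix t assume t: "t \<in> cball t0 \<delta>"
    have P: "((\<lambda>t. \<chi> i. p i (z k t)) has_vector_derivative (\<chi> i. q i (z k t))) (at t)" if "k < 2" for k
      unfolding has_vector_derivative_def
    proof (subst has_derivative_componentwise_within, intro ballI)
      fix b :: "real^'n" assume "b \<in> Basis"
      then obtain i where b: "b = axis i 1" by (auto simp: Basis_vec_def)
      show "((\<lambda>t. (\<chi> i. p i (z k t)) \<bullet> b) has_derivative (\<lambda>r. (r *\<^sub>R (\<chi> i. q i (z k t))) \<bullet> b)) (at t)"
        using EL[OF that zb(3)[OF t], of i]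
        by (simp add: b inner_axis has_field_derivative_def z_def mult_commute_abs mult.commute)
    qed
    show "(w has_vector_derivative w' t) (at t)"
    proof -
      have "w = (\<lambda>t. (x 0 t - x 1 t, (\<chi> i. p i (z 0 t)) - (\<chi> i. p i (z 1 t))))"
        by (simp add: w_def \<Phi>_def z_def)
      moreover have "w' t = (y 0 t - y 1 t, (\<chi> i. q i (z 0 t)) - (\<chi> i. q i (z 1 t)))"
        by (simp add: w'_def z_def vec_eq_iff)
      ultimately show ?thesis
        by (auto intro!: has_vector_derivative_Pair has_vector_derivative_diff x zb(3)[OF t] P)
    qed
    have "norm (w' t) \<le> K' * norm (z 0 t - z 1 t)"
      unfolding w'_def by (rule upper) (use zb t in auto)
    also have "\<dots> \<le> K' * (2 / B * norm (w t))"
      using lower[of "z 0 t" "z 1 t"] zb[OF t] B(1) K'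
      by (intro mult_left_mono) (auto simp: w_def field_simps)
    finally show "norm (w' t) \<le> C * norm (w t)" by (simp add: C_def mult_ac)
  qed
  have "z 0 t = z 1 t" "t \<in> I" if "t \<in> ball t0 \<delta>" for t
  proof -
    have t: "t \<in> cball t0 \<delta>" using that by auto
    then show "t \<in> I" using zb by blast
    have "B / 2 * norm (z 0 t - z 1 t) \<le> 0"
      using lower[of "z 0 t" "z 1 t"] zb[OF t] w0[OF t] by (simp add: w_def)
    then show "z 0 t = z 1 t" using B(1) by (simp add: mult_le_0_iff)
  qed
  then show ?thesis using \<delta>(1) by (intro exI[of _ \<delta>]) (auto simp: z_def)
qed

section \<open>Geodesics and the geodesic flow\<close>

context manifold
begin

lemma smooth_curve:
  assumes "smooth_into A UNIV \<sigma>" "c \<in> A"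
  shows "open (\<sigma> -` fst c)" "smooth_on (\<sigma> -` fst c) (snd c \<circ> \<sigma>)"
  using assms by (auto simp: smooth_into_def)

lemma velocity_chart:
  assumes \<sigma>: "smooth_into A UNIV \<sigma>" and c: "c \<in> A" "\<sigma> t \<in> fst c"
  shows "((snd c \<circ> \<sigma>) has_vector_derivative velocity A \<sigma> t c) (at t)"
    and "velocity A \<sigma> t c = frechet_derivative (snd c \<circ> \<sigma>) (at t) 1"
proof -
  have d: "(snd c \<circ> \<sigma>) differentiable (at t)"
    by (rule smooth_onD_differentiable[OF smooth_curve(2)[OF \<sigma> c(1)]]) (use c in simp)
  then show "((snd c \<circ> \<sigma>) has_vector_derivative velocity A \<sigma> t c) (at t)"
    using c by (simp add: velocity_def vector_derivative_works)
  show "velocity A \<sigma> t c = frechet_derivative (snd c \<circ> \<sigma>) (at t) 1"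
    using c frechet_derivative_eq_vector_derivative[OF d] by (simp add: velocity_def)
qed

lemma smooth_velocity:
  assumes "smooth_into A UNIV \<sigma>" "c \<in> A"
  shows "smooth_on (\<sigma> -` fst c) (\<lambda>t. velocity A \<sigma> t c)"
  by (rule smooth_on_cong[OF smooth_curve(1)[OF assms] smooth_on_dd[OF smooth_curve(2)[OF assms]]])
    (use velocity_chart(2)[OF assms] in auto)

text \<open>The chain rule for the transition maps is the transformation law of tangent vectors.\<close>

lemma velocity_tangent:
  assumes \<sigma>: "smooth_into A UNIV \<sigma>"
  shows "velocity A \<sigma> t \<in> tangent_space A (\<sigma> t)"
  unfolding tangent_space_def
proof (intro CollectI conjI allI ballI impI)
  fix c d assume c: "c \<in> A" "\<sigma> t \<in> fst c" and d: "d \<in> A" "\<sigma> t \<in> fst d"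
  have "((snd d \<circ> chart_inv c) has_derivative trans_deriv c d (\<sigma> t)) (at ((snd c \<circ> \<sigma>) t))"
    using has_derivative_transition[OF c(1) d(1) c(2) d(2)] by simp
  from diff_chain_at[OF velocity_chart(1)[OF \<sigma> c, unfolded has_vector_derivative_def] this]
  have "(((snd d \<circ> chart_inv c) \<circ> (snd c \<circ> \<sigma>)) has_vector_derivative trans_deriv c d (\<sigma> t) (velocity A \<sigma> t c)) (at t)"
    using linear_cmul[OF linear_trans_deriv[OF c(1) d(1) c(2) d(2)]] by (simp add: has_vector_derivative_def o_def)
  then have "((snd d \<circ> \<sigma>) has_vector_derivative trans_deriv c d (\<sigma> t) (velocity A \<sigma> t c)) (at t)"
    by (rule has_vector_derivative_transform_within_open[OF _ smooth_curve(1)[OF \<sigma> c(1)]])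
      (use c in \<open>auto simp: chart_inv_left\<close>)
  then show "velocity A \<sigma> t d = trans_deriv c d (\<sigma> t) (velocity A \<sigma> t c)"
    using velocity_chart(1)[OF \<sigma> d] vector_derivative_unique_at by blast
qed (auto simp: velocity_def)

lemma smooth_curve_shift:
  assumes \<sigma>: "smooth_into A UNIV \<sigma>"
  shows "smooth_into A UNIV (\<lambda>t. \<sigma> (s + t))" "velocity A (\<lambda>t. \<sigma> (s + t)) t = velocity A \<sigma> (s + t)"
    "lift (\<lambda>t. \<sigma> (s + t)) t = lift \<sigma> (s + t)"
proof -
  have pre: "(\<lambda>t. \<sigma> (s + t)) -` T = (\<lambda>t. s + t) -` (\<sigma> -` T)" for T by auto
  show "smooth_into A UNIV (\<lambda>t. \<sigma> (s + t))"
    unfolding smooth_into_def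
  proof (intro conjI ballI)
    show "(\<lambda>t. \<sigma> (s + t)) ` UNIV \<subseteq> carrier_of A" using \<sigma> by (auto simp: smooth_into_def)
    fix c assume c: "c \<in> A"
    have "smooth_on ((\<lambda>t. s + t) -` (\<sigma> -` fst c)) (\<lambda>t. (snd c \<circ> \<sigma>) (s + t))"
      by (rule smooth_on_affine_comp[OF bounded_linear_ident smooth_curve[OF \<sigma> c]])
    then show "smooth_on (UNIV \<inter> (\<lambda>t. \<sigma> (s + t)) -` fst c) (snd c \<circ> (\<lambda>t. \<sigma> (s + t)))"
      by (simp add: pre o_def)
    have "open ((\<lambda>t. s + t) -` (\<sigma> -` fst c))"
      by (intro open_vimage smooth_curve(1)[OF \<sigma> c] continuous_intros)
    then show "open (UNIV \<inter> (\<lambda>t. \<sigma> (s + t)) -` fst c)" by (simp add: pre)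
  qed
  show v: "velocity A (\<lambda>t. \<sigma> (s + t)) t = velocity A \<sigma> (s + t)"
  proof
    fix c
    show "velocity A (\<lambda>t. \<sigma> (s + t)) t c = velocity A \<sigma> (s + t) c"
    proof (cases "c \<in> A \<and> \<sigma> (s + t) \<in> fst c")
      case True
      have 1: "((\<lambda>t. s + t) has_vector_derivative 1) (at t)"
        by (auto intro!: derivative_eq_intros)
      have "((snd c \<circ> \<sigma>) has_vector_derivative velocity A \<sigma> (s + t) c) (at (s + t))"
        using velocity_chart(1)[OF \<sigma>] True by blast
      from vector_diff_chain_at[OF 1 this]
      have "((snd c \<circ> (\<lambda>t. \<sigma> (s + t))) has_vector_derivative velocity A \<sigma> (s + t) c) (at t)"
        by (simp add: o_def)
      then show ?thesis using True by (simp add: velocity_def[of A "\<lambda>t. \<sigma> (s + t)"] vector_derivative_at)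
    qed (auto simp: velocity_def)
  qed
  show "lift (\<lambda>t. \<sigma> (s + t)) t = lift \<sigma> (s + t)"
    by (simp add: canonical_lift_def v)
qed

lemma topspace_manifold: "topspace (manifold_topology A) = carrier_of A"
proof -
  have "carrier_of A \<subseteq> \<Union> {fst c \<inter> snd c -` W |c W. c \<in> A \<and> open W}"
  proof
    fix p assume "p \<in> carrier_of A"
    then obtain c where c: "c \<in> A" "p \<in> fst c" using carrier_chart by blast
    show "p \<in> \<Union> {fst c \<inter> snd c -` W |c W. c \<in> A \<and> open W}"
    proof (rule UnionI[of "fst c \<inter> snd c -` UNIV"])
      show "fst c \<inter> snd c -` UNIV \<in> {fst c \<inter> snd c -` W |c W. c \<in> A \<and> open W}"
        using c(1) open_UNIV by blast
    qed (use c in simp)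
  qed
  then show ?thesis
    unfolding manifold_topology_def topology_generated_by_topspace by (auto simp: carrier_of_def)
qed

lemma open_vimage_curve:
  fixes \<sigma> :: "real \<Rightarrow> 'a"
  assumes \<sigma>: "smooth_into A UNIV \<sigma>" and "openin (manifold_topology A) U"
  shows "open (\<sigma> -` U)"
proof -
  have "continuous_map euclideanreal (manifold_topology A) \<sigma>"
    unfolding manifold_topology_def
  proof (rule continuous_on_generated_topo)
    fix U assume "U \<in> {fst c \<inter> snd c -` W |c W. c \<in> A \<and> open W}"
    then obtain c W where c: "c \<in> A" "open W" "U = fst c \<inter> snd c -` W" by blast
    have "open (\<sigma> -` fst c \<inter> (snd c \<circ> \<sigma>) -` W)"
      by (intro continuous_open_preimage smooth_on_continuous_on smooth_curve \<sigma> c)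
    moreover have "\<sigma> -` U = \<sigma> -` fst c \<inter> (snd c \<circ> \<sigma>) -` W" using c by auto
    ultimately show "openin euclideanreal (\<sigma> -` U \<inter> topspace euclideanreal)" by simp
  next
    have "\<sigma> ` UNIV \<subseteq> carrier_of A" using \<sigma> by (simp add: smooth_into_def)
    moreover have "carrier_of A = \<Union> {fst c \<inter> snd c -` W |c W. c \<in> A \<and> open W}"
      using topspace_manifold unfolding manifold_topology_def topology_generated_by_topspace by simp
    ultimately show "\<sigma> ` topspace euclideanreal \<subseteq> \<Union> {fst c \<inter> snd c -` W |c W. c \<in> A \<and> open W}" by auto
  qed
  from openin_continuous_map_preimage[OF this assms(2)] show ?thesis by (simp add: vimage_def)
qed

text \<open>Base points are separated by the Hausdorff property, distinct velocities at a common base point by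
  continuity in a chart.\<close>

lemma separate_lifts:
  assumes \<sigma>: "smooth_into A UNIV \<sigma>" and \<rho>: "smooth_into A UNIV \<rho>"
    and ne: "lift \<sigma> t0 \<noteq> lift \<rho> t0"
  shows "\<exists>J. open J \<and> t0 \<in> J \<and> (\<forall>t\<in>J. lift \<sigma> t \<noteq> lift \<rho> t)"
proof (cases "\<sigma> t0 = \<rho> t0")
  case False
  have car: "\<sigma> t0 \<in> topspace (manifold_topology A)" "\<rho> t0 \<in> topspace (manifold_topology A)"
    using \<sigma> \<rho> unfolding topspace_manifold smooth_into_def by blast+
  have "Hausdorff_space (manifold_topology A)" using smooth_manifold by (simp add: smooth_manifold_def)
  then obtain U V where UV: "openin (manifold_topology A) U" "openin (manifold_topology A) V"
    "\<sigma> t0 \<in> U" "\<rho> t0 \<in> V" "disjnt U V"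
    using False car unfolding Hausdorff_space_def by metis
  then show ?thesis
    using open_vimage_curve[OF \<sigma> UV(1)] open_vimage_curve[OF \<rho> UV(2)]
    by (intro exI[of _ "\<sigma> -` U \<inter> \<rho> -` V"]) (auto simp: canonical_lift_def disjnt_iff)
next
  case True
  then have vne: "velocity A \<sigma> t0 \<noteq> velocity A \<rho> t0" using ne by (auto simp: canonical_lift_def)
  have "\<sigma> t0 \<in> carrier_of A" using \<sigma> by (auto simp: smooth_into_def)
  then obtain c where c: "c \<in> A" "\<sigma> t0 \<in> fst c" using carrier_chart by blast
  let ?I = "\<sigma> -` fst c \<inter> \<rho> -` fst c"
  have oI: "open ?I" using smooth_curve(1) \<sigma> \<rho> c(1) by blast
  have vc: "velocity A \<sigma> t0 c \<noteq> velocity A \<rho> t0 c"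
    using tangent_eqI[OF c velocity_tangent[OF \<sigma>], of "velocity A \<rho> t0"] velocity_tangent[OF \<rho>, of t0] vne True by auto
  define f where "f = (\<lambda>t. velocity A \<sigma> t c - velocity A \<rho> t c)"
  have "continuous_on ?I f"
    unfolding f_def
    by (intro continuous_on_diff continuous_on_subset[OF smooth_on_continuous_on[OF smooth_velocity[OF \<sigma> c(1)]]]
      continuous_on_subset[OF smooth_on_continuous_on[OF smooth_velocity[OF \<rho> c(1)]]]) auto
  then have "open (?I \<inter> f -` (- {0}))" by (rule continuous_open_preimage[OF _ oI]) auto
  then show ?thesis
    using c True vc by (intro exI[of _ "?I \<inter> f -` (- {0})"]) (auto simp: f_def canonical_lift_def)
qed

end

context finsler_manifold
begin

lemma geodesicD:
  assumes "geodesic A F \<sigma>"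
  shows "smooth_into A UNIV \<sigma>" "velocity A \<sigma> t \<noteq> 0"
    and "c \<in> A \<Longrightarrow> \<sigma> t \<in> fst c \<Longrightarrow>
      ((\<lambda>s. dd (E c) (0, axis i 1) (snd c (\<sigma> s), velocity A \<sigma> s c)) has_real_derivative
        dd (E c) (axis i 1, 0) (snd c (\<sigma> t), velocity A \<sigma> t c)) (at t)"
  using assms unfolding geodesic_def Let_def canonical_lift_def tangent_chart_snd by blast+

lemma lift_in_slit:
  assumes "geodesic A F \<sigma>"
  shows "lift \<sigma> t \<in> slit_tangent_bundle A"
proof -
  note \<sigma> = geodesicD[OF assms]
  have "\<sigma> t \<in> carrier_of A" using \<sigma>(1) by (auto simp: smooth_into_def)
  then show ?thesis
    using velocity_tangent[OF \<sigma>(1)] \<sigma>(2) by (simp add: canonical_lift_def slit_tangent_bundle_def tangent_bundle_def)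
qed

lemma velocity_chart_nonzero:
  assumes "geodesic A F \<sigma>" "c \<in> A" "\<sigma> t \<in> fst c"
  shows "velocity A \<sigma> t c \<noteq> 0"
  using tangent_eqI[OF assms(2,3) velocity_tangent[OF geodesicD(1)[OF assms(1)]] subspace_0[OF subspace_tangent_space]]
    geodesicD(2)[OF assms(1)]
  by auto

lemma geodesic_shift:
  assumes "geodesic A F \<sigma>"
  shows "geodesic A F (\<lambda>t. \<sigma> (s + t))"
proof -
  note \<sigma> = geodesicD[OF assms] and sh = smooth_curve_shift[OF geodesicD(1)[OF assms], of s]
  have "((\<lambda>r. dd (E c) (0, axis i 1) (snd c (\<sigma> (s + r)), velocity A \<sigma> (s + r) c)) has_real_derivative
        dd (E c) (axis i 1, 0) (snd c (\<sigma> (s + t)), velocity A \<sigma> (s + t) c)) (at t)"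
    if "c \<in> A" "\<sigma> (s + t) \<in> fst c" for c t i
  proof -
    have "((\<lambda>r. s + r) has_real_derivative 1) (at t)" by (auto intro!: derivative_eq_intros)
    from DERIV_chain2[OF \<sigma>(3)[OF that] this] show ?thesis by simp
  qed
  then show ?thesis
    unfolding geodesic_def Let_def using sh(1) \<sigma>(2)
    by (auto simp: canonical_lift_def tangent_chart_snd sh(2))
qed

lemma geodesic_locally_unique:
  assumes \<sigma>: "geodesic A F \<sigma>" and \<rho>: "geodesic A F \<rho>"
    and eq: "lift \<sigma> t0 = lift \<rho> t0"
  shows "\<exists>J. open J \<and> t0 \<in> J \<and> (\<forall>t\<in>J. lift \<sigma> t = lift \<rho> t)"
proof -
  note s = geodesicD[OF \<sigma>] and r = geodesicD[OF \<rho>]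
  have eq': "\<sigma> t0 = \<rho> t0" "velocity A \<sigma> t0 = velocity A \<rho> t0" using eq by (auto simp: canonical_lift_def)
  have "\<sigma> t0 \<in> carrier_of A" using s(1) by (auto simp: smooth_into_def)
  then obtain c where c: "c \<in> A" "\<sigma> t0 \<in> fst c" using carrier_chart by blast
  let ?I = "\<sigma> -` fst c \<inter> \<rho> -` fst c" and ?S = "rng c \<times> - {0::real^'n}"
  let ?\<gamma> = "\<lambda>k::nat. if k = 0 then \<sigma> else \<rho>"
  have \<gamma>: "geodesic A F (?\<gamma> k)" for k using \<sigma> \<rho> by auto
  have I: "?I \<subseteq> ?\<gamma> k -` fst c" for k by auto
  have "\<exists>\<delta>>0. \<forall>t\<in>ball t0 \<delta>. t \<in> ?I \<and> (snd c \<circ> ?\<gamma> 0) t = (snd c \<circ> ?\<gamma> 1) t \<and> velocity A (?\<gamma> 0) t c = velocity A (?\<gamma> 1) t c"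
  proof (rule euler_lagrange_locally_unique[OF smooth_E[OF c(1)] open_slit[OF c(1)], of ?I t0 "\<lambda>k. snd c \<circ> ?\<gamma> k" "\<lambda>k t. velocity A (?\<gamma> k) t c"])
    show "open ?I" using smooth_curve(1) s(1) r(1) c(1) by blast
    show "t0 \<in> ?I" using c eq' by simp
    fix k :: nat and t assume t: "t \<in> ?I"
    then have tc: "?\<gamma> k t \<in> fst c" using I by blast
    show "((snd c \<circ> ?\<gamma> k) has_vector_derivative velocity A (?\<gamma> k) t c) (at t)"
      by (rule velocity_chart(1)[OF geodesicD(1)[OF \<gamma>] c(1) tc])
    show "((\<lambda>s. dd (E c) (0, axis i 1) ((snd c \<circ> ?\<gamma> k) s, velocity A (?\<gamma> k) s c)) has_real_derivative
          dd (E c) (axis i 1, 0) ((snd c \<circ> ?\<gamma> k) t, velocity A (?\<gamma> k) t c)) (at t)" for i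
      using geodesicD(3)[OF \<gamma> c(1) tc] by simp
  next
    fix k :: nat
    show "continuous_on ?I (\<lambda>t. velocity A (?\<gamma> k) t c)"
      by (rule continuous_on_subset[OF smooth_on_continuous_on[OF smooth_velocity[OF geodesicD(1)[OF \<gamma>] c(1)]] I])
    have "?\<gamma> k t0 \<in> fst c" using c eq' by simp
    then show "((snd c \<circ> ?\<gamma> k) t0, velocity A (?\<gamma> k) t0 c) \<in> ?S"
      using velocity_chart_nonzero[OF \<gamma> c(1)] by simp
  next
    fix z and v :: "real^'n" assume "z \<in> ?S" and 0: "\<And>i. dd (dd (E c) (0, axis i 1)) (0, v) z = 0"
    then obtain x y where z: "z = (x, y)" "x \<in> rng c" "y \<noteq> 0" by auto
    interpret M: minkowski_energy "\<lambda>y. E c (x, y)" by (rule minkowski_energy_fibre'[OF c(1) z(2)])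
    have "(v v* hessian (\<lambda>y. E c (x, y)) y) $ j = 0" for j
    proof -
      let ?p = "dd (E c) (0, axis j 1)"
      have sm: "smooth_on ?S ?p" by (intro smooth_on_dd smooth_E c)
      have dif: "(\<lambda>y. ?p (x, y)) differentiable (at y)"
      proof -
        have 1: "((\<lambda>y. (x, y)) has_derivative (\<lambda>v. (0, v))) (at y)" by (auto intro!: derivative_eq_intros)
        have 2: "(?p has_derivative frechet_derivative ?p (at (x, y))) (at (x, y))"
          by (rule smooth_on_has_derivative[OF sm]) (use z in auto)
        show ?thesis by (rule differentiableI[OF diff_chain_at[OF 1 2, unfolded o_def]])
      qed
      have "0 = dd (\<lambda>y. ?p (x, y)) v y"
        using 0[of j] dd_fibre[OF c(1) z(2,3) sm] z(1) by simp
      also have "\<dots> = (\<Sum>i\<in>UNIV. v $ i * dd (\<lambda>y. ?p (x, y)) (axis i 1) y)" by (rule dd_expand[OF dif])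
      also have "\<dots> = (\<Sum>i\<in>UNIV. v $ i * hessian (\<lambda>y. E c (x, y)) y $ i $ j)"
        using dd_fibre[OF c(1) z(2,3) sm] hessian_fibre[OF c(1) z(2,3)] by simp
      finally show ?thesis by (simp add: vector_matrix_mult_def mult.commute)
    qed
    then have "v v* hessian (\<lambda>y. E c (x, y)) y = 0" by (simp add: vec_eq_iff)
    then have "v \<bullet> (hessian (\<lambda>y. E c (x, y)) y *v v) = 0" by (simp add: dot_lmul_matrix[symmetric])
    then show "v = 0" using M.posdef[OF z(3), of v] by auto
  qed (use eq' in auto)
  then obtain \<delta> where \<delta>: "\<delta> > 0" "\<And>t. t \<in> ball t0 \<delta> \<Longrightarrow> t \<in> ?I \<and> snd c (\<sigma> t) = snd c (\<rho> t) \<and> velocity A \<sigma> t c = velocity A \<rho> t c"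
    by auto
  have "lift \<sigma> t = lift \<rho> t" if "t \<in> ball t0 \<delta>" for t
  proof -
    note t = \<delta>(2)[OF that]
    have "\<sigma> t = \<rho> t" using t inj_onD[OF inj_chart[OF c(1)]] by auto
    moreover have "velocity A \<sigma> t = velocity A \<rho> t"
      by (rule tangent_eqI[OF c(1)])
        (use t velocity_tangent[OF s(1), of t] velocity_tangent[OF r(1), of t] \<open>\<sigma> t = \<rho> t\<close> in auto)
    ultimately show ?thesis by (simp add: canonical_lift_def)
  qed
  then show ?thesis using \<delta>(1) by (intro exI[of _ "ball t0 \<delta>"]) auto
qed

text \<open>The set of times at which the lifts agree is open and closed.\<close>

lemma geodesic_unique:
  assumes \<sigma>: "geodesic A F \<sigma>" and \<rho>: "geodesic A F \<rho>"
    and eq: "lift \<sigma> t0 = lift \<rho> t0"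
  shows "lift \<sigma> t = lift \<rho> t"
proof -
  let ?T = "{t. lift \<sigma> t = lift \<rho> t}"
  have "open ?T"
  proof (subst open_subopen, intro ballI)
    fix t assume "t \<in> ?T"
    then obtain J where "open J" "t \<in> J" "\<forall>t\<in>J. lift \<sigma> t = lift \<rho> t"
      using geodesic_locally_unique[OF \<sigma> \<rho>, of t] by blast
    then show "\<exists>J. open J \<and> t \<in> J \<and> J \<subseteq> ?T" by blast
  qed
  moreover have "open (- ?T)"
  proof (subst open_subopen, intro ballI)
    fix t assume "t \<in> - ?T"
    then obtain J where "open J" "t \<in> J" "\<forall>t\<in>J. lift \<sigma> t \<noteq> lift \<rho> t"
      using separate_lifts[OF geodesicD(1)[OF \<sigma>] geodesicD(1)[OF \<rho>], of t] by blast
    then show "\<exists>J. open J \<and> t \<in> J \<and> J \<subseteq> - ?T" by blast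
  qed
  ultimately have "?T = {} \<or> ?T = UNIV" using clopen[of ?T] by (simp add: closed_def)
  then show ?thesis using eq by blast
qed

text \<open>Uniqueness of geodesics makes the definite description in the definition of the flow meaningful.\<close>

lemma geodesic_flow_lift:
  assumes \<sigma>: "geodesic A F \<sigma>"
  shows "geodesic_flow A F t (lift \<sigma> s) = lift \<sigma> (s + t)"
  unfolding geodesic_flow_def
proof (rule the_equality)
  note sh = smooth_curve_shift(3)[OF geodesicD(1)[OF \<sigma>]]
  show "\<exists>\<rho>. geodesic A F \<rho> \<and> lift \<rho> 0 = lift \<sigma> s \<and> lift \<rho> t = lift \<sigma> (s + t)"
    using geodesic_shift[OF \<sigma>, of s] sh[of s] by (intro exI[of _ "\<lambda>t. \<sigma> (s + t)"]) simp
  fix \<eta> assume "\<exists>\<rho>. geodesic A F \<rho> \<and> lift \<rho> 0 = lift \<sigma> s \<and> lift \<rho> t = \<eta>"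
  then obtain \<rho> where \<rho>: "geodesic A F \<rho>" "lift \<rho> 0 = lift \<sigma> s" "lift \<rho> t = \<eta>" by blast
  have "lift \<rho> t = lift (\<lambda>t. \<sigma> (s + t)) t"
    by (rule geodesic_unique[OF \<rho>(1) geodesic_shift[OF \<sigma>], of 0]) (use \<rho>(2) sh in simp)
  then show "\<eta> = lift \<sigma> (s + t)" using \<rho>(3) sh by simp
qed

text \<open>The S-curvature is a value of \<open>deriv\<close>, which determines an actual derivative only because the distortion
  is differentiable along the geodesic.\<close>

lemma distortion_along_geodesic:
  assumes \<sigma>: "geodesic A F \<sigma>" and S: "\<And>\<theta>. \<theta> \<in> slit_tangent_bundle A \<Longrightarrow> S_curvature A F \<theta> = K * F \<theta>"
  shows "((\<lambda>t. distortion A F (lift \<sigma> t)) has_real_derivative K * F (lift \<sigma> t)) (at t)"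
proof -
  define f where "f = (\<lambda>t. distortion A F (lift \<sigma> t))"
  note s = geodesicD[OF \<sigma>]
  have "\<sigma> t \<in> carrier_of A" using s(1) by (auto simp: smooth_into_def)
  then obtain c where c: "c \<in> A" "\<sigma> t \<in> fst c" using carrier_chart by blast
  define z where "z = (\<lambda>t. (snd c (\<sigma> t), velocity A \<sigma> t c))"
  have "z differentiable (at t)"
  proof -
    have "(snd c \<circ> \<sigma>) differentiable (at t)"
      by (rule smooth_onD_differentiable[OF smooth_curve(2)[OF s(1) c(1)]]) (use c in simp)
    moreover have "(\<lambda>t. velocity A \<sigma> t c) differentiable (at t)"
      by (rule smooth_onD_differentiable[OF smooth_velocity[OF s(1) c(1)]]) (use c in simp)
    ultimately show ?thesis unfolding z_def o_def differentiable_def by (elim exE, intro exI) (rule has_derivative_Pair)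
  qed
  moreover have "chart_distortion c differentiable (at (z t))"
    by (rule chart_distortion_differentiable[OF c(1)]) (use c velocity_chart_nonzero[OF \<sigma> c] in \<open>auto simp: z_def\<close>)
  ultimately have "(chart_distortion c \<circ> z) differentiable (at t)" by (rule differentiable_chain_at)
  then have "f differentiable (at t)"
  proof (rule frechet_derivative_cong_open(2)[OF smooth_curve(1)[OF s(1) c(1)], rotated 2])
    show "t \<in> \<sigma> -` fst c" using c by simp
    fix r assume "r \<in> \<sigma> -` fst c"
    then show "(chart_distortion c \<circ> z) r = f r"
      using distortion_eq_chart_distortion[OF c(1) _ velocity_tangent[OF s(1)] s(2), of r]
      by (simp add: f_def z_def canonical_lift_def)
  qed
  then have f: "(f has_real_derivative deriv f t) (at t)"
    using DERIV_deriv_iff_real_differentiable by blast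
  have "((\<lambda>r. f (t + r)) has_real_derivative deriv f t) (at 0)"
  proof -
    have "((\<lambda>r. t + r) has_real_derivative 1) (at 0)" by (auto intro!: derivative_eq_intros)
    from DERIV_chain2[OF _ this, of f] f show ?thesis by simp
  qed
  then have "deriv (\<lambda>r. f (t + r)) 0 = deriv f t" by (rule DERIV_imp_deriv)
  moreover have "S_curvature A F (lift \<sigma> t) = deriv (\<lambda>r. f (t + r)) 0"
    by (simp add: S_curvature_def geodesic_flow_lift[OF \<sigma>] f_def)
  ultimately have "deriv f t = K * F (lift \<sigma> t)" using S[OF lift_in_slit[OF \<sigma>]] by simp
  then show ?thesis using f by (simp add: f_def)
qed

lemma unit_nonzero: "(p, v) \<in> unit_tangent_bundle A F \<Longrightarrow> v \<noteq> 0"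
  using F_zero by (auto simp: unit_tangent_bundle_def)

lemma unit_chart:
  assumes "\<theta> \<in> unit_tangent_bundle A F"
  obtains c where "c \<in> A" "\<theta> \<in> fst (TC c)" "snd (TC c) \<theta> \<in> rng c \<times> - {0}"
proof -
  obtain p v where \<theta>: "\<theta> = (p, v)" by (cases \<theta>)
  have t: "p \<in> carrier_of A" "v \<in> tangent_space A p"
    using assms by (auto simp: \<theta> unit_tangent_bundle_def tangent_bundle_def)
  then obtain c where c: "c \<in> A" "p \<in> fst c" using carrier_chart by blast
  have "v c \<noteq> 0"
    using tangent_eqI[OF c t(2) subspace_0[OF subspace_tangent_space]] unit_nonzero assms \<theta> by auto
  then show ?thesis
    using c t by (intro that[of c]) (auto simp: \<theta> tangent_chart_fst tangent_chart_snd)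
qed

text \<open>Approximation by points of a dense orbit, expressed in the coordinates of a chart.\<close>

lemma dense_orbit_chart:
  assumes dense: "subtopology (manifold_topology (tangent_atlas A)) (unit_tangent_bundle A F) closure_of R = unit_tangent_bundle A F"
    and \<theta>: "\<theta> \<in> unit_tangent_bundle A F" and c: "c \<in> A" "\<theta> \<in> fst (TC c)"
    and W: "open W" "snd (TC c) \<theta> \<in> W"
  shows "\<exists>\<eta>\<in>R. \<eta> \<in> unit_tangent_bundle A F \<and> \<eta> \<in> fst (TC c) \<and> snd (TC c) \<eta> \<in> W"
proof -
  let ?C = "TC c" and ?X = "manifold_topology (tangent_atlas A)" and ?U = "unit_tangent_bundle A F"
  have "openin ?X (fst ?C \<inter> snd ?C -` W)"
    unfolding manifold_topology_def tangent_atlas_def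
    by (rule topology_generated_by_Basis) (use c W in blast)
  then have o: "openin (subtopology ?X ?U) ((fst ?C \<inter> snd ?C -` W) \<inter> ?U)"
    unfolding openin_subtopology by blast
  have "\<theta> \<in> (fst ?C \<inter> snd ?C -` W) \<inter> ?U" using \<theta> c W by simp
  moreover have "\<theta> \<in> subtopology ?X ?U closure_of R" using dense \<theta> by simp
  then have "\<forall>T. \<theta> \<in> T \<and> openin (subtopology ?X ?U) T \<longrightarrow> (\<exists>y. y \<in> R \<and> y \<in> T)"
    unfolding in_closure_of by (rule conjunct2)
  ultimately have "\<exists>y\<in>R. y \<in> (fst ?C \<inter> snd ?C -` W) \<inter> ?U" using o by metis
  then show ?thesis by auto
qed

text \<open>If no geodesic had initial velocity \<open>\<theta>\<close>, then the orbit of \<open>\<theta>\<close> would consist of one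
  point, and a single point is not dense: every fibre of the unit tangent bundle has two opposite points.\<close>

lemma dense_orbit_geodesic:
  assumes \<theta>: "\<theta> \<in> unit_tangent_bundle A F"
    and dense: "subtopology (manifold_topology (tangent_atlas A)) (unit_tangent_bundle A F)
         closure_of range (\<lambda>t. geodesic_flow A F t \<theta>) = unit_tangent_bundle A F"
  shows "\<exists>\<sigma>. geodesic A F \<sigma> \<and> lift \<sigma> 0 = \<theta>"
proof (rule ccontr)
  assume "\<not> ?thesis"
  then have "geodesic_flow A F t \<theta> = (THE \<eta>. False)" for t
    unfolding geodesic_flow_def by (intro arg_cong[where f = The]) blast
  then have R: "range (\<lambda>t. geodesic_flow A F t \<theta>) = {THE \<eta>. False}" by auto
  obtain p v where pv: "\<theta> = (p, v)" by (cases \<theta>)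
  obtain c where c: "c \<in> A" "\<theta> \<in> fst (TC c)" using unit_chart[OF \<theta>] by blast
  have pc: "p \<in> fst c" and tv: "v \<in> tangent_space A p" using c by (auto simp: pv tangent_chart_fst)
  have v0: "v \<noteq> 0" using unit_nonzero \<theta> pv by blast
  have vc: "v c \<noteq> 0" using tangent_eqI[OF c(1) pc tv subspace_0[OF subspace_tangent_space]] v0 by auto
  define u where "u = (-1) *\<^sub>R v"
  have tu: "u \<in> tangent_space A p" unfolding u_def by (intro subspace_scale subspace_tangent_space tv)
  have uc: "u c = - v c" by (simp add: u_def)
  then have "u \<noteq> 0" using vc by auto
  then have Fu: "F (p, u) > 0" by (intro F_pos tangent_bundle_chart[OF c(1) pc tu])
  define w where "w = (1 / F (p, u)) *\<^sub>R u"
  have tw: "w \<in> tangent_space A p" unfolding w_def by (intro subspace_scale subspace_tangent_space tu)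
  have "F (p, w) = 1" unfolding w_def using F_hom[OF tangent_bundle_chart[OF c(1) pc tu], of "1 / F (p, u)"] Fu by simp
  then have w: "(p, w) \<in> unit_tangent_bundle A F" by (simp add: unit_tangent_bundle_def tangent_bundle_chart[OF c(1) pc tw])
  have "w c \<noteq> v c"
  proof
    assume "w c = v c"
    moreover have "(1 + 1 / F (p, u)) *\<^sub>R v c = v c - w c" by (simp add: w_def uc scaleR_add_left)
    ultimately have "(1 + 1 / F (p, u)) *\<^sub>R v c = 0" by simp
    moreover have "1 + 1 / F (p, u) > 0" using Fu by (simp add: add_pos_pos)
    ultimately show False using vc by simp
  qed
  then have ne: "snd (TC c) \<theta> \<noteq> snd (TC c) (p, w)" by (simp add: pv tangent_chart_snd)
  obtain W W' where W: "open W" "open W'" "snd (TC c) \<theta> \<in> W" "snd (TC c) (p, w) \<in> W'" "W \<inter> W' = {}"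
    using hausdorff[OF ne] by blast
  have "(p, w) \<in> fst (TC c)" using pc tw by (simp add: tangent_chart_fst)
  from dense_orbit_chart[OF dense w c(1) this W(2,4)] dense_orbit_chart[OF dense \<theta> c W(1,3)]
  show False using W(5) unfolding R by auto
qed

section \<open>Constant distortion characterises Riemannian metrics\<close>

text \<open>On a fibre the volume factor in the distortion is constant, so constant distortion on unit
  vectors is the hypothesis of Deicke's theorem.\<close>

lemma hessian_const_if_distortion_const:
  assumes const: "\<And>\<theta>. \<theta> \<in> unit_tangent_bundle A F \<Longrightarrow> distortion A F \<theta> = k"
    and c: "c \<in> A" and x: "x \<in> rng c" and yz: "y \<noteq> 0" "z \<noteq> 0"
  shows "hessian (fibre_energy c x) y = hessian (fibre_energy c x) z"
proof -
  interpret M: minkowski_energy "fibre_energy c x" by (rule minkowski_energy_fibre'[OF c x])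
  interpret V: smooth_norm_family "rng c" "Fc c" by (rule smooth_norm_family_Fc[OF c])
  define \<kappa> where "\<kappa> = unit_ball_volume c x / measure lborel (ball (0::real^'n) 1)"
  have "unit_ball_volume c x > 0" using V.vol_pos[OF x] by (simp add: V.vol_def unit_ball_volume_def)
  moreover have "measure lborel (ball (0::real^'n) 1) > 0"
    using content_ball_pos[of 1 "0::real^'n"] by simp
  ultimately have \<kappa>: "\<kappa> > 0" by (simp add: \<kappa>_def)
  have det: "det (hessian (fibre_energy c x) y) = (exp k / \<kappa>)\<^sup>2" if y: "y \<noteq> 0" for y
  proof -
    let ?p = "chart_inv c x"
    have p: "?p \<in> fst c" "snd c ?p = x" using chart_inv_in[OF x] chart_inv_right[OF x] by auto
    define r where "r = Fc c (x, y)"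
    have r: "r > 0" unfolding r_def by (rule Fc_pos[OF c x y])
    define u where "u = (1 / r) *\<^sub>R y"
    have u: "u \<noteq> 0" using r y by (simp add: u_def)
    have "Fc c (x, u) = 1" using Fc_hom[OF c x, of "1 / r" y] r by (simp add: u_def r_def)
    then have F1: "F (?p, coord_vector A c ?p u) = 1" by (simp add: Fc_eq[OF c x])
    have t: "coord_vector A c ?p u \<in> tangent_space A ?p" by (rule coord_vector_tangent[OF c p(1)])
    have "(?p, coord_vector A c ?p u) \<in> unit_tangent_bundle A F"
      using F1 tangent_bundle_chart[OF c p(1) t] by (simp add: unit_tangent_bundle_def)
    then have "k = chart_distortion c (x, u)"
      using const distortion_eq_chart_distortion[OF c p(1) t] coord_vector_eq_0[OF c p(1)] u
      by (simp add: p(2) coord_vector_same[OF c p(1)])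
    also have "hessian (fibre_energy c x) u = hessian (fibre_energy c x) y"
      using M.hom_dd[of "1 / r" y] r y by (simp add: hessian_def u_def)
    then have "chart_distortion c (x, u) = ln (sqrt (det (hessian (fibre_energy c x) y)) * \<kappa>)"
      by (simp add: chart_distortion_def \<kappa>_def)
    finally have "exp k = sqrt (det (hessian (fibre_energy c x) y)) * \<kappa>"
      using det_hessian_pos[OF c x y] \<kappa> by simp
    then have "sqrt (det (hessian (fibre_energy c x) y)) = exp k / \<kappa>" using \<kappa> by (simp add: field_simps)
    then show ?thesis using det_hessian_pos[OF c x y] by (metis less_imp_le real_sqrt_pow2)
  qed
  interpret minkowski_energy_const_det "fibre_energy c x"
    by unfold_locales (simp add: det)
  show ?thesis by (rule deicke[OF yz])
qed

text \<open>The polarisation \<open>h\<close> of \<open>F\<^sup>2\<close> is the metric. In a chart it is bilinear with the constant Hessian as matrix,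
  and it depends smoothly on the base point because each \<open>F\<^sup>2(x, y)\<close> with fixed \<open>y\<close> does.\<close>

lemma riemannian_if_fibre_hessian_const:
  assumes const: "\<And>c x y z. c \<in> A \<Longrightarrow> x \<in> rng c \<Longrightarrow> y \<noteq> 0 \<Longrightarrow> z \<noteq> 0 \<Longrightarrow>
    hessian (fibre_energy c x) y = hessian (fibre_energy c x) z"
  shows "riemannian_finsler A F"
proof -
  define h where "h = (\<lambda>p u v. ((F (p, u + v))\<^sup>2 - (F (p, u))\<^sup>2 - (F (p, v))\<^sup>2) / 2)"
  obtain y0 :: "real^'n" where y0: "y0 \<noteq> 0" by (metis axis_eq_0_iff one_neq_zero)
  define B where "B = (\<lambda>c x. hessian (fibre_energy c x) y0)"
  have E: "E c (x, y) = (y \<bullet> (B c x *v y)) / 2" if c: "c \<in> A" and x: "x \<in> rng c" for c x y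
  proof -
    interpret M: minkowski_energy "fibre_energy c x" by (rule minkowski_energy_fibre'[OF c x])
    show ?thesis using M.euler[of y] M.phi_0 const[OF c x _ y0, of y] by (cases "y = 0") (auto simp: B_def)
  qed
  have hB: "h p u v = u c \<bullet> (B c (snd c p) *v v c)"
    if c: "c \<in> A" "p \<in> fst c" and u: "u \<in> tangent_space A p" and v: "v \<in> tangent_space A p" for c p u v
  proof -
    have x: "snd c p \<in> rng c" using c by simp
    interpret M: minkowski_energy "fibre_energy c (snd c p)" by (rule minkowski_energy_fibre[OF c])
    have F2: "(F (p, w))\<^sup>2 = w c \<bullet> (B c (snd c p) *v w c)" if "w \<in> tangent_space A p" for w
      using E[OF c(1) x, of "w c"] Fc_coord[OF c that] by (simp add: E_eq)
    have "v c \<bullet> (B c (snd c p) *v u c) = u c \<bullet> (B c (snd c p) *v v c)"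
      unfolding B_def by (metis M.hessian_sym[OF y0] dot_lmul_matrix inner_commute vector_transpose_matrix)
    then show ?thesis
      unfolding h_def F2[OF u] F2[OF v] F2[OF subspace_add[OF subspace_tangent_space u v]]
      by (simp add: inner_add_left inner_add_right matrix_vector_right_distrib)
  qed
  have hFF: "h p v v = (F (p, v))\<^sup>2" if "(p, v) \<in> tangent_bundle A" for p v
  proof -
    have "F (p, v + v) = 2 * F (p, v)" using F_hom[OF that, of 2] by (simp add: scaleR_2)
    then show ?thesis by (simp add: h_def power_mult_distrib)
  qed
  have "riemannian_metric A h"
    unfolding riemannian_metric_def
  proof (intro conjI ballI allI impI)
    fix p u v assume "p \<in> carrier_of A" "u \<in> tangent_space A p" "v \<in> tangent_space A p"
    show "h p u v = h p v u" by (simp add: h_def add.commute)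
  next
    fix p u v w and a b :: real
    assume p: "p \<in> carrier_of A" and t: "u \<in> tangent_space A p" "v \<in> tangent_space A p" "w \<in> tangent_space A p"
    obtain c where c: "c \<in> A" "p \<in> fst c" using carrier_chart[OF p] by blast
    have "a *\<^sub>R u + b *\<^sub>R v \<in> tangent_space A p"
      by (intro subspace_add subspace_scale subspace_tangent_space t)
    then show "h p (a *\<^sub>R u + b *\<^sub>R v) w = a * h p u w + b * h p v w"
      using t by (simp add: hB[OF c] inner_add_left)
  next
    fix p u assume p: "p \<in> carrier_of A" "u \<in> tangent_space A p" "u \<noteq> 0"
    then have "(p, u) \<in> tangent_bundle A" by (simp add: tangent_bundle_def)
    then show "h p u u > 0" using hFF[of p u] F_pos[of p u] p(3) by simp
  next
    fix c and u w :: "real^'n" assume c: "c \<in> A"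
    let ?D = "rng c"
    have sm: "smooth_on ?D (\<lambda>x. E c (x, y))" for y
    proof (cases "y = 0")
      case True
      have "0 = E c (x, y)" if "x \<in> ?D" for x
        using E[OF c that, of y] by (simp add: True)
      then show ?thesis by (rule smooth_on_cong[OF open_chart[OF c] smooth_on_const])
    next
      case False
      have "bounded_linear (\<lambda>x. (x::real^'n, 0::real^'n))" by (intro bounded_linear_intros)
      from smooth_on_affine_comp[OF this open_slit[OF c] smooth_E[OF c], of "(0, y)"]
      have "smooth_on ((\<lambda>x. (0, y) + (x, 0)) -` (?D \<times> - {0})) (\<lambda>x. E c (x, y))" by simp
      then show ?thesis by (rule smooth_on_subset) (use False in auto)
    qed
    have "smooth_on ?D (\<lambda>x. E c (x, u + w) + ((- 1) * E c (x, u) + (- 1) * E c (x, w)))"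
      by (intro smooth_on_add smooth_on_mult smooth_on_const sm open_chart c)
    then show "smooth_on ?D (\<lambda>x. let p = chart_inv c x in h p (coord_vector A c p u) (coord_vector A c p w))"
    proof (rule smooth_on_cong[OF open_chart[OF c]])
      fix x assume x: "x \<in> ?D"
      have "coord_vector A c (chart_inv c x) u + coord_vector A c (chart_inv c x) w = coord_vector A c (chart_inv c x) (u + w)"
        using coord_vector_linear(1)[OF c chart_inv_in[OF x]] by simp
      then show "E c (x, u + w) + ((- 1) * E c (x, u) + (- 1) * E c (x, w))
          = (let p = chart_inv c x in h p (coord_vector A c p u) (coord_vector A c p w))"
        by (simp add: Let_def h_def E_eq Fc_eq[OF c x] diff_divide_distrib)
    qed
  qed
  moreover have "F (p, v) = sqrt (h p v v)" if "(p, v) \<in> tangent_bundle A" for p v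
    using hFF[OF that] F_nonneg[OF that] by simp
  ultimately show ?thesis unfolding riemannian_finsler_def by auto
qed

end

theorem theorem2:
  fixes A :: "('a, real^'n::finite) chart set"
    and F :: "('a, 'n) finsler"
  assumes "closed_manifold A"
    and "finsler_structure A F"
    and "no_conjugate_points A F"
    and "transitive_geodesic_flow A F"
    and "continuous_on_unit_bundle A F (stable_green_bundle A F)"
    and "continuous_on_unit_bundle A F (unstable_green_bundle A F)"
    and "\<exists>\<sigma>. hyperbolic_closed_geodesic A F \<sigma>"
    and "constant_S_curvature A F"
  shows "riemannian_finsler A F"
proof -
  interpret finsler_manifold A F
    using assms(1,2) by unfold_locales (auto simp: closed_manifold_def)
  obtain K where S: "\<And>\<theta>. \<theta> \<in> slit_tangent_bundle A \<Longrightarrow> S_curvature A F \<theta> = K * F \<theta>"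
    using assms(8) unfolding constant_S_curvature_def by blast
  have "K = 0"
  proof -
    obtain \<sigma> T where \<sigma>: "geodesic A F \<sigma>" and F1: "\<And>t. F (lift \<sigma> t) = 1"
      and T: "T > 0" "\<And>t. \<sigma> (t + T) = \<sigma> t"
      using assms(7) unfolding hyperbolic_closed_geodesic_def by blast
    let ?\<tau> = "\<lambda>t. distortion A F (lift \<sigma> t)"
    have "((\<lambda>t. ?\<tau> t - K * t) has_real_derivative 0) (at t)" for t
      using distortion_along_geodesic[OF \<sigma> S, of t] F1 by (auto intro!: derivative_eq_intros)
    then have "?\<tau> T - K * T = ?\<tau> 0 - K * 0" by (intro DERIV_isconst_all) blast
    moreover have "(\<lambda>t. \<sigma> (T + t)) = \<sigma>" using T(2) by (simp add: add.commute)
    then have "lift \<sigma> T = lift \<sigma> 0"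
      using smooth_curve_shift(3)[OF geodesicD(1)[OF \<sigma>], of T 0] by simp
    ultimately show ?thesis using T(1) by simp
  qed
  obtain \<theta> where \<theta>: "\<theta> \<in> unit_tangent_bundle A F"
    and dense: "subtopology (manifold_topology (tangent_atlas A)) (unit_tangent_bundle A F)
         closure_of range (\<lambda>t. geodesic_flow A F t \<theta>) = unit_tangent_bundle A F"
    using assms(4) unfolding transitive_geodesic_flow_def by blast
  obtain \<sigma> where \<sigma>: "geodesic A F \<sigma>" "lift \<sigma> 0 = \<theta>"
    using dense_orbit_geodesic[OF \<theta> dense] by blast
  have orbit: "distortion A F \<eta> = distortion A F \<theta>" if "\<eta> \<in> range (\<lambda>t. geodesic_flow A F t \<theta>)" for \<eta>
  proof -
    obtain t where "\<eta> = geodesic_flow A F t \<theta>" using \<open>\<eta> \<in> range _\<close> by blast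
    then have \<eta>: "\<eta> = lift \<sigma> t"
      using geodesic_flow_lift[OF \<sigma>(1), of t 0] \<sigma>(2) by simp
    have "((\<lambda>t. distortion A F (lift \<sigma> t)) has_real_derivative 0) (at t)" for t
      using distortion_along_geodesic[OF \<sigma>(1) S, of t] \<open>K = 0\<close> by simp
    then have "distortion A F (lift \<sigma> t) = distortion A F (lift \<sigma> 0)"
      using DERIV_isconst_all[of "\<lambda>t. distortion A F (lift \<sigma> t)" t 0] by blast
    then show ?thesis using \<eta> \<sigma>(2) by simp
  qed
  have "distortion A F \<xi> = distortion A F \<theta>" if \<xi>: "\<xi> \<in> unit_tangent_bundle A F" for \<xi>
  proof (rule ccontr)
    assume ne: "distortion A F \<xi> \<noteq> distortion A F \<theta>"
    obtain c where c: "c \<in> A" "\<xi> \<in> fst (TC c)" "snd (TC c) \<xi> \<in> rng c \<times> - {0}"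
      using unit_chart[OF \<xi>] by blast
    have eq: "distortion A F \<eta> = chart_distortion c (snd (TC c) \<eta>)"
      if "\<eta> \<in> unit_tangent_bundle A F" "\<eta> \<in> fst (TC c)" for \<eta>
    proof (cases \<eta>)
      case (Pair p v)
      then show ?thesis
        using distortion_eq_chart_distortion[OF c(1), of p v] unit_nonzero[of p v] that
        by (simp add: tangent_chart_fst tangent_chart_snd)
    qed
    have "continuous_on (rng c \<times> - {0}) (chart_distortion c)"
      using chart_distortion_differentiable[OF c(1)]
      by (intro continuous_at_imp_continuous_on ballI differentiable_imp_continuous_within) blast
    then have W: "open ((rng c \<times> - {0}) \<inter> chart_distortion c -` (- {distortion A F \<theta>}))"
      by (rule continuous_open_preimage[OF _ open_slit[OF c(1)]]) auto
    have "snd (TC c) \<xi> \<in> (rng c \<times> - {0}) \<inter> chart_distortion c -` (- {distortion A F \<theta>})"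
      using c(3) ne eq[OF \<xi> c(2)] by simp
    from dense_orbit_chart[OF dense \<xi> c(1,2) W this]
    obtain \<eta> where \<eta>: "\<eta> \<in> range (\<lambda>t. geodesic_flow A F t \<theta>)" "\<eta> \<in> unit_tangent_bundle A F"
      "\<eta> \<in> fst (TC c)" "chart_distortion c (snd (TC c) \<eta>) \<noteq> distortion A F \<theta>"
      by blast
    then show False using orbit[OF \<eta>(1)] eq[OF \<eta>(2,3)] by simp
  qed
  then show ?thesis
    by (intro riemannian_if_fibre_hessian_const hessian_const_if_distortion_const)
qed

end
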